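(* For all Weihrauch degrees $\mathbf a,\mathbf b\in\mathcal W$: \begin{enumerate} \item $(\mathbf a\sqcup\mathbf b)^*=\mathbf a^*\times\mathbf b^*$ \item $(\mathbf a\times\mathbf b)^*\leq_{\mathrm W}\mathbf a^*\times\mathbf b^*$ \item $(\mathbf a\sqcap\mathbf b)^*=\mathbf a^*\sqcap\mathbf b^*$ \item $(\mathbf a\star\mathbf b)^*\leq_{\mathrm W}\mathbf a^*\star\mathbf b^*$ \item $\widehat{\mathbf a}\times\widehat{\mathbf b}\leq_{\mathrm W}\widehat{(\mathbf a\sqcup\mathbf b)}$ \item $\widehat{\mathbf a}\sqcup\widehat{\mathbf b}\leq_{\mathrm W}\widehat{(\mathbf a\sqcup\mathbf b)}$ \item $\widehat{(\mathbf a\times\mathbf b)}=\widehat{\mathbf a}\times\widehat{\mathbf b}$ \item $\widehat{(\mathbf a\sqcap\mathbf b)}\leq_{\mathrm W}\widehat{\mathbf a}\sqcap\widehat{\mathbf b}$ \item $\widehat{(\mathbf a\star\mathbf b)}\leq_{\mathrm W}\widehat{\mathbf a}\star\widehat{\mathbf b}$ \end{enumerate} In general, none of the reductions "$\leq_{\mathrm W}$" can be replaced by "$=$" (i.e., for each item stated with $\leq_{\mathrm W}$ there are degrees for which equality fails).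
   Context: A represented space $\mathbf X=(X,\delta_X)$ is a set $X$ with a partial surjection $\delta_X:\subseteq\mathbb N^{\mathbb N}\to X$ (the symbol $\subseteq$ marks possibly partial functions). A multi-valued function $f:\subseteq\mathbf X\rightrightarrows\mathbf Y$ assigns to each $x\in\mathrm{dom}(f)\subseteq X$ a nonempty set $f(x)\subseteq Y$. Composition: $z\in(f\circ g)(x)$ iff $g(x)\subseteq\mathrm{dom}(f)$ and $z\in f(y)$ for some $y\in g(x)$ (with $x\in\mathrm{dom}(g)$). $F:\subseteq\mathbb N^{\mathbb N}\to\mathbb N^{\mathbb N}$ is a realizer of $f$, $F\vdash f$, if $\delta_YF(p)\in f\delta_X(p)$ for all $p\in\mathrm{dom}(f\delta_X)$. $f\leq_{\mathrm W}g$ iff there are computable $K,H:\subseteq\mathbb N^{\mathbb N}\to\mathbb N^{\mathbb N}$ with $K\langle\mathrm{id},GH\rangle\vdash f$ for all $G\vdash g$. $\mathcal W$ is the partially ordered set of equivalence classes (Weihrauch degrees), extended by an additional top element $\infty$ (the Axiom of Choice for Baire space is assumed). Operations (well defined on degrees), for $f:\subseteq\mathbf X\rightrightarrows\mathbf Y$, $g:\subseteq\mathbf U\rightrightarrows\mathbf V$: $(f\times g)(x,u)=f(x)\times g(u)$; $f\sqcup g:\subseteq\mathbf X\sqcup\mathbf U\rightrightarrows\mathbf Y\sqcup\mathbf V$, $(f\sqcup g)(0,x)=\{0\}\times f(x)$, $(f\sqcup g)(1,u)=\{1\}\times g(u)$; $f\sqcap g:\subseteq\mathbf X\times\mathbf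 U\rightrightarrows\mathbf Y\sqcup\mathbf V$, $(f\sqcap g)(x,u)=(\{0\}\times f(x))\cup(\{1\}\times g(u))$ (canonical representations of products and coproducts). With $\mathbf X^0$ the one-point space $\{1\}$ (totally represented), $\mathbf X^{n+1}=\mathbf X^n\times\mathbf X$ and $\mathbf X^*=\bigsqcup_{n\in\mathbb N}\mathbf X^n$, the operation $f^*:\subseteq\mathbf X^*\rightrightarrows\mathbf Y^*$ is $f^*(0,1)=(0,1)$, $f^*(n+1,(x_0,\dots,x_n))=\{n+1\}\times f(x_0)\times\dots\times f(x_n)$. With $\widehat{\mathbf X}=\mathbf X\times\mathbf X\times\cdots$ (countable product), $\widehat f:\subseteq\widehat{\mathbf X}\rightrightarrows\widehat{\mathbf Y}$ is $\widehat f(x_0,x_1,\dots)=\prod_{i\in\mathbb N}f(x_i)$. Space $\mathcal M(\mathbf X,\mathbf Y)$: fix a universal Turing machine; $\Phi_p:\subseteq\mathbb N^{\mathbb N}\to\mathbb N^{\mathbb N}$ is the partial function it computes with first input $p$, i.e. $\Phi_p(q)=r$ iff on input $\langle p,q\rangle$ it produces the infinite output $r$. Let $\delta_X^{\mathrm{cyl}}\langle p,q\rangle:=\delta_X(p)$, $\Phi_p^{\mathbf X,\mathbf Y}:=\delta_Y\circ\Phi_p\circ(\delta_X^{\mathrm{cyl}})^{-1}$. $\mathcal M(\mathbf X,\mathbf Y)$ is the represented space of all $\Phi_p^{\mathbf X,\mathbf Y}$, with $p$ as a name. Compositional product: with $g^{\mathrm t}_{\mathbf Z}:\subseteq\mathcal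 M(\mathbf Y,\mathbf Z)\times\mathbf X\rightrightarrows\mathbf Z$, $g^{\mathrm t}_{\mathbf Z}(h,x):=(h\circ g)(x)$ for $g:\subseteq\mathbf X\rightrightarrows\mathbf Y$, and $f:\subseteq\mathbf U\rightrightarrows\mathbf V$, put $f\star g:=(\mathrm{id}_{\mathbb N^{\mathbb N}}\times f)\circ g^{\mathrm t}_{\mathbb N^{\mathbb N}\times\mathbf U}$; this is well defined on degrees. Conventions for $\infty$: $\mathbf a\times\infty=\infty\times\mathbf a=\mathbf a\star\infty=\infty\star\mathbf a=\mathbf a\sqcup\infty=\infty\sqcup\mathbf a=\infty$, $\mathbf a\sqcap\infty=\infty\sqcap\mathbf a=\mathbf a$, $\infty^*=\widehat{\infty}=\infty$. *)

theory Defs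
  imports Main "HOL-Library.Nat_Bijection"
begin

section \<open>Computable functions on Baire space\<close>

type_synonym baire = "nat \<Rightarrow> nat"

text \<open>
  The model of computation is Kleene's: programs for partial recursive functions relative to an
  oracle \<open>p\<close>. A program with oracle \<open>p\<close> that computes \<open>n \<mapsto> q n\<close> is the same thing as a Turing
  machine that, on the infinite input \<open>p\<close>, writes the infinite output \<open>q\<close>.
\<close>

datatype program =
    Zero
  | Succ
  | Proj nat
  | Oracle
  | Comp program "program list"
  | PrimRec program program
  | Mu program

fun eval :: "baire \<Rightarrow> program \<Rightarrow> nat list \<Rightarrow> nat option" where
  "eval p Zero xs = Some 0"
| "eval p Succ xs = (case xs of [] \<Rightarrow> None | x # _ \<Rightarrow> Some (Suc x))"
| "eval p (Proj i) xs = (if i < length xs then Some (xs ! i) else None)"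
| "eval p Oracle xs = (case xs of [] \<Rightarrow> None | x # _ \<Rightarrow> Some (p x))"
| "eval p (Comp f gs) xs =
     (let ys = map (\<lambda>g. eval p g xs) gs
      in if None \<in> set ys then None else eval p f (map the ys))"
| "eval p (PrimRec f g) xs =
     (case xs of [] \<Rightarrow> None
      | n # zs \<Rightarrow> rec_nat (eval p f zs)
          (\<lambda>m r. case r of None \<Rightarrow> None | Some y \<Rightarrow> eval p g (m # y # zs)) n)"
| "eval p (Mu f) xs =
     (if \<exists>n. eval p f (n # xs) = Some 0 \<and> (\<forall>m<n. eval p f (m # xs) \<noteq> None)
      then Some (LEAST n. eval p f (n # xs) = Some 0) else None)"

definition run :: "program \<Rightarrow> baire \<rightharpoonup> baire" where
  "run M p = (if \<forall>n. eval p M [n] \<noteq> None then Some (\<lambda>n. the (eval p M [n])) else None)"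

text \<open>A partial function is computable if some machine is correct on its domain.\<close>

definition computable :: "(baire \<rightharpoonup> baire) \<Rightarrow> bool" where
  "computable F \<longleftrightarrow> (\<exists>M. \<forall>p\<in>dom F. run M p = F p)"

definition pair :: "baire \<Rightarrow> baire \<Rightarrow> baire" where
  "pair p q = (\<lambda>n. if even n then p (n div 2) else q (n div 2))"

definition left :: "baire \<Rightarrow> baire" where
  "left r = (\<lambda>n. r (2 * n))"

definition right :: "baire \<Rightarrow> baire" where
  "right r = (\<lambda>n. r (2 * n + 1))"

definition component :: "baire \<Rightarrow> nat \<Rightarrow> baire" where
  "component r i = (\<lambda>k. r (prod_encode (i, k)))"

definition tail :: "baire \<Rightarrow> baire" where
  "tail r = (\<lambda>n. r (Suc n))"

text \<open>
  A universal machine simulates every machine \<open>M\<close>, including its domain: on the first input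
  \<open>S p\<close>, a code of \<open>M\<close> together with the parameter \<open>p\<close>, it computes \<open>q \<mapsto> M\<langle>p, q\<rangle>\<close>. The
  usual universal program, which decodes \<open>M\<close> from the first symbol of its input, satisfies this
  with \<open>S\<close> prepending a Goedel number of \<open>M\<close> to \<open>p\<close>.
\<close>

definition universal :: "program \<Rightarrow> bool" where
  "universal U \<longleftrightarrow>
     (\<forall>M. \<exists>S :: baire \<Rightarrow> baire. computable (\<lambda>p. Some (S p)) \<and>
        (\<forall>p q. run U (pair (S p) q) = run M (pair p q)))"

definition Phi :: "program \<Rightarrow> baire \<Rightarrow> baire \<rightharpoonup> baire" where
  "Phi U p = (\<lambda>q. run U (pair p q))"


section \<open>Represented spaces and multi-valued functions\<close>

text \<open>
  A represented space is given by its representation \<open>d :: baire \<rightharpoonup> 'a\<close>; the underlying set is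
  \<open>ran d\<close>. A multi-valued function is a map \<open>f :: 'a \<Rightarrow> 'b set\<close> with domain \<open>{x. f x \<noteq> {}}\<close>.
\<close>

definition mdom :: "('a \<Rightarrow> 'b set) \<Rightarrow> 'a set" where
  "mdom f = {x. f x \<noteq> {}}"

definition mcomp :: "('b \<Rightarrow> 'c set) \<Rightarrow> ('a \<Rightarrow> 'b set) \<Rightarrow> 'a \<Rightarrow> 'c set" (infixr "\<circ>\<^sub>M" 55) where
  "(f \<circ>\<^sub>M g) x = {z. x \<in> mdom g \<and> g x \<subseteq> mdom f \<and> (\<exists>y\<in>g x. z \<in> f y)}"

definition mfun :: "('a \<rightharpoonup> 'b) \<Rightarrow> 'a \<Rightarrow> 'b set" where
  "mfun F x = set_option (F x)"

definition minverse :: "('a \<rightharpoonup> 'b) \<Rightarrow> 'b \<Rightarrow> 'a set" where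
  "minverse F y = {x. F x = Some y}"

definition baire_rep :: "baire \<rightharpoonup> baire" where
  "baire_rep = Some"

definition prod_rep :: "(baire \<rightharpoonup> 'a) \<Rightarrow> (baire \<rightharpoonup> 'b) \<Rightarrow> baire \<rightharpoonup> 'a \<times> 'b" where
  "prod_rep d e r =
     (case (d (left r), e (right r)) of (Some x, Some y) \<Rightarrow> Some (x, y) | _ \<Rightarrow> None)"

definition sum_rep :: "(baire \<rightharpoonup> 'a) \<Rightarrow> (baire \<rightharpoonup> 'b) \<Rightarrow> baire \<rightharpoonup> 'a + 'b" where
  "sum_rep d e r =
     (if r 0 = 0 then map_option Inl (d (tail r))
      else if r 0 = 1 then map_option Inr (e (tail r))
      else None)"

text \<open>The \<open>n\<close>-tuples over a space are represented as lists of length \<open>n\<close>.\<close>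

fun power_rep :: "(baire \<rightharpoonup> 'a) \<Rightarrow> nat \<Rightarrow> baire \<rightharpoonup> 'a list" where
  "power_rep d 0 r = Some []"
| "power_rep d (Suc n) r =
     (case (power_rep d n (left r), d (right r)) of
        (Some xs, Some x) \<Rightarrow> Some (xs @ [x]) | _ \<Rightarrow> None)"

definition list_rep :: "(baire \<rightharpoonup> 'a) \<Rightarrow> baire \<rightharpoonup> 'a list" where
  "list_rep d r = power_rep d (r 0) (tail r)"

definition seq_rep :: "(baire \<rightharpoonup> 'a) \<Rightarrow> baire \<rightharpoonup> (nat \<Rightarrow> 'a)" where
  "seq_rep d r =
     (if \<forall>i. d (component r i) \<noteq> None then Some (\<lambda>i. the (d (component r i))) else None)"

definition cyl_rep :: "(baire \<rightharpoonup> 'a) \<Rightarrow> baire \<rightharpoonup> 'a" where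
  "cyl_rep d r = d (left r)"

text \<open>The representation of the space \<open>\<M>(X, Y)\<close>; it is total.\<close>

definition fun_rep ::
    "program \<Rightarrow> (baire \<rightharpoonup> 'a) \<Rightarrow> (baire \<rightharpoonup> 'b) \<Rightarrow> baire \<rightharpoonup> ('a \<Rightarrow> 'b set)" where
  "fun_rep U d e p = Some (mfun e \<circ>\<^sub>M mfun (Phi U p) \<circ>\<^sub>M minverse (cyl_rep d))"


section \<open>Problems and Weihrauch reducibility\<close>

record ('a, 'b) problem =
  src :: "baire \<rightharpoonup> 'a"
  tgt :: "baire \<rightharpoonup> 'b"
  val :: "'a \<Rightarrow> 'b set"

definition is_problem :: "('a, 'b) problem \<Rightarrow> bool" where
  "is_problem f \<longleftrightarrow> (\<forall>x. val f x \<noteq> {} \<longrightarrow> x \<in> ran (src f) \<and> val f x \<subseteq> ran (tgt f))"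

definition realizes :: "(baire \<rightharpoonup> baire) \<Rightarrow> ('a, 'b) problem \<Rightarrow> bool" (infix "\<turnstile>\<^sub>R" 50) where
  "F \<turnstile>\<^sub>R f \<longleftrightarrow>
     (\<forall>p x. src f p = Some x \<and> x \<in> mdom (val f) \<longrightarrow>
        (\<exists>q y. F p = Some q \<and> tgt f q = Some y \<and> y \<in> val f x))"

definition reducible :: "('a, 'b) problem \<Rightarrow> ('c, 'd) problem \<Rightarrow> bool" where
  "reducible f g \<longleftrightarrow>
     (\<exists>K H. computable K \<and> computable H \<and>
        (\<forall>G. G \<turnstile>\<^sub>R g \<longrightarrow> (\<lambda>p. Option.bind ((G \<circ>\<^sub>m H) p) (\<lambda>r. K (pair p r))) \<turnstile>\<^sub>R f))"

definition equivalent :: "('a, 'b) problem \<Rightarrow> ('c, 'd) problem \<Rightarrow> bool" where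
  "equivalent f g \<longleftrightarrow> reducible f g \<and> reducible g f"

definition prod_problem ::
    "('a, 'b) problem \<Rightarrow> ('c, 'd) problem \<Rightarrow> ('a \<times> 'c, 'b \<times> 'd) problem" where
  "prod_problem f g =
     \<lparr>src = prod_rep (src f) (src g), tgt = prod_rep (tgt f) (tgt g),
      val = (\<lambda>(x, u). val f x \<times> val g u)\<rparr>"

definition sup_problem ::
    "('a, 'b) problem \<Rightarrow> ('c, 'd) problem \<Rightarrow> ('a + 'c, 'b + 'd) problem" where
  "sup_problem f g =
     \<lparr>src = sum_rep (src f) (src g), tgt = sum_rep (tgt f) (tgt g),
      val = case_sum (\<lambda>x. Inl ` val f x) (\<lambda>u. Inr ` val g u)\<rparr>"

text \<open>
  The meet is defined on pairs of instances only, whence the case distinction: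
  \<open>val f x <+> val g u\<close> is nonempty as soon as one of the two sets is.
\<close>

definition inf_problem ::
    "('a, 'b) problem \<Rightarrow> ('c, 'd) problem \<Rightarrow> ('a \<times> 'c, 'b + 'd) problem" where
  "inf_problem f g =
     \<lparr>src = prod_rep (src f) (src g), tgt = sum_rep (tgt f) (tgt g),
      val = (\<lambda>(x, u). if x \<in> mdom (val f) \<and> u \<in> mdom (val g)
                       then val f x <+> val g u else {})\<rparr>"

definition star_problem :: "('a, 'b) problem \<Rightarrow> ('a list, 'b list) problem" where
  "star_problem f =
     \<lparr>src = list_rep (src f), tgt = list_rep (tgt f),
      val = (\<lambda>xs. {ys. list_all2 (\<lambda>x y. y \<in> val f x) xs ys})\<rparr>"

definition hat_problem :: "('a, 'b) problem \<Rightarrow> (nat \<Rightarrow> 'a, nat \<Rightarrow> 'b) problem" where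
  "hat_problem f =
     \<lparr>src = seq_rep (src f), tgt = seq_rep (tgt f),
      val = (\<lambda>xs. {ys. \<forall>i. ys i \<in> val f (xs i)})\<rparr>"

definition id_baire :: "(baire, baire) problem" where
  "id_baire = \<lparr>src = baire_rep, tgt = baire_rep, val = (\<lambda>p. {p})\<rparr>"

text \<open>
  \<open>transp_problem U g e\<close> is the problem \<open>(h, x) \<mapsto> (h \<circ> g)(x)\<close> on \<open>\<M>(Y, Z) \<times> X\<close>, where \<open>Y\<close> is
  the target of \<open>g\<close> and \<open>e\<close> represents \<open>Z\<close>. The type of \<open>h\<close> also contains functions outside
  \<open>\<M>(Y, Z)\<close>, which are excluded from the domain.
\<close>

definition transp_problem ::
    "program \<Rightarrow> ('a, 'b) problem \<Rightarrow> (baire \<rightharpoonup> 'z) \<Rightarrow> (('b \<Rightarrow> 'z set) \<times> 'a, 'z) problem" where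
  "transp_problem U g e =
     \<lparr>src = prod_rep (fun_rep U (tgt g) e) (src g), tgt = e,
      val = (\<lambda>(h, x). if h \<in> ran (fun_rep U (tgt g) e) then (h \<circ>\<^sub>M val g) x else {})\<rparr>"

definition comp_problem :: "('b, 'c) problem \<Rightarrow> ('a, 'b) problem \<Rightarrow> ('a, 'c) problem" where
  "comp_problem f g = \<lparr>src = src g, tgt = tgt f, val = val f \<circ>\<^sub>M val g\<rparr>"

definition compprod_problem ::
    "program \<Rightarrow> ('u, 'v) problem \<Rightarrow> ('a, 'b) problem \<Rightarrow>
       (('b \<Rightarrow> (baire \<times> 'u) set) \<times> 'a, baire \<times> 'v) problem" where
  "compprod_problem U f g =
     comp_problem (prod_problem id_baire f)
       (transp_problem U g (prod_rep baire_rep (src f)))"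


section \<open>Weihrauch degrees\<close>

text \<open>
  Degrees are equivalence classes of problems whose underlying sets consist of points of Baire
  space. This is no restriction: a represented space is computably isomorphic to the one obtained
  by replacing each point by one of its names.
\<close>

datatype wdegree = Top_degree | Degree "(baire, baire) problem set"

definition degree_of :: "('a, 'b) problem \<Rightarrow> wdegree" where
  "degree_of f = Degree {g. is_problem g \<and> equivalent f g}"

definition weihrauch_degrees :: "wdegree set" ("\<W>") where
  "\<W> = insert Top_degree (degree_of ` {f :: (baire, baire) problem. is_problem f})"

definition representative :: "(baire, baire) problem set \<Rightarrow> (baire, baire) problem" where
  "representative A = (SOME f. f \<in> A)"

fun wle :: "wdegree \<Rightarrow> wdegree \<Rightarrow> bool" (infix "\<le>\<^sub>W" 50) where
  "a \<le>\<^sub>W Top_degree \<longleftrightarrow> True"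
| "Top_degree \<le>\<^sub>W Degree B \<longleftrightarrow> False"
| "Degree A \<le>\<^sub>W Degree B \<longleftrightarrow> reducible (representative A) (representative B)"

fun wprod :: "wdegree \<Rightarrow> wdegree \<Rightarrow> wdegree" (infixl "\<times>\<^sub>W" 70) where
  "Degree A \<times>\<^sub>W Degree B = degree_of (prod_problem (representative A) (representative B))"
| "a \<times>\<^sub>W b = Top_degree"

fun wsup :: "wdegree \<Rightarrow> wdegree \<Rightarrow> wdegree" (infixl "\<squnion>\<^sub>W" 65) where
  "Degree A \<squnion>\<^sub>W Degree B = degree_of (sup_problem (representative A) (representative B))"
| "a \<squnion>\<^sub>W b = Top_degree"

fun winf :: "wdegree \<Rightarrow> wdegree \<Rightarrow> wdegree" (infixl "\<sqinter>\<^sub>W" 70) where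
  "Degree A \<sqinter>\<^sub>W Degree B = degree_of (inf_problem (representative A) (representative B))"
| "a \<sqinter>\<^sub>W Top_degree = a"
| "Top_degree \<sqinter>\<^sub>W b = b"

fun wcompprod :: "program \<Rightarrow> wdegree \<Rightarrow> wdegree \<Rightarrow> wdegree" where
  "wcompprod U (Degree A) (Degree B) =
     degree_of (compprod_problem U (representative A) (representative B))"
| "wcompprod U a b = Top_degree"

fun wstar :: "wdegree \<Rightarrow> wdegree" ("_\<^sup>\<star>" [1000] 1000) where
  "(Degree A)\<^sup>\<star> = degree_of (star_problem (representative A))"
| "Top_degree\<^sup>\<star> = Top_degree"

fun wpar :: "wdegree \<Rightarrow> wdegree" where
  "wpar (Degree A) = degree_of (hat_problem (representative A))"
| "wpar Top_degree = Top_degree"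

end

theory Submission
  imports Defs "HOL-Library.Countable"
begin

text \<open>
  Weihrauch reducibility depends only on the relation between the names of instances and the names
  of their solutions. On such relations, \<open>h\<close> reduces to \<open>f \<star> g\<close> iff it is solved by one computable
  query to \<open>g\<close>, followed by one to \<open>f\<close> that may depend on the first answer; this description is
  preserved when all computable steps are carried out entrywise on lists or sequences, which gives
  the two inequalities for the compositional product. The other reductions rearrange names.

  Some separations use a noncomputable \<open>q\<close>. If \<open>b\<close> has no instances, then those of \<open>a \<times> b\<close>
  and \<open>a \<star> b\<close> disappear, and with the constant \<open>q\<close> for \<open>a\<close> the degrees \<open>a* \<times> b*\<close> and \<open>a* \<star> b*\<close> are
  still not computable; such a \<open>b\<close> also makes a product of parallelizations empty, but not the
  parallelized join. If \<open>b\<close> computes single values of \<open>q\<close> and \<open>a\<close> is defined at \<open>q\<close> only, then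
  every instance of the parallelization of \<open>a \<star> b\<close> computes \<open>q\<close>. The separations that involve
  joins and meets of parallelizations take for \<open>a\<close> the limited principle of omniscience and for \<open>b\<close>
  the task to avoid the value \<open>v n\<close> on input \<open>n\<close>. By continuity, answers to \<open>b\<close> do not help with
  \<open>a\<close>, and \<open>v\<close> diagonalizes against all reductions that use only finitely many answers to \<open>b\<close>.
\<close>


section \<open>Kleene programs\<close>

text \<open>A reduction must work for every realizer, but a realizer may be altered at a single
  point and remain one. Hence the final step has to be correct for every solution of the query, and
  realizers disappear. Empty values mark names outside the domain, so each inequality includes a
  check of domains. There a problem without instances can separate: the empty list is always an
  instance of a finite parallelization, whereas a parallelization asks infinitely many questions.

  Computability is the larger obstacle. Composition of Kleene programs is strict and
  \<open>computable\<close> concerns partial functions, so a branch that is not taken must never be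
  evaluated. Moreover, running a program on all entries of a sequence has to be one program with the
  index as a parameter; oracle substitution provides it.

  In the two diagonal separations a single instance asks \<open>b\<close> at every number, hence
  also at the code of the very reduction that is to fail. Such codes exist because programs are
  countable.\<close>

instance program :: countable
  by countable_datatype

section \<open>Dependence of computations on finitely many oracle values\<close>

lemma uniform_threshold:
  assumes "\<forall>x\<in>set xs. \<exists>L. \<forall>L'\<ge>L. Q x L'"
  shows "\<exists>L::nat. \<forall>L'\<ge>L. \<forall>x\<in>set xs. Q x L'"
  using assms
proof (induction xs)
  case (Cons a xs)
  then obtain L1 L2 where "\<forall>L'\<ge>L1. Q a L'" "\<forall>L'\<ge>L2. \<forall>x\<in>set xs. Q x L'"
    by auto
  then have "\<forall>L'\<ge>max L1 L2. \<forall>x\<in>set (a # xs). Q x L'" by auto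
  then show ?case by blast
qed auto

definition agree :: "nat \<Rightarrow> baire \<Rightarrow> baire \<Rightarrow> bool" where
  "agree L p p' \<longleftrightarrow> (\<forall>n<L. p' n = p n)"

lemma agree_mono: "agree L p p' \<Longrightarrow> L' \<le> L \<Longrightarrow> agree L' p p'"
  by (auto simp: agree_def)

lemma eval_Comp:
  "eval p (Comp f gs) xs =
     (if \<exists>g\<in>set gs. eval p g xs = None then None
      else eval p f (map (\<lambda>g. the (eval p g xs)) gs))"
  by (auto simp: Let_def comp_def image_iff Bex_def)

lemma eval_PrimRec_Cons:
  "eval p (PrimRec f g) (n # zs) = rec_nat (eval p f zs)
     (\<lambda>m r. Option.bind r (\<lambda>y. eval p g (m # y # zs))) n"
proof -
  have "(\<lambda>m r. case r of None \<Rightarrow> None | Some y \<Rightarrow> eval p g (m # y # zs))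
    = (\<lambda>m r. Option.bind r (\<lambda>y. eval p g (m # y # zs)))"
    by (intro ext) (simp split: option.split)
  then show ?thesis by simp
qed

declare eval.simps(5,6)[simp del]

lemma eval_PrimRec_Nil [simp]: "eval p (PrimRec f g) [] = None"
  by (simp add: eval.simps)

text \<open>A terminating evaluation asks the oracle only finitely often, so a prefix of the oracle
  fixes its value. Nothing similar holds for divergence, which may depend on the whole
  oracle.\<close>

lemma eval_continuous:
  "eval p M xs = Some y \<Longrightarrow> \<exists>L. \<forall>p'. agree L p p' \<longrightarrow> eval p' M xs = Some y"
proof (induction M arbitrary: xs y)
  case Oracle
  then obtain x zs where "xs = x # zs" "y = p x" by (cases xs) auto
  then show ?case by (intro exI[of _ "Suc x"]) (auto simp: agree_def)
next
  case (Comp f gs)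
  have d: "\<forall>g\<in>set gs. eval p g xs \<noteq> None"
    and e: "eval p f (map (\<lambda>g. the (eval p g xs)) gs) = Some y"
    using Comp.prems by (auto simp: eval_Comp split: if_splits)
  obtain L1 where L1: "\<forall>p'. agree L1 p p' \<longrightarrow> eval p' f (map (\<lambda>g. the (eval p g xs)) gs) = Some y"
    using Comp.IH(1)[OF e] by blast
  have "\<forall>g\<in>set gs. \<exists>L. \<forall>L'\<ge>L. \<forall>p'. agree L' p p' \<longrightarrow> eval p' g xs = eval p g xs"
  proof
    fix g assume g: "g \<in> set gs"
    with d obtain z where z: "eval p g xs = Some z" by auto
    then obtain L where "\<forall>p'. agree L p p' \<longrightarrow> eval p' g xs = Some z"
      using Comp.IH(2)[OF g z] by blast
    then show "\<exists>L. \<forall>L'\<ge>L. \<forall>p'. agree L' p p' \<longrightarrow> eval p' g xs = eval p g xs"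
      using z agree_mono by metis
  qed
  from uniform_threshold[OF this] obtain L2 where
    L2: "\<forall>L'\<ge>L2. \<forall>g\<in>set gs. \<forall>p'. agree L' p p' \<longrightarrow> eval p' g xs = eval p g xs" by blast
  show ?case
  proof (intro exI[of _ "max L1 L2"] allI impI)
    fix p' assume a: "agree (max L1 L2) p p'"
    have "eval p' g xs = eval p g xs" if "g \<in> set gs" for g
      using L2 a that by (metis max.cobounded2)
    moreover have "eval p' f (map (\<lambda>g. the (eval p g xs)) gs) = Some y"
      using L1 agree_mono[OF a, of L1] by simp
    ultimately show "eval p' (Comp f gs) xs = Some y"
      using d by (simp add: eval_Comp cong: map_cong)
  qed
next
  case (PrimRec f g)
  then obtain n zs where xs: "xs = n # zs" by (cases xs) auto
  have "\<exists>L. \<forall>p'. agree L p p' \<longrightarrow> eval p' (PrimRec f g) (n # zs) = Some y"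
    if "eval p (PrimRec f g) (n # zs) = Some y" for n y
    using that
  proof (induction n arbitrary: y)
    case 0
    then show ?case using PrimRec.IH(1)[of zs y] by (simp add: eval_PrimRec_Cons)
  next
    case (Suc n)
    from Suc.prems obtain r where r: "eval p (PrimRec f g) (n # zs) = Some r"
      and s: "eval p g (n # r # zs) = Some y"
      by (auto simp: eval_PrimRec_Cons bind_eq_Some_conv)
    from Suc.IH[OF r] PrimRec.IH(2)[OF s] obtain L1 L2 where
      "\<forall>p'. agree L1 p p' \<longrightarrow> eval p' (PrimRec f g) (n # zs) = Some r"
      "\<forall>p'. agree L2 p p' \<longrightarrow> eval p' g (n # r # zs) = Some y" by blast
    then have "\<forall>p'. agree (max L1 L2) p p' \<longrightarrow> eval p' (PrimRec f g) (n # zs) = Some r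
        \<and> eval p' g (n # r # zs) = Some y"
      using agree_mono by (metis max.cobounded1 max.cobounded2)
    then show ?case by (intro exI[of _ "max L1 L2"]) (auto simp: eval_PrimRec_Cons)
  qed
  then show ?case using PrimRec.prems xs by blast
next
  case (Mu f)
  from Mu.prems obtain n where n: "eval p f (n # xs) = Some 0" "\<forall>m<n. eval p f (m # xs) \<noteq> None"
    and y: "y = (LEAST n. eval p f (n # xs) = Some 0)"
    by (auto split: if_splits)
  \<comment> \<open>The witness \<open>n\<close> of definedness may lie beyond the least zero
    \<open>y\<close>. It guarantees that the finitely many values up to \<open>y\<close> are
    defined, so that each has a threshold.\<close>
  have y0: "eval p f (y # xs) = Some 0" "y \<le> n"
    unfolding y using n by (auto intro: LeastI Least_le)
  have ly: "eval p f (m # xs) \<noteq> Some 0" if "m < y" for m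
    using that unfolding y by (rule not_less_Least)
  have d: "\<forall>m\<in>set [0..<Suc y]. \<exists>z. eval p f (m # xs) = Some z"
    using n y0 by (force simp: less_Suc_eq)
  have "\<forall>m\<in>set [0..<Suc y]. \<exists>L. \<forall>L'\<ge>L. \<forall>p'. agree L' p p' \<longrightarrow> eval p' f (m # xs) = eval p f (m # xs)"
  proof
    fix m assume g: "m \<in> set [0..<Suc y]"
    with d obtain z where z: "eval p f (m # xs) = Some z" by blast
    then obtain L where "\<forall>p'. agree L p p' \<longrightarrow> eval p' f (m # xs) = Some z"
      using Mu.IH by blast
    then show "\<exists>L. \<forall>L'\<ge>L. \<forall>p'. agree L' p p' \<longrightarrow> eval p' f (m # xs) = eval p f (m # xs)"
      using z agree_mono by metis
  qed
  from uniform_threshold[OF this] obtain L where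
    L: "\<forall>p'. agree L p p' \<longrightarrow> (\<forall>m\<in>set [0..<Suc y]. eval p' f (m # xs) = eval p f (m # xs))"
    by blast
  show ?case
  proof (intro exI[of _ L] allI impI)
    fix p' assume "agree L p p'"
    with L have e: "\<And>m. m \<le> y \<Longrightarrow> eval p' f (m # xs) = eval p f (m # xs)"
      by (auto simp del: upt_Suc)
    have "(LEAST n. eval p' f (n # xs) = Some 0) = y"
      using e y0 ly by (intro Least_equality) (auto simp: not_less[symmetric] intro: ccontr)
    moreover have "\<forall>m<y. eval p' f (m # xs) \<noteq> None"
    proof (intro allI impI)
      fix m assume "m < y"
      then show "eval p' f (m # xs) \<noteq> None" using e[of m] n y0 by simp
    qed
    ultimately show "eval p' (Mu f) xs = Some y"
      using e[of y] y0 by auto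
  qed
qed (auto split: list.splits if_splits)

text \<open>
  The oracle becomes the functional computed by \<open>N\<close> at a parameter, which is passed as an additional
  first argument. The number \<open>k\<close> of the other arguments is needed to reorder them by projections.
\<close>

fun subst_oracle :: "program \<Rightarrow> program \<Rightarrow> nat \<Rightarrow> program \<Rightarrow> program" where
  "subst_oracle P N k Zero = Zero"
| "subst_oracle P N k Succ = Comp Succ [Proj 1]"
| "subst_oracle P N k (Proj j) = Proj (Suc j)"
| "subst_oracle P N k Oracle = Comp N [Comp P [Proj 0, Proj 1]]"
| "subst_oracle P N k (Comp f gs) =
     Comp (subst_oracle P N (length gs) f) (Proj 0 # map (subst_oracle P N k) gs)"
| "subst_oracle P N k (PrimRec f g) =
     (if k = 0 then Proj 1
      else Comp (PrimRec (subst_oracle P N (k - 1) f)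
                   (Comp (subst_oracle P N (Suc k) g)
                      (Proj 2 # Proj 0 # Proj 1 # map (\<lambda>j. Proj (j + 3)) [0..<k - 1])))
             (Proj 1 # Proj 0 # map (\<lambda>j. Proj (j + 2)) [0..<k - 1]))"
| "subst_oracle P N k (Mu f) =
     Mu (Comp (subst_oracle P N (Suc k) f)
           (Proj 1 # Proj 0 # map (\<lambda>j. Proj (j + 2)) [0..<k]))"

lemma map_nth_upt:
  "map (\<lambda>j. the (if j < length xs then Some (xs ! j) else None)) [0..<length xs] = xs"
  by (rule nth_equalityI) auto

lemma eval_subst_oracle:
  assumes N: "\<And>m. eval p N [prod_encode (i, m)] = Some (q m)"
    and P: "\<And>a b. eval p P [a, b] = Some (prod_encode (a, b))"
  shows "length xs = k \<Longrightarrow> eval p (subst_oracle P N k M) (i # xs) = eval q M xs"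
proof (induction M arbitrary: k xs)
  case Succ
  then show ?case by (cases xs) (auto simp: eval_Comp)
next
  case Oracle
  then show ?case by (cases xs) (auto simp: eval_Comp N P)
next
  case (Comp f gs)
  have "eval p (subst_oracle P N k g) (i # xs) = eval q g xs" if "g \<in> set gs" for g
    using Comp that by blast
  then show ?case
    by (auto simp: eval_Comp Comp.IH(1)[of _ "length gs"] comp_def cong: map_cong)
next
  case (PrimRec f g)
  show ?case
  proof (cases xs)
    case (Cons n zs)
    have k: "k = Suc (length zs)" using PrimRec.prems Cons by simp
    \<comment> \<open>The recursion supplies counter, previous value, \<open>i\<close> and
      \<open>zs\<close> in this order; the substituted step program expects \<open>i\<close> in
      front.\<close>
    let ?g = "Comp (subst_oracle P N (Suc k) g)
                (Proj 2 # Proj 0 # Proj 1 # map (\<lambda>j. Proj (j + 3)) [0..<k - 1])"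
    have g: "eval p ?g (m # y # i # zs) = eval q g (m # y # zs)" for m y
      using PrimRec.IH(2)[of "m # y # zs" "Suc k"] k
      by (auto simp: eval_Comp comp_def map_nth_upt numeral_3_eq_3 numeral_2_eq_2
          cong: map_cong if_cong)
    have f: "eval p (subst_oracle P N (k - 1) f) (i # zs) = eval q f zs"
      using PrimRec.IH(1)[of zs "k - 1"] k by simp
    have "eval p (subst_oracle P N k (PrimRec f g)) (i # xs)
      = eval p (PrimRec (subst_oracle P N (k - 1) f) ?g) (n # i # zs)"
      using k Cons
      by (auto simp: eval_Comp comp_def map_nth_upt numeral_2_eq_2 cong: map_cong if_cong)
    also have "\<dots> = eval q (PrimRec f g) (n # zs)"
      unfolding eval_PrimRec_Cons g f ..
    finally show ?thesis using Cons by simp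
  \<comment> \<open>For the empty argument list, \<open>Proj 1\<close> is undefined on
    \<open>[i]\<close>, just as \<open>PrimRec\<close> is on \<open>[]\<close>.\<close>
  qed (use PrimRec in simp)
next
  case (Mu f)
  have "eval p (Comp (subst_oracle P N (Suc k) f)
           (Proj 1 # Proj 0 # map (\<lambda>j. Proj (j + 2)) [0..<k])) (n # i # xs) = eval q f (n # xs)" for n
    using Mu.IH[of "n # xs" "Suc k"] Mu.prems
    by (auto simp: eval_Comp comp_def map_nth_upt numeral_2_eq_2 cong: map_cong if_cong)
  then show ?case by simp
qed auto

section \<open>Programs for arithmetic and the Cantor pairing\<close>

definition "prog_pred = PrimRec Zero (Proj 0)"
definition "prog_add = PrimRec (Proj 0) (Comp Succ [Proj 1])"
text \<open>Truncated subtraction. The recursion runs over the subtrahend, whence the swap of the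
  arguments.\<close>

definition "prog_diff = Comp (PrimRec (Proj 0) (Comp prog_pred [Proj 1])) [Proj 1, Proj 0]"
definition "prog_mult = PrimRec Zero (Comp prog_add [Proj 1, Proj 2])"
definition "prog_triangle = PrimRec Zero (Comp prog_add [Comp Succ [Proj 0], Proj 1])"
definition "prog_pair = Comp prog_add [Comp prog_triangle [prog_add], Proj 0]"
definition "prog_is_zero = PrimRec (Comp Succ [Zero]) Zero"
text \<open>The diagonal of \<^const>\<open>prod_encode\<close> on which a given code lies.\<close>
definition "prog_diagonal = PrimRec Zero (Comp prog_add [Proj 1, Comp prog_is_zero
   [Comp prog_diff [Comp prog_triangle [Comp Succ [Proj 1]], Comp Succ [Proj 0]]]])"
definition "prog_fst = Comp prog_diff [Proj 0, Comp prog_triangle [prog_diagonal]]"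
definition "prog_snd = Comp prog_diff [prog_diagonal, prog_fst]"

lemma eval_prog_pred: "eval p prog_pred [n] = Some (n - 1)"
  by (induction n) (auto simp: prog_pred_def eval_PrimRec_Cons)

lemma eval_prog_add: "eval p prog_add [m, n] = Some (m + n)"
  by (induction m) (auto simp: prog_add_def eval_PrimRec_Cons eval_Comp)

lemma eval_prog_diff: "eval p prog_diff [m, n] = Some (m - n)"
proof -
  have "eval p (PrimRec (Proj 0) (Comp prog_pred [Proj 1])) [n, m] = Some (m - n)"
    by (induction n) (auto simp: eval_PrimRec_Cons eval_Comp eval_prog_pred)
  then show ?thesis by (simp add: prog_diff_def eval_Comp)
qed

lemma eval_prog_mult: "eval p prog_mult [m, n] = Some (m * n)"
  by (induction m)
    (auto simp: prog_mult_def eval_PrimRec_Cons eval_Comp eval_prog_add)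

lemma eval_prog_triangle: "eval p prog_triangle [n] = Some (triangle n)"
  by (induction n)
    (auto simp: prog_triangle_def eval_PrimRec_Cons eval_Comp eval_prog_add)

lemma eval_prog_pair: "eval p prog_pair [m, n] = Some (prod_encode (m, n))"
  by (auto simp: prog_pair_def eval_Comp eval_prog_add eval_prog_triangle prod_encode_def)

lemma eval_prog_is_zero: "eval p prog_is_zero [n] = Some (if n = 0 then 1 else 0)"
  by (induction n) (auto simp: prog_is_zero_def eval_PrimRec_Cons eval_Comp)

lemma triangle_mono: "m \<le> n \<Longrightarrow> triangle m \<le> triangle n"
  by (induction rule: dec_induct) auto

lemma prod_decode_decompose:
  assumes "prod_decode n = (a, b)"
  shows "n = triangle (a + b) + a"
proof -
  have "n = prod_encode (a, b)"
    using arg_cong[OF assms, of prod_encode] by simp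
  then show ?thesis by (simp add: prod_encode_def)
qed

text \<open>Since \<open>n = triangle (a + b) + a\<close>, the sum \<open>a + b\<close> is the
  largest \<open>s\<close> with \<open>triangle s \<le> n\<close>. Counting up to \<open>n\<close>,
  the recursion raises its value each time the next triangular number is reached.\<close>

lemma diagonal_recursion:
  "rec_nat 0 (\<lambda>m r. if triangle (Suc r) \<le> Suc m then Suc r else r) n
    = (case prod_decode n of (a, b) \<Rightarrow> a + b)" (is "?s n = _")
proof -
  have "triangle (?s n) \<le> n \<and> n < triangle (Suc (?s n))"
    by (induction n) auto
  moreover obtain a b where ab: "prod_decode n = (a, b)" by force
  then have "n = triangle (a + b) + a"
    by (rule prod_decode_decompose)
  then have "triangle (a + b) \<le> n" "n < triangle (Suc (a + b))" by simp_all
  moreover have "s = c" if "triangle s \<le> n" "n < triangle (Suc s)" "triangle c \<le> n" "n < triangle (Suc c)"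
    for s c
    using that triangle_mono[of "Suc s" c] triangle_mono[of "Suc c" s]
    by (cases s c rule: linorder_cases) auto
  ultimately have "?s n = a + b" by blast
  with ab show ?thesis by (simp only: prod.case)
qed

lemma eval_prog_diagonal:
  "eval p prog_diagonal [n] = Some (case prod_decode n of (a, b) \<Rightarrow> a + b)"
  unfolding diagonal_recursion[symmetric]
  by (induction n)
    (auto simp: prog_diagonal_def eval_PrimRec_Cons eval_Comp eval_prog_add eval_prog_diff
      eval_prog_is_zero eval_prog_triangle simp del: triangle_Suc)

definition pfst :: "nat \<Rightarrow> nat" where "pfst n = fst (prod_decode n)"
definition psnd :: "nat \<Rightarrow> nat" where "psnd n = snd (prod_decode n)"

lemma pfst_encode [simp]: "pfst (prod_encode (a, b)) = a"
  and psnd_encode [simp]: "psnd (prod_encode (a, b)) = b"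
  and encode_pfst_psnd [simp]: "prod_encode (pfst n, psnd n) = n"
  by (auto simp: pfst_def psnd_def)

lemma pfst_le: "pfst n \<le> n" and psnd_le: "psnd n \<le> n"
  by (metis encode_pfst_psnd le_prod_encode_1, metis encode_pfst_psnd le_prod_encode_2)

lemma eval_prog_fst: "eval p prog_fst [n] = Some (pfst n)"
  using prod_decode_decompose[of n]
  by (cases "prod_decode n")
    (auto simp: prog_fst_def eval_Comp eval_prog_diff eval_prog_triangle eval_prog_diagonal pfst_def)

lemma eval_prog_snd: "eval p prog_snd [n] = Some (psnd n)"
  by (cases "prod_decode n")
    (auto simp: prog_snd_def eval_Comp eval_prog_diff eval_prog_fst eval_prog_diagonal
      pfst_def psnd_def)


section \<open>Computable functionals\<close>

text \<open>
  Functionals of several number arguments are treated as functionals of one argument, which codes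
  them with \<^const>\<open>prod_encode\<close>; \<open>prc\<close> and \<open>rc\<close> are the partial and the total computable ones.
\<close>

definition prc :: "(baire \<Rightarrow> nat \<Rightarrow> nat option) \<Rightarrow> bool" where
  "prc \<phi> \<longleftrightarrow> (\<exists>M. \<forall>p n. eval p M [n] = \<phi> p n)"

definition rc :: "(baire \<Rightarrow> nat \<Rightarrow> nat) \<Rightarrow> bool" where
  "rc f \<longleftrightarrow> (\<exists>M. \<forall>p n. eval p M [n] = Some (f p n))"

definition rcp :: "(baire \<Rightarrow> nat \<Rightarrow> bool) \<Rightarrow> bool" where
  "rcp P \<longleftrightarrow> rc (\<lambda>p n. if P p n then 1 else 0)"

lemma rc_prc: "rc f \<longleftrightarrow> prc (\<lambda>p n. Some (f p n))"
  by (simp add: rc_def prc_def)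

lemma prc_eval: "prc (\<lambda>p n. eval p M [n])"
  by (auto simp: prc_def)

lemma prc_bind:
  assumes "prc \<phi>" "prc (\<lambda>p z. \<psi> p (pfst z) (psnd z))"
  shows "prc (\<lambda>p n. Option.bind (\<phi> p n) (\<psi> p n))"
proof -
  from assms obtain M N where M: "\<And>p n. eval p M [n] = \<phi> p n"
    and N: "\<And>p z. eval p N [z] = \<psi> p (pfst z) (psnd z)"
    by (auto simp: prc_def)
  have "eval p (Comp N [Comp prog_pair [Proj 0, M]]) [n] = Option.bind (\<phi> p n) (\<psi> p n)" for p n
    by (cases "\<phi> p n") (auto simp: eval_Comp M N eval_prog_pair)
  then show ?thesis unfolding prc_def by blast
qed

lemma rc_unary:
  assumes M: "\<And>p a. eval p M [a] = Some (g p a)" and "rc f"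
  shows "rc (\<lambda>p n. g p (f p n))"
proof -
  from assms obtain N where N: "\<And>p n. eval p N [n] = Some (f p n)" by (auto simp: rc_def)
  have "eval p (Comp M [N]) [n] = Some (g p (f p n))" for p n
    by (auto simp: eval_Comp M N)
  then show ?thesis unfolding rc_def by blast
qed

lemma rc_binary:
  assumes M: "\<And>p a b. eval p M [a, b] = Some (h a b)" and "rc f" "rc g"
  shows "rc (\<lambda>p n. h (f p n) (g p n))"
proof -
  from assms obtain N R where N: "\<And>p n. eval p N [n] = Some (f p n)"
    and R: "\<And>p n. eval p R [n] = Some (g p n)" by (auto simp: rc_def)
  have "eval p (Comp M [N, R]) [n] = Some (h (f p n) (g p n))" for p n
    by (auto simp: eval_Comp M N R)
  then show ?thesis unfolding rc_def by blast
qed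

section \<open>Closure properties of total computable functionals\<close>

named_theorems rc_intros

lemma rc_id [rc_intros]: "rc (\<lambda>p n. n)"
  unfolding rc_def by (rule exI[of _ "Proj 0"]) simp

lemma rc_Suc [rc_intros]: "rc f \<Longrightarrow> rc (\<lambda>p n. Suc (f p n))"
  by (rule rc_unary[where M = Succ]) auto

lemma rc_const [rc_intros]: "rc (\<lambda>p n. c)"
proof (induction c)
  case 0
  show ?case unfolding rc_def by (rule exI[of _ Zero]) simp
qed (rule rc_Suc)

lemma rc_oracle [rc_intros]: "rc f \<Longrightarrow> rc (\<lambda>p n. p (f p n))"
  by (rule rc_unary[where M = Oracle]) auto

lemma rc_add [rc_intros]: "rc f \<Longrightarrow> rc g \<Longrightarrow> rc (\<lambda>p n. f p n + g p n)"
  by (rule rc_binary[OF eval_prog_add])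

lemma rc_diff [rc_intros]: "rc f \<Longrightarrow> rc g \<Longrightarrow> rc (\<lambda>p n. f p n - g p n)"
  by (rule rc_binary[OF eval_prog_diff])

lemma rc_mult [rc_intros]: "rc f \<Longrightarrow> rc g \<Longrightarrow> rc (\<lambda>p n. f p n * g p n)"
  by (rule rc_binary[OF eval_prog_mult])

lemma rc_pfst [rc_intros]: "rc f \<Longrightarrow> rc (\<lambda>p n. pfst (f p n))"
  by (rule rc_unary[OF eval_prog_fst])

lemma rc_psnd [rc_intros]: "rc f \<Longrightarrow> rc (\<lambda>p n. psnd (f p n))"
  by (rule rc_unary[OF eval_prog_snd])

lemma rc_prod_encode [rc_intros]: "rc f \<Longrightarrow> rc g \<Longrightarrow> rc (\<lambda>p n. prod_encode (f p n, g p n))"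
  using rc_binary[where h = "\<lambda>a b. prod_encode (a, b)", OF eval_prog_pair] .

lemma rc_comp: "rc f \<Longrightarrow> rc a \<Longrightarrow> rc (\<lambda>p n. f p (a p n))"
  using rc_unary[of _ f a] unfolding rc_def[of f] by blast

lemma rc_rec_nat:
  assumes "rc a" "rc b" "rc (\<lambda>p z. g p (pfst z) (pfst (psnd z)) (psnd (psnd z)))"
  shows "rc (\<lambda>p n. rec_nat (a p n) (\<lambda>m r. g p n m r) (b p n))"
proof -
  from assms obtain A B G where A: "\<And>p n. eval p A [n] = Some (a p n)"
    and B: "\<And>p n. eval p B [n] = Some (b p n)"
    and G: "\<And>p z. eval p G [z] = Some (g p (pfst z) (pfst (psnd z)) (psnd (psnd z)))"
    by (auto simp: rc_def)
  let ?G = "Comp G [Comp prog_pair [Proj 2, Comp prog_pair [Proj 0, Proj 1]]]"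
  have "eval p (PrimRec A ?G) [m, n] = Some (rec_nat (a p n) (\<lambda>m r. g p n m r) m)" for p m n
    by (induction m)
      (auto simp: eval_PrimRec_Cons eval_Comp A G eval_prog_pair numeral_2_eq_2)
  then have "eval p (Comp (PrimRec A ?G) [B, Proj 0]) [n]
      = Some (rec_nat (a p n) (\<lambda>m r. g p n m r) (b p n))" for p n
    by (auto simp: eval_Comp B)
  then show ?thesis unfolding rc_def by blast
qed

text \<open>Both branches are total, so the case distinction becomes arithmetic with the
  characteristic function of \<open>P\<close>. Partial branches do not admit this, as composition is
  strict.\<close>

lemma rc_if [rc_intros]:
  assumes "rcp P" "rc f" "rc g"
  shows "rc (\<lambda>p n. if P p n then f p n else g p n)"
proof -
  have "rc (\<lambda>p n. (if P p n then 1 else 0) * f p n + (1 - (if P p n then 1 else 0)) * g p n)"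
    using assms unfolding rcp_def by (intro rc_intros)
  moreover have "(\<lambda>p n. (if P p n then 1 else 0) * f p n + (1 - (if P p n then 1 else 0)) * g p n)
      = (\<lambda>p n. if P p n then f p n else g p n)" by (auto simp: fun_eq_iff)
  ultimately show ?thesis by simp
qed

lemma rcp_if_eq_0: "rc f \<Longrightarrow> (\<And>p n. f p n = 0 \<longleftrightarrow> P p n) \<Longrightarrow> rcp P"
  unfolding rcp_def using rc_unary[OF eval_prog_is_zero, of f] by simp

lemma rcp_le [rc_intros]: "rc f \<Longrightarrow> rc g \<Longrightarrow> rcp (\<lambda>p n. f p n \<le> g p n)"
  by (rule rcp_if_eq_0[of "\<lambda>p n. f p n - g p n"]) (auto intro: rc_intros)

lemma rcp_less [rc_intros]: "rc f \<Longrightarrow> rc g \<Longrightarrow> rcp (\<lambda>p n. f p n < g p n)"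
  using rcp_le[OF rc_Suc] by (simp add: Suc_le_eq)

lemma rcp_eq [rc_intros]: "rc f \<Longrightarrow> rc g \<Longrightarrow> rcp (\<lambda>p n. (f p n :: nat) = g p n)"
  by (rule rcp_if_eq_0[of "\<lambda>p n. (f p n - g p n) + (g p n - f p n)"]) (auto intro: rc_intros)

lemma rcp_not [rc_intros]: "rcp P \<Longrightarrow> rcp (\<lambda>p n. \<not> P p n)"
  by (rule rcp_if_eq_0[of "\<lambda>p n. if P p n then 1 else 0"]) (auto intro!: rc_intros)

lemma rcp_conj [rc_intros]:
  assumes "rcp P" "rcp Q" shows "rcp (\<lambda>p n. P p n \<and> Q p n)"
proof -
  have "rc (\<lambda>p n. if P p n then if Q p n then 1 else 0 else 0)"
    using assms by (intro rc_intros)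
  then show ?thesis
    unfolding rcp_def by (rule back_subst[of rc]) (auto simp: fun_eq_iff)
qed

text \<open>Bounded search as an iteration: the candidate advances until it satisfies
  \<open>P\<close> and then stays. The value \<open>b\<close> thus signals that no witness lies
  below \<open>b\<close>.\<close>

definition first_below :: "nat \<Rightarrow> (nat \<Rightarrow> bool) \<Rightarrow> nat" where
  "first_below b P = rec_nat 0 (\<lambda>m r. if P r then r else Suc r) b"

lemma first_below_le: "first_below b P \<le> b"
  unfolding first_below_def by (induction b) (auto simp: le_SucI)

lemma first_below_minimal: "i < first_below b P \<Longrightarrow> \<not> P i"
  unfolding first_below_def by (induction b) (auto simp: less_Suc_eq split: if_splits)

lemma first_below_holds: "first_below b P < b \<Longrightarrow> P (first_below b P)"
proof (induction b)
  case (Suc b)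
  then show ?case
    using first_below_le[of b P] by (cases "first_below b P < b") (auto simp: first_below_def)
qed simp

lemma first_below_Ex: "first_below b P < b \<longleftrightarrow> (\<exists>i<b. P i)"
  using first_below_le first_below_minimal first_below_holds
  by (metis le_neq_implies_less)

lemma rc_first_below [rc_intros]:
  assumes "rc b" "rcp (\<lambda>p z. P p (pfst z) (psnd z))"
  shows "rc (\<lambda>p n. first_below (b p n) (\<lambda>i. P p n i))"
proof -
  have "rc (\<lambda>p z. prod_encode (pfst z, psnd (psnd z)))"
    by (intro rc_intros)
  from rc_comp[OF assms(2)[unfolded rcp_def] this]
  have "rcp (\<lambda>p z. P p (pfst z) (psnd (psnd z)))"
    by (simp add: rcp_def)
  then show ?thesis
    unfolding first_below_def using assms(1) by (intro rc_rec_nat rc_intros)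
qed

lemma rcp_Ex_less [rc_intros]:
  assumes "rc b" "rcp (\<lambda>p z. P p (pfst z) (psnd z))"
  shows "rcp (\<lambda>p n. \<exists>i<b p n. P p n i)"
  unfolding first_below_Ex[symmetric] using assms by (intro rc_intros)

lemma rcp_All_less [rc_intros]:
  assumes "rc b" "rcp (\<lambda>p z. P p (pfst z) (psnd z))"
  shows "rcp (\<lambda>p n. \<forall>i<b p n. P p n i)"
proof -
  have "rcp (\<lambda>p n. \<not> (\<exists>i<b p n. \<not> P p n i))" using assms by (intro rc_intros)
  then show ?thesis by (rule back_subst[of rcp]) auto
qed

lemma rc_div [rc_intros]:
  assumes "rc f" "rc g" shows "rc (\<lambda>p n. (f p n :: nat) div g p n)"
proof -
  \<comment> \<open>The quotient is the least \<open>i\<close> with \<open>x < Suc i * y\<close>;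
    for positive \<open>y\<close> it is at most \<open>x\<close>, which bounds the search.\<close>
  have "x div y = (if y = 0 then 0 else first_below (Suc x) (\<lambda>i. x < Suc i * y))" for x y :: nat
  proof (cases "y = 0")
    case False
    let ?i = "first_below (Suc x) (\<lambda>i. x < Suc i * y)"
    have "x < Suc x * y" using False by (cases y) auto
    then have "?i < Suc x" unfolding first_below_Ex by blast
    then have 1: "x < Suc ?i * y" by (rule first_below_holds)
    have "?i * y \<le> x"
    proof (cases ?i)
      case (Suc j)
      then have "\<not> x < Suc j * y"
        using first_below_minimal[of j "Suc x" "\<lambda>i. x < Suc i * y"] by simp
      then show ?thesis using Suc by simp
    qed simp
    then have "x div y = ?i" using 1 by (intro div_nat_eqI) (auto simp: mult.commute)
    then show ?thesis using False by simp
  qed simp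
  then show ?thesis using assms rc_comp[OF assms(1) rc_pfst[OF rc_id]]
      rc_comp[OF assms(2) rc_pfst[OF rc_id]]
    by (simp only:) (intro rc_intros)
qed

lemma rc_mod [rc_intros]:
  assumes "rc f" "rc g" shows "rc (\<lambda>p n. (f p n :: nat) mod g p n)"
  unfolding modulo_nat_def[of "f _ _"] minus_mult_div_eq_mod[symmetric]
  using assms by (intro rc_intros)

lemma rcp_even [rc_intros]: "rc f \<Longrightarrow> rcp (\<lambda>p n. even (f p n))"
  unfolding even_iff_mod_2_eq_zero by (intro rc_intros)

lemma rc_power [rc_intros]:
  assumes "rc f" "rc g" shows "rc (\<lambda>p n. (f p n :: nat) ^ g p n)"
proof -
  have "x ^ k = rec_nat 1 (\<lambda>_ r. x * r) k" for x k :: nat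
    by (induction k) auto
  moreover have "rc (\<lambda>p z. f p (pfst z))"
    by (rule rc_comp[OF assms(1) rc_pfst[OF rc_id]])
  ultimately show ?thesis using assms
    by (simp only:) (intro rc_rec_nat rc_intros)
qed

section \<open>Computable partial functions on Baire space\<close>

lemma run_eq_Some: "run M p = Some q \<longleftrightarrow> (\<forall>n. eval p M [n] = Some (q n))"
proof
  assume "\<forall>n. eval p M [n] = Some (q n)"
  then show "run M p = Some q" by (simp add: run_def)
qed (auto simp: run_def split: if_splits)

lemma computable_run: "computable (run M)"
  by (auto simp: computable_def)

lemma computableE:
  assumes "computable F"
  obtains M where "\<And>p q. F p = Some q \<Longrightarrow> run M p = Some q"
  using assms unfolding computable_def by (metis domI)

lemma computableI: "(\<And>p q. F p = Some q \<Longrightarrow> run M p = Some q) \<Longrightarrow> computable F"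
  unfolding computable_def by (intro exI[of _ M]) auto

named_theorems computable_intros

lemma computable_total [computable_intros]:
  assumes "rc T" shows "computable (\<lambda>p. Some (T p))"
proof -
  from assms obtain M where "\<And>p n. eval p M [n] = Some (T p n)" by (auto simp: rc_def)
  then show ?thesis by (intro computableI[of _ M]) (auto simp: run_eq_Some)
qed

lemma prc_comp:
  assumes "prc \<phi>" "rc a"
  shows "prc (\<lambda>p n. \<phi> p (a p n))"
proof -
  from assms obtain N M where N: "\<And>p n. eval p N [n] = Some (a p n)"
    and M: "\<And>p n. eval p M [n] = \<phi> p n" by (auto simp: rc_def prc_def)
  have "eval p (Comp M [N]) [n] = \<phi> p (a p n)" for p n
    by (auto simp: eval_Comp M N)
  then show ?thesis unfolding prc_def by blast
qed

lemma prc_eval_comp: "rc a \<Longrightarrow> prc (\<lambda>p n. eval p M [a p n])"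
  by (rule prc_comp[OF prc_eval])

text \<open>A primitive recursion with counter 0 does not run its step program. With the truth value
  of \<open>P\<close> as counter, \<open>\<phi>\<close> is evaluated only where \<open>P\<close>
  holds, so it may diverge elsewhere.\<close>

lemma prc_if:
  assumes "rcp P" "prc \<phi>" "rc c"
  shows "prc (\<lambda>p n. if P p n then \<phi> p n else Some (c p n))"
proof -
  from assms obtain A B C where A: "\<And>p n. eval p A [n] = Some (if P p n then 1 else 0)"
    and B: "\<And>p n. eval p B [n] = \<phi> p n" and C: "\<And>p n. eval p C [n] = Some (c p n)"
    by (auto simp: rcp_def rc_def prc_def)
  have "eval p (Comp (PrimRec C (Comp B [Proj 2])) [A, Proj 0]) [n]
      = (if P p n then \<phi> p n else Some (c p n))" for p n
    by (auto simp: eval_Comp A B C eval_PrimRec_Cons)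
  then show ?thesis unfolding prc_def by blast
qed

text \<open>One functional \<open>\<phi>\<close> serves all indices \<open>i\<close> at once. This
  uniformity allows a program to be run on every entry of a sequence; a single change of oracle is
  the case of a fixed index.\<close>

lemma prc_subst_oracle:
  assumes "prc \<nu>" "prc \<theta>"
  shows "\<exists>\<phi>. prc \<phi> \<and> (\<forall>p i n q. (\<forall>m. \<nu> p (prod_encode (i, m)) = Some (q m))
            \<longrightarrow> \<phi> p (prod_encode (i, n)) = \<theta> q n)"
proof -
  from assms obtain N M where N: "\<And>p n. eval p N [n] = \<nu> p n"
    and M: "\<And>p n. eval p M [n] = \<theta> p n" by (auto simp: prc_def)
  let ?T = "Comp (subst_oracle prog_pair N 1 M) [prog_fst, prog_snd]"
  have "eval p ?T [prod_encode (i, n)] = \<theta> q n"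
    if "\<forall>m. \<nu> p (prod_encode (i, m)) = Some (q m)" for p i n q
  proof -
    have "eval p (subst_oracle prog_pair N 1 M) [i, n] = eval q M [n]"
      using eval_subst_oracle[of p N i q prog_pair "[n]" 1 M] that N eval_prog_pair by simp
    then show ?thesis
      by (simp add: eval_Comp eval_prog_fst eval_prog_snd M)
  qed
  then show ?thesis using prc_eval[of ?T] by blast
qed

lemma pair_even [simp]: "pair p q (2 * n) = p n" and pair_odd [simp]: "pair p q (Suc (2 * n)) = q n"
  by (auto simp: pair_def)

lemma left_pair [simp]: "left (pair p q) = p" and right_pair [simp]: "right (pair p q) = q"
  by (auto simp: left_def right_def)

lemma pair_left_right [simp]: "pair (left r) (right r) = r"
  by (auto simp: left_def right_def pair_def fun_eq_iff elim!: oddE)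

lemma computable_bind [computable_intros]:
  assumes "computable F" "computable (\<lambda>z. G (left z) (right z))"
  shows "computable (\<lambda>p. Option.bind (F p) (G p))"
proof -
  obtain M where M: "\<And>p q. F p = Some q \<Longrightarrow> run M p = Some q"
    using computableE[OF assms(1)] by blast
  obtain N where N: "\<And>z q. G (left z) (right z) = Some q \<Longrightarrow> run N z = Some q"
    using computableE[OF assms(2)] by blast
  \<comment> \<open>\<open>\<nu>\<close> tabulates \<open>pair p a\<close> for the value
    \<open>a\<close> of \<open>F\<close> at \<open>p\<close>. It runs \<open>M\<close> on even
    positions as well, which is harmless: if \<open>F p\<close> is defined, \<open>M\<close> halts
    everywhere.\<close>
  define \<nu> where "\<nu> p z = Option.bind (eval p M [psnd z div 2])
    (\<lambda>a. Some (if even (psnd z) then p (psnd z div 2) else a))" for p z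
  have "prc \<nu>" unfolding \<nu>_def
    by (intro prc_bind prc_eval_comp rc_intros rc_prc[THEN iffD1])
  from prc_subst_oracle[OF this prc_eval[of N]] obtain \<phi> where "prc \<phi>" and
    \<phi>: "\<And>p i n q. (\<forall>m. \<nu> p (prod_encode (i, m)) = Some (q m))
            \<Longrightarrow> \<phi> p (prod_encode (i, n)) = eval q N [n]" by blast
  have "prc (\<lambda>p n. \<phi> p (prod_encode (0, n)))"
    by (intro prc_comp[OF \<open>prc \<phi>\<close>] rc_intros)
  then obtain R where R: "\<And>p n. eval p R [n] = \<phi> p (prod_encode (0, n))"
    by (auto simp: prc_def)
  show ?thesis
  proof (rule computableI[of _ R])
    fix p b assume "Option.bind (F p) (G p) = Some b"
    then obtain a where a: "F p = Some a" "G p a = Some b" by (auto simp: bind_eq_Some_conv)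
    have "\<nu> p (prod_encode (0, m)) = Some (pair p a m)" for m
      using M[OF a(1)] by (auto simp: \<nu>_def run_eq_Some pair_def)
    moreover have "run N (pair p a) = Some b" using N[of "pair p a"] a by simp
    ultimately show "run R p = Some b"
      using \<phi>[of p 0 "pair p a"] by (auto simp: run_eq_Some R)
  qed
qed

lemma computable_comp_total:
  assumes "computable F" "rc T"
  shows "computable (\<lambda>p. F (T p))"
proof -
  obtain M where M: "\<And>p q. F p = Some q \<Longrightarrow> run M p = Some q"
    using computableE[OF assms(1)] by blast
  have "prc (\<lambda>p z. Some (T p (psnd z)))"
    unfolding rc_prc[symmetric] by (intro rc_comp[OF assms(2)] rc_intros)
  from prc_subst_oracle[OF this prc_eval[of M]] obtain \<phi> where "prc \<phi>" and
    \<phi>: "\<And>p i n. \<phi> p (prod_encode (i, n)) = eval (T p) M [n]" by auto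
  have "prc (\<lambda>p n. \<phi> p (prod_encode (0, n)))"
    by (intro prc_comp[OF \<open>prc \<phi>\<close>] rc_intros)
  then obtain R where R: "\<And>p n. eval p R [n] = eval (T p) M [n]"
    by (auto simp: prc_def \<phi>)
  show ?thesis
    using M by (intro computableI[of _ R]) (auto simp: run_eq_Some R)
qed

lemma computable_if [computable_intros]:
  assumes "rcp (\<lambda>p n. P p)" "computable F" "computable G"
  shows "computable (\<lambda>p. if P p then F p else G p)"
proof -
  obtain M where M: "\<And>p q. F p = Some q \<Longrightarrow> run M p = Some q"
    using computableE[OF assms(2)] by blast
  obtain N where N: "\<And>p q. G p = Some q \<Longrightarrow> run N p = Some q"
    using computableE[OF assms(3)] by blast
  \<comment> \<open>The branch that is not selected contributes 0 without being evaluated, so the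
    sum is the value of the selected one.\<close>
  have "prc (\<lambda>p n. Option.bind (if P p then eval p M [n] else Some 0)
      (\<lambda>a. Option.bind (if \<not> P p then eval p N [n] else Some 0) (\<lambda>b. Some (a + b))))"
    by (intro prc_bind prc_if prc_eval_comp rc_prc[THEN iffD1] rc_intros assms(1))
  then obtain R where R: "\<And>p n. eval p R [n] = Option.bind (if P p then eval p M [n] else Some 0)
      (\<lambda>a. Option.bind (if \<not> P p then eval p N [n] else Some 0) (\<lambda>b. Some (a + b)))"
    unfolding prc_def by blast
  show ?thesis
  proof (rule computableI[of _ R])
    fix p q assume "(if P p then F p else G p) = Some q"
    then show "run R p = Some q"
      using M[of p q] N[of p q] by (auto simp: run_eq_Some R split: if_splits)
  qed
qed

text \<open>The index \<open>i\<close> is the parameter of an oracle substitution, so one program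
  runs \<open>F\<close> on all points \<open>T p i\<close>. A single undefined entry would make the
  whole output undefined; therefore \<open>P\<close> guards the entries, and those outside it are
  filled with 0.\<close>

lemma computable_lift:
  assumes F: "computable F" and P: "rcp P" and T: "rc (\<lambda>p z. T p (pfst z) (psnd z))"
  obtains L where "computable L"
    "\<And>p. (\<And>i. P p i \<Longrightarrow> F (T p i) \<noteq> None) \<Longrightarrow>
       \<exists>s. L p = Some s \<and> (\<forall>i. P p i \<longrightarrow> F (T p i) = Some (component s i))"
proof -
  obtain M where M: "\<And>p q. F p = Some q \<Longrightarrow> run M p = Some q"
    using computableE[OF F] by blast
  from prc_subst_oracle[OF T[unfolded rc_prc] prc_eval[of M]] obtain \<phi> where "prc \<phi>" and
    \<phi>: "\<And>p i n q. (\<forall>m. T p i m = q m) \<Longrightarrow> \<phi> p (prod_encode (i, n)) = eval q M [n]"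
    by auto
  have "rcp (\<lambda>p z. P p (pfst z))"
    using rc_comp[OF P[unfolded rcp_def] rc_pfst[OF rc_id]] by (simp add: rcp_def)
  from prc_if[OF this \<open>prc \<phi>\<close> rc_const[of 0]] obtain R where
    R: "\<And>p n. eval p R [n] = (if P p (pfst n) then \<phi> p n else Some 0)"
    by (auto simp: prc_def)
  show ?thesis
  proof (rule that[OF computable_run[of R]])
    fix p assume d: "\<And>i. P p i \<Longrightarrow> F (T p i) \<noteq> None"
    have e: "\<forall>n. eval p R [prod_encode (i, n)] = Some (the (F (T p i)) n)" if P: "P p i" for i
    proof -
      from d[OF P] obtain q where q: "F (T p i) = Some q" by blast
      from M[OF q] have "\<forall>n. eval (T p i) M [n] = Some (q n)" by (simp add: run_eq_Some)
      then show ?thesis using \<phi>[of p i "T p i"] P q by (simp add: R)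
    qed
    have "\<exists>y. eval p R [n] = Some y" for n
      using e[of "pfst n"] R[of p n] by (cases "P p (pfst n)") (metis encode_pfst_psnd, auto)
    then obtain s where s: "\<forall>n. eval p R [n] = Some (s n)" by metis
    then have "run R p = Some s" by (simp add: run_eq_Some)
    moreover have "F (T p i) = Some (component s i)" if P: "P p i" for i
      using e[OF P] d[OF P] s by (auto simp: component_def)
    ultimately show "\<exists>s. run R p = Some s \<and> (\<forall>i. P p i \<longrightarrow> F (T p i) = Some (component s i))"
      by blast
  qed
qed

section \<open>Names of sequences and lists\<close>

definition cons :: "nat \<Rightarrow> baire \<Rightarrow> baire" where
  "cons c r = (\<lambda>n. if n = 0 then c else r (n - 1))"

lemma cons_0 [simp]: "cons c r 0 = c" and tail_cons [simp]: "tail (cons c r) = r"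
  by (auto simp: cons_def tail_def)

definition mk_seq :: "(nat \<Rightarrow> baire) \<Rightarrow> baire" where
  "mk_seq e = (\<lambda>n. e (pfst n) (psnd n))"

lemma component_mk_seq [simp]: "component (mk_seq e) i = e i"
  by (simp add: component_def mk_seq_def)

text \<open>
  In a name of a list of length \<open>n\<close>, the nested pairing puts the \<open>j\<close>-th value of the name of the
  \<open>k\<close>-th entry from the right at position \<open>1 + 2^k * (2 * j + 1)\<close>.
\<close>

definition elem :: "baire \<Rightarrow> nat \<Rightarrow> baire" where
  "elem r k = (\<lambda>j. r (Suc (2 ^ k * Suc (2 * j))))"

text \<open>The exponent of 2 in a positive \<open>m\<close>. The search bound \<open>m\<close>
  suffices because \<open>k < 2 ^ k\<close>.\<close>

definition two_adic :: "nat \<Rightarrow> nat" where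
  "two_adic m = first_below m (\<lambda>k. m mod 2 ^ Suc k \<noteq> 0)"

lemma two_adic [simp]: "two_adic (2 ^ k * Suc (2 * j)) = k"
proof -
  define m where "m = 2 ^ k * Suc (2 * j)"
  define P where "P i \<longleftrightarrow> m mod 2 ^ Suc i \<noteq> 0" for i
  have "2 ^ k * 2 dvd m \<longleftrightarrow> 2 dvd Suc (2 * j)"
    unfolding m_def by (rule dvd_times_left_cancel_iff) simp
  then have 1: "P k"
    unfolding P_def by (simp only: mod_eq_0_iff_dvd power_Suc2) simp
  have 2: "\<not> P i" if "i < k" for i
    unfolding P_def m_def not_not mod_eq_0_iff_dvd
    using that by (intro dvd_mult2 le_imp_power_dvd) simp
  have "k < 2 ^ k" by (rule less_exp)
  also have "\<dots> \<le> m" by (simp add: m_def)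
  finally have "first_below m P < m"
    using 1 by (auto simp: first_below_Ex)
  then have "P (first_below m P)" by (rule first_below_holds)
  then have "\<not> first_below m P < k" using 2 by auto
  moreover have "\<not> k < first_below m P"
    using 1 first_below_minimal[of k m P] by auto
  ultimately have "first_below m P = k" by simp
  then show ?thesis
    unfolding two_adic_def P_def m_def .
qed

text \<open>The two divisions invert \<open>m - 1 = 2 ^ k * Suc (2 * j)\<close>, which traces a
  position back to the entry \<open>k\<close> and the place \<open>j\<close> in it.\<close>

definition mk_list :: "nat \<Rightarrow> (nat \<Rightarrow> baire) \<Rightarrow> baire" where
  "mk_list n e = (\<lambda>m. if m = 0 then n
     else e (two_adic (m - 1)) ((m - 1) div 2 ^ two_adic (m - 1) div 2))"

lemma mk_list_0 [simp]: "mk_list n e 0 = n"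
  by (simp add: mk_list_def)

lemma elem_mk_list [simp]: "elem (mk_list n e) k = e k"
proof -
  have "mk_list n e (Suc m) = e (two_adic m) (m div 2 ^ two_adic m div 2)" for m
    by (simp add: mk_list_def)
  then have "mk_list n e (Suc (2 ^ k * Suc (2 * j))) = e k (2 ^ k * Suc (2 * j) div 2 ^ k div 2)" for j
    by (simp only: two_adic)
  moreover have "2 ^ k * Suc (2 * j) div 2 ^ k div 2 = j" for j :: nat
    by (subst nonzero_mult_div_cancel_left) auto
  ultimately show ?thesis by (simp only: elem_def)
qed


section \<open>Relations between names\<close>

type_synonym brel = "baire \<Rightarrow> baire set"

text \<open>The value is also empty if \<open>p\<close> names nothing. As the solutions of a problem
  have names, \<open>names f p \<noteq> {}\<close> expresses that \<open>p\<close> names an instance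
  in the domain.\<close>

definition names :: "('a, 'b) problem \<Rightarrow> brel" where
  "names f p = {q. \<exists>x y. src f p = Some x \<and> tgt f q = Some y \<and> y \<in> val f x}"

definition red :: "brel \<Rightarrow> brel \<Rightarrow> bool" where
  "red F G \<longleftrightarrow> (\<exists>K H. computable K \<and> computable H \<and>
     (\<forall>p. F p \<noteq> {} \<longrightarrow> (\<exists>h. H p = Some h \<and> G h \<noteq> {} \<and>
        (\<forall>r\<in>G h. \<exists>q\<in>F p. K (pair p r) = Some q))))"

lemma redI:
  assumes "computable K" "computable H"
    and "\<And>p. F p \<noteq> {} \<Longrightarrow> \<exists>h. H p = Some h \<and> G h \<noteq> {} \<and> (\<forall>r\<in>G h. \<exists>q\<in>F p. K (pair p r) = Some q)"
  shows "red F G"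
  using assms unfolding red_def by blast

lemma redE:
  assumes "red F G"
  obtains K H where "computable K" "computable H"
    "\<And>p. F p \<noteq> {} \<Longrightarrow> \<exists>h. H p = Some h \<and> G h \<noteq> {} \<and> (\<forall>r\<in>G h. \<exists>q\<in>F p. K (pair p r) = Some q)"
  using assms unfolding red_def by blast

lemma is_problem_iff:
  "is_problem f \<longleftrightarrow> (\<forall>x y. y \<in> val f x \<longrightarrow> (\<exists>p. src f p = Some x) \<and> (\<exists>q. tgt f q = Some y))"
  unfolding is_problem_def ran_def by blast

lemma is_problemI:
  "(\<And>x y. y \<in> val f x \<Longrightarrow> (\<exists>p. src f p = Some x) \<and> (\<exists>q. tgt f q = Some y)) \<Longrightarrow> is_problem f"
  by (auto simp: is_problem_iff)

lemma realizes_iff: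
  assumes "is_problem g"
  shows "G \<turnstile>\<^sub>R g \<longleftrightarrow> (\<forall>p. names g p \<noteq> {} \<longrightarrow> (\<exists>q\<in>names g p. G p = Some q))" (is "?L \<longleftrightarrow> ?R")
proof
  assume L: ?L
  show ?R
  proof (intro allI impI)
    fix p assume "names g p \<noteq> {}"
    then obtain x where x: "src g p = Some x" "x \<in> mdom (val g)"
      by (auto simp: names_def mdom_def)
    with L obtain q y where "G p = Some q" "tgt g q = Some y" "y \<in> val g x"
      unfolding realizes_def by blast
    then show "\<exists>q\<in>names g p. G p = Some q" using x by (auto simp: names_def)
  qed
next
  assume R: ?R
  show ?L unfolding realizes_def
  proof (intro allI impI)
    fix p x assume x: "src g p = Some x \<and> x \<in> mdom (val g)"
    then obtain y where "y \<in> val g x" by (auto simp: mdom_def)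
    with x assms have "names g p \<noteq> {}" unfolding is_problem_iff names_def by blast
    with R obtain q where "q \<in> names g p" "G p = Some q" by blast
    then show "\<exists>q y. G p = Some q \<and> tgt g q = Some y \<and> y \<in> val g x"
      using x by (auto simp: names_def)
  qed
qed

lemma reducible_iff_red:
  assumes f: "is_problem f" and g: "is_problem g"
  shows "reducible f g \<longleftrightarrow> red (names f) (names g)"
proof
  assume "reducible f g"
  then obtain K H where KH: "computable K" "computable H"
    and r: "\<And>G. G \<turnstile>\<^sub>R g \<Longrightarrow> (\<lambda>p. Option.bind ((G \<circ>\<^sub>m H) p) (\<lambda>r. K (pair p r))) \<turnstile>\<^sub>R f"
    unfolding reducible_def by blast
  \<comment> \<open>Some realizer is needed to see that \<open>H\<close> is defined at
    \<open>p\<close> and leads into the domain of \<open>g\<close>. Choice provides one; it is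
    undefined off the domain, so definedness at \<open>h\<close> suffices.\<close>
  define G0 where "G0 p = (if names g p = {} then None else Some (SOME q. q \<in> names g p))" for p
  have G0: "G0 \<turnstile>\<^sub>R g"
    unfolding realizes_iff[OF g] G0_def by (auto simp: some_in_eq)
  show "red (names f) (names g)"
  proof (rule redI[OF KH])
    fix p assume p: "names f p \<noteq> {}"
    obtain q where "Option.bind ((G0 \<circ>\<^sub>m H) p) (\<lambda>r. K (pair p r)) = Some q"
      using r[OF G0] p unfolding realizes_iff[OF f] by blast
    then obtain h r0 where h: "H p = Some h" "G0 h = Some r0"
      by (auto simp: bind_eq_Some_conv map_comp_Some_iff)
    then have h': "names g h \<noteq> {}" by (auto simp: G0_def split: if_splits)
    have "\<exists>q\<in>names f p. K (pair p s) = Some q" if s: "s \<in> names g h" for s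
    proof -
      \<comment> \<open>The realizer altered at \<open>h\<close> alone answers \<open>s\<close>
        there, so \<open>K\<close> must be correct for this \<open>s\<close>.\<close>
      have "G0(h \<mapsto> s) \<turnstile>\<^sub>R g"
        using G0 s unfolding realizes_iff[OF g] by auto
      from r[OF this] p show ?thesis unfolding realizes_iff[OF f]
        by (fastforce simp: map_comp_def h)
    qed
    with h h' show "\<exists>h. H p = Some h \<and> names g h \<noteq> {} \<and>
        (\<forall>r\<in>names g h. \<exists>q\<in>names f p. K (pair p r) = Some q)" by blast
  qed
next
  assume "red (names f) (names g)"
  then obtain K H where KH: "computable K" "computable H"
    and *: "\<And>p. names f p \<noteq> {} \<Longrightarrow> \<exists>h. H p = Some h \<and> names g h \<noteq> {} \<and>
        (\<forall>r\<in>names g h. \<exists>q\<in>names f p. K (pair p r) = Some q)" by (rule redE) blast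
  have "(\<lambda>p. Option.bind ((G \<circ>\<^sub>m H) p) (\<lambda>r. K (pair p r))) \<turnstile>\<^sub>R f" if "G \<turnstile>\<^sub>R g" for G
    unfolding realizes_iff[OF f]
  proof (intro allI impI)
    fix p assume "names f p \<noteq> {}"
    from *[OF this] obtain h where h: "H p = Some h" "names g h \<noteq> {}"
      and hr: "\<forall>r\<in>names g h. \<exists>q\<in>names f p. K (pair p r) = Some q" by blast
    from that h obtain r where "r \<in> names g h" "G h = Some r"
      unfolding realizes_iff[OF g] by blast
    with h hr show "\<exists>q\<in>names f p. Option.bind ((G \<circ>\<^sub>m H) p) (\<lambda>r. K (pair p r)) = Some q"
      by auto
  qed
  with KH show "reducible f g" unfolding reducible_def by blast
qed

section \<open>Operations on relations between names\<close>

definition rprod :: "brel \<Rightarrow> brel \<Rightarrow> brel" where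
  "rprod F G p = {q. left q \<in> F (left p) \<and> right q \<in> G (right p)}"

definition rsup :: "brel \<Rightarrow> brel \<Rightarrow> brel" where
  "rsup F G p = {q. q 0 = p 0 \<and>
     (p 0 = 0 \<and> tail q \<in> F (tail p) \<or> p 0 = 1 \<and> tail q \<in> G (tail p))}"

definition rinf :: "brel \<Rightarrow> brel \<Rightarrow> brel" where
  "rinf F G p = {q. F (left p) \<noteq> {} \<and> G (right p) \<noteq> {} \<and>
     (q 0 = 0 \<and> tail q \<in> F (left p) \<or> q 0 = 1 \<and> tail q \<in> G (right p))}"

definition rstar :: "brel \<Rightarrow> brel" where
  "rstar F p = {q. q 0 = p 0 \<and> (\<forall>k<p 0. elem q k \<in> F (elem p k))}"

definition rhat :: "brel \<Rightarrow> brel" where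
  "rhat F p = {q. \<forall>i. component q i \<in> F (component p i)}"

text \<open>The variable \<open>t\<close> is the second half of a cylinder name of the point named
  by \<open>y\<close>, and the machine's output may depend on it. The universal clause is the domain
  condition for composing multi-valued functions: every name must lead to an instance of
  \<open>F\<close>.\<close>

definition rcompprod :: "program \<Rightarrow> brel \<Rightarrow> brel \<Rightarrow> brel" where
  "rcompprod U F G p = {q. G (right p) \<noteq> {} \<and>
     (\<forall>y\<in>G (right p). \<forall>t. \<exists>s. run U (pair (left p) (pair y t)) = Some s \<and> F (right s) \<noteq> {}) \<and>
     (\<exists>y\<in>G (right p). \<exists>t s. run U (pair (left p) (pair y t)) = Some s \<and>
        left q = left s \<and> right q \<in> F (right s))}"

section \<open>Names of instances and solutions of composite problems\<close>

lemma prod_rep_eq_Some [simp]: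
  "prod_rep d e r = Some xy \<longleftrightarrow> d (left r) = Some (fst xy) \<and> e (right r) = Some (snd xy)"
  by (cases xy) (auto simp: prod_rep_def split: option.splits)

lemma sum_rep_eq_Some [simp]:
  "sum_rep d e r = Some (Inl x) \<longleftrightarrow> r 0 = 0 \<and> d (tail r) = Some x"
  "sum_rep d e r = Some (Inr u) \<longleftrightarrow> r 0 = 1 \<and> e (tail r) = Some u"
  by (auto simp: sum_rep_def)

lemma seq_rep_eq_Some [simp]:
  "seq_rep d r = Some xs \<longleftrightarrow> (\<forall>i. d (component r i) = Some (xs i))"
proof
  assume "\<forall>i. d (component r i) = Some (xs i)"
  then show "seq_rep d r = Some xs" by (simp add: seq_rep_def)
qed (auto simp: seq_rep_def split: if_splits)

text \<open>The last entry is named by the right half, and passing to the left half doubles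
  positions. Entries are therefore counted from the right, which explains
  \<open>rev\<close>.\<close>

lemma power_rep_eq_Some:
  "power_rep d n r = Some xs \<longleftrightarrow> length xs = n \<and>
     (\<forall>k<n. d (\<lambda>j. r (2 ^ k * Suc (2 * j))) = Some (rev xs ! k))"
proof (induction n arbitrary: r xs)
  case (Suc n)
  have "power_rep d (Suc n) r = Some xs \<longleftrightarrow> (\<exists>ys y. xs = ys @ [y] \<and>
      power_rep d n (left r) = Some ys \<and> d (right r) = Some y)"
    by (auto split: option.splits)
  also have "\<dots> \<longleftrightarrow> length xs = Suc n \<and>
     (\<forall>k<Suc n. d (\<lambda>j. r (2 ^ k * Suc (2 * j))) = Some (rev xs ! k))"
    unfolding Suc.IH
    by (cases xs rule: rev_cases)
      (auto simp: All_less_Suc2 left_def right_def mult.assoc simp del: mult_Suc_right)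
  finally show ?case .
qed auto

lemma list_rep_eq_Some [simp]:
  "list_rep d r = Some xs \<longleftrightarrow> length xs = r 0 \<and> (\<forall>k<r 0. d (elem r k) = Some (rev xs ! k))"
  by (simp add: list_rep_def power_rep_eq_Some elem_def tail_def)

lemma names_prod: "names (prod_problem f g) = rprod (names f) (names g)"
  by (auto simp: names_def prod_problem_def rprod_def fun_eq_iff)

lemma is_problem_prod:
  assumes "is_problem f" "is_problem g"
  shows "is_problem (prod_problem f g)"
proof (rule is_problemI)
  fix x y assume "y \<in> val (prod_problem f g) x"
  then have "snd y \<in> val g (snd x)" "fst y \<in> val f (fst x)"
    by (auto simp: prod_problem_def split: prod.splits)
  with assms obtain p p' q q' where
    "src f p = Some (fst x)" "src g p' = Some (snd x)" "tgt f q = Some (fst y)" "tgt g q' = Some (snd y)"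
    unfolding is_problem_iff by metis
  then show "(\<exists>p. src (prod_problem f g) p = Some x) \<and> (\<exists>q. tgt (prod_problem f g) q = Some y)"
    by (intro conjI exI[of _ "pair p p'"] exI[of _ "pair q q'"]) (auto simp: prod_problem_def)
qed

lemma names_sup: "names (sup_problem f g) = rsup (names f) (names g)"
proof (intro ext set_eqI)
  fix p q
  show "q \<in> names (sup_problem f g) p \<longleftrightarrow> q \<in> rsup (names f) (names g) p"
    unfolding names_def sup_problem_def rsup_def
    by (simp add: split_sum_ex image_iff) auto
qed

lemma is_problem_sup:
  assumes "is_problem f" "is_problem g"
  shows "is_problem (sup_problem f g)"
proof (rule is_problemI)
  fix x y assume y: "y \<in> val (sup_problem f g) x"
  show "(\<exists>p. src (sup_problem f g) p = Some x) \<and> (\<exists>q. tgt (sup_problem f g) q = Some y)"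
  proof (cases x)
    case (Inl a)
    with y obtain b where b: "y = Inl b" "b \<in> val f a" by (auto simp: sup_problem_def)
    with assms obtain p q where "src f p = Some a" "tgt f q = Some b"
      unfolding is_problem_iff by metis
    with Inl b show ?thesis
      by (intro conjI exI[of _ "cons 0 p"] exI[of _ "cons 0 q"]) (auto simp: sup_problem_def)
  next
    case (Inr a)
    with y obtain b where b: "y = Inr b" "b \<in> val g a" by (auto simp: sup_problem_def)
    with assms obtain p q where "src g p = Some a" "tgt g q = Some b"
      unfolding is_problem_iff by metis
    with Inr b show ?thesis
      by (intro conjI exI[of _ "cons 1 p"] exI[of _ "cons 1 q"]) (auto simp: sup_problem_def)
  qed
qed

lemma names_eq_empty_iff:
  assumes "is_problem f" "src f p = Some x"
  shows "names f p = {} \<longleftrightarrow> val f x = {}"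
  using assms unfolding is_problem_iff names_def by fastforce

text \<open>The meet requires both instances to lie in the domain, although an answer concerns only
  one of them. The premises translate this from nonempty values to nonempty sets of names.\<close>

lemma names_inf:
  assumes "is_problem f" "is_problem g"
  shows "names (inf_problem f g) = rinf (names f) (names g)"
proof (intro ext set_eqI)
  fix p q
  have "q \<in> names (inf_problem f g) p \<longleftrightarrow> (\<exists>x u. src f (left p) = Some x \<and> src g (right p) = Some u \<and>
      val f x \<noteq> {} \<and> val g u \<noteq> {} \<and>
      (q 0 = 0 \<and> tail q \<in> names f (left p) \<or> q 0 = 1 \<and> tail q \<in> names g (right p)))"
    unfolding names_def inf_problem_def
    by (simp add: split_sum_ex mdom_def) blast
  also have "\<dots> \<longleftrightarrow> q \<in> rinf (names f) (names g) p"
    using names_eq_empty_iff[OF assms(1)] names_eq_empty_iff[OF assms(2)]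
    unfolding rinf_def names_def by fastforce
  finally show "q \<in> names (inf_problem f g) p \<longleftrightarrow> q \<in> rinf (names f) (names g) p" .
qed

lemma is_problem_inf:
  assumes "is_problem f" "is_problem g"
  shows "is_problem (inf_problem f g)"
proof (rule is_problemI)
  fix x y assume y: "y \<in> val (inf_problem f g) x"
  obtain a b where x: "x = (a, b)" by force
  from y x have "val f a \<noteq> {}" "val g b \<noteq> {}" and y': "y \<in> val f a <+> val g b"
    by (auto simp: inf_problem_def mdom_def split: if_splits)
  with assms obtain p p' where p: "src f p = Some a" "src g p' = Some b"
    unfolding is_problem_iff by blast
  have "\<exists>q. sum_rep (tgt f) (tgt g) q = Some y"
  proof (cases y)
    case (Inl c)
    with y' assms obtain q where "tgt f q = Some c" unfolding is_problem_iff by blast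
    with Inl show ?thesis by (intro exI[of _ "cons 0 q"]) auto
  next
    case (Inr c)
    with y' assms obtain q where "tgt g q = Some c" unfolding is_problem_iff by blast
    with Inr show ?thesis by (intro exI[of _ "cons 1 q"]) auto
  qed
  with p x show "(\<exists>p. src (inf_problem f g) p = Some x) \<and> (\<exists>q. tgt (inf_problem f g) q = Some y)"
    by (auto simp: inf_problem_def intro!: exI[of _ "pair p p'"])
qed

lemma list_all2_rev_nth:
  "list_all2 P xs ys \<longleftrightarrow> length ys = length xs \<and> (\<forall>k<length xs. P (rev xs ! k) (rev ys ! k))"
  using list_all2_conv_all_nth[of P "rev xs" "rev ys"] by auto

lemma names_star: "names (star_problem f) = rstar (names f)"
proof (intro ext set_eqI)
  fix p q
  show "q \<in> names (star_problem f) p \<longleftrightarrow> q \<in> rstar (names f) p"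
  proof
    assume "q \<in> names (star_problem f) p"
    then show "q \<in> rstar (names f) p"
      by (fastforce simp: names_def star_problem_def rstar_def list_all2_rev_nth)
  next
    assume q: "q \<in> rstar (names f) p"
    then have "\<forall>k. \<exists>x y. k < p 0 \<longrightarrow> src f (elem p k) = Some x \<and> tgt f (elem q k) = Some y \<and> y \<in> val f x"
      by (auto simp: rstar_def names_def)
    then obtain x y where "\<And>k. k < p 0 \<Longrightarrow> src f (elem p k) = Some (x k) \<and>
        tgt f (elem q k) = Some (y k) \<and> y k \<in> val f (x k)" by metis
    with q show "q \<in> names (star_problem f) p"
      unfolding names_def star_problem_def
      by (auto simp: list_all2_rev_nth rstar_def
          intro!: exI[of _ "rev (map x [0..<p 0])"] exI[of _ "rev (map y [0..<p 0])"])
  qed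
qed

lemma is_problem_star:
  assumes "is_problem f"
  shows "is_problem (star_problem f)"
proof (rule is_problemI)
  fix xs ys assume "ys \<in> val (star_problem f) xs"
  then have l: "length ys = length xs" and "\<And>k. k < length xs \<Longrightarrow> rev ys ! k \<in> val f (rev xs ! k)"
    by (auto simp: star_problem_def list_all2_rev_nth)
  then have "\<forall>k. \<exists>p q. k < length xs \<longrightarrow> src f p = Some (rev xs ! k) \<and> tgt f q = Some (rev ys ! k)"
    using assms unfolding is_problem_iff by blast
  then obtain p q where "\<And>k. k < length xs \<Longrightarrow> src f (p k) = Some (rev xs ! k) \<and> tgt f (q k) = Some (rev ys ! k)"
    by metis
  with l show "(\<exists>p. src (star_problem f) p = Some xs) \<and> (\<exists>q. tgt (star_problem f) q = Some ys)"
    by (intro conjI exI[of _ "mk_list (length xs) p"] exI[of _ "mk_list (length xs) q"])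
      (auto simp: star_problem_def)
qed

lemma names_hat: "names (hat_problem f) = rhat (names f)"
  unfolding names_def hat_problem_def rhat_def by (intro ext) (auto, metis)

lemma is_problem_hat:
  assumes "is_problem f"
  shows "is_problem (hat_problem f)"
proof (rule is_problemI)
  fix xs ys assume "ys \<in> val (hat_problem f) xs"
  then have "\<forall>i. \<exists>p q. src f p = Some (xs i) \<and> tgt f q = Some (ys i)"
    using assms unfolding is_problem_iff hat_problem_def by simp blast
  then obtain p q where "\<And>i. src f (p i) = Some (xs i)" "\<And>i. tgt f (q i) = Some (ys i)"
    by metis
  then show "(\<exists>p. src (hat_problem f) p = Some xs) \<and> (\<exists>q. tgt (hat_problem f) q = Some ys)"
    by (intro conjI exI[of _ "mk_seq p"] exI[of _ "mk_seq q"]) (auto simp: hat_problem_def)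
qed

lemma in_mcomp_iff:
  "z \<in> (f \<circ>\<^sub>M g) x \<longleftrightarrow>
     (\<exists>y. y \<in> g x) \<and> (\<forall>y\<in>g x. \<exists>z. z \<in> f y) \<and> (\<exists>y\<in>g x. z \<in> f y)"
  by (auto simp: mcomp_def mdom_def)

section \<open>The compositional product on names\<close>

context
  fixes U :: program and f :: "('u, 'v) problem" and g :: "('a, 'b) problem"
  assumes f: "is_problem f" and g: "is_problem g"
begin

private abbreviation "e \<equiv> prod_rep baire_rep (src f)"

text \<open>The function that \<open>p\<close> names in the space of functions from the target of
  \<open>g\<close> to the product of Baire space with the source of \<open>f\<close>.\<close>

private definition h :: "baire \<Rightarrow> 'b \<Rightarrow> (baire \<times> 'u) set" where
  "h p = mfun e \<circ>\<^sub>M mfun (Phi U p) \<circ>\<^sub>M minverse (cyl_rep (tgt g))"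

private lemma in_h_iff:
  "z \<in> h p y \<longleftrightarrow> (\<exists>r. tgt g r = Some y) \<and>
     (\<forall>r t. tgt g r = Some y \<longrightarrow> (\<exists>s. run U (pair p (pair r t)) = Some s \<and> e s \<noteq> None)) \<and>
     (\<exists>r t s. tgt g r = Some y \<and> run U (pair p (pair r t)) = Some s \<and> e s = Some z)"
proof -
  have inv: "minverse (cyl_rep (tgt g)) y = {pair r t |r t. tgt g r = Some y}"
    unfolding minverse_def cyl_rep_def by (auto, metis pair_left_right)
  define B where "B = mfun (Phi U p) \<circ>\<^sub>M minverse (cyl_rep (tgt g))"
  have B: "w \<in> B y \<longleftrightarrow> (\<exists>r. tgt g r = Some y) \<and>
      (\<forall>r t. tgt g r = Some y \<longrightarrow> run U (pair p (pair r t)) \<noteq> None) \<and>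
      (\<exists>r t. tgt g r = Some y \<and> run U (pair p (pair r t)) = Some w)" for w
  proof -
    have "w \<in> B y \<longleftrightarrow> (\<exists>r t. tgt g r = Some y) \<and>
      (\<forall>r t. tgt g r = Some y \<longrightarrow> (\<exists>s. run U (pair p (pair r t)) = Some s)) \<and>
      (\<exists>r t. tgt g r = Some y \<and> run U (pair p (pair r t)) = Some w)"
      unfolding B_def in_mcomp_iff mfun_def inv Phi_def by auto
    then show ?thesis by (simp only: not_None_eq simp_thms)
  qed
  have h: "z \<in> h p y \<longleftrightarrow> (\<exists>w. w \<in> B y) \<and> (\<forall>w\<in>B y. e w \<noteq> None) \<and> (\<exists>w\<in>B y. e w = Some z)"
    unfolding h_def B_def[symmetric] in_mcomp_iff[of z "mfun e" B] mfun_def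
    by (simp only: elem_set not_None_eq)
  show ?thesis (is "?L \<longleftrightarrow> ?A \<and> ?C \<and> ?D")
  proof
    assume ?L
    then show "?A \<and> ?C \<and> ?D" unfolding h B Ball_def Bex_def not_None_eq by blast
  next
    assume R: "?A \<and> ?C \<and> ?D"
    then have *: "w \<in> B y" if "tgt g r = Some y" "run U (pair p (pair r t)) = Some w" for w r t
      using that unfolding B not_None_eq by blast
    have "e w \<noteq> None" if w: "w \<in> B y" for w
    proof -
      from w obtain r t where rt: "tgt g r = Some y" "run U (pair p (pair r t)) = Some w"
        unfolding B by blast
      with R obtain s where "run U (pair p (pair r t)) = Some s" "e s \<noteq> None" by blast
      with rt show ?thesis by simp
    qed
    with R * show ?L unfolding h by blast
  qed
qed

private lemma names_comp_iff:
  "q \<in> names (compprod_problem U f g) p \<longleftrightarrow> (\<exists>x. src g (right p) = Some x \<and> val g x \<noteq> {} \<and>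
     (\<forall>y\<in>val g x. h (left p) y \<noteq> {} \<and> (\<forall>z\<in>h (left p) y. val f (snd z) \<noteq> {})) \<and>
     (\<exists>y\<in>val g x. \<exists>z\<in>h (left p) y. left q = fst z \<and>
        (\<exists>v. tgt f (right q) = Some v \<and> v \<in> val f (snd z))))"
proof -
  have r: "fun_rep U (tgt g) e p = Some (h p)" for p
    by (simp add: fun_rep_def h_def)
  then have ran: "h p \<in> ran (fun_rep U (tgt g) e)" for p
    by (auto simp: ran_def)
  have val: "z \<in> val (compprod_problem U f g) (h p, x) \<longleftrightarrow> val g x \<noteq> {} \<and>
     (\<forall>y\<in>val g x. h p y \<noteq> {} \<and> (\<forall>z\<in>h p y. val f (snd z) \<noteq> {})) \<and>
     (\<exists>y\<in>val g x. \<exists>w\<in>h p y. fst z = fst w \<and> snd z \<in> val f (snd w))" for p x z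
  proof -
    have 1: "val (prod_problem id_baire f) w = {fst w} \<times> val f (snd w)" for w
      by (auto simp: prod_problem_def id_baire_def split: prod.splits)
    have 2: "val (transp_problem U g e) (h p, x) = (h p \<circ>\<^sub>M val g) x"
      by (simp add: transp_problem_def ran)
    have "z \<in> val (compprod_problem U f g) (h p, x) \<longleftrightarrow> (\<exists>w. w \<in> (h p \<circ>\<^sub>M val g) x) \<and>
       (\<forall>w\<in>(h p \<circ>\<^sub>M val g) x. \<exists>u. u \<in> val f (snd w)) \<and>
       (\<exists>w\<in>(h p \<circ>\<^sub>M val g) x. fst z = fst w \<and> snd z \<in> val f (snd w))"
      unfolding compprod_problem_def comp_problem_def by (simp add: in_mcomp_iff 1 2 mem_Times_iff)
    also have "\<dots> \<longleftrightarrow> val g x \<noteq> {} \<and>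
       (\<forall>y\<in>val g x. h p y \<noteq> {} \<and> (\<forall>z\<in>h p y. val f (snd z) \<noteq> {})) \<and>
       (\<exists>y\<in>val g x. \<exists>w\<in>h p y. fst z = fst w \<and> snd z \<in> val f (snd w))"
      unfolding Bex_def Ball_def in_mcomp_iff by blast
    finally show ?thesis .
  qed
  have src: "src (compprod_problem U f g) p = Some hx \<longleftrightarrow>
      fst hx = h (left p) \<and> src g (right p) = Some (snd hx)" for hx
    by (auto simp: compprod_problem_def comp_problem_def transp_problem_def r)
  have tgt: "tgt (compprod_problem U f g) q = Some z \<longleftrightarrow>
      fst z = left q \<and> tgt f (right q) = Some (snd z)" for z
    by (auto simp: compprod_problem_def comp_problem_def prod_problem_def id_baire_def baire_rep_def)
  have "q \<in> names (compprod_problem U f g) p \<longleftrightarrow> (\<exists>x v. src g (right p) = Some x \<and>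
      tgt f (right q) = Some v \<and> (left q, v) \<in> val (compprod_problem U f g) (h (left p), x))"
    unfolding names_def mem_Collect_eq src tgt by auto
  then show ?thesis unfolding val fst_conv snd_conv by blast
qed

text \<open>The composition quantifies over points, the relation over names. The domain conditions
  agree because every solution of \<open>g\<close> has a name and a value of \<open>h\<close> exists
  only if the machine succeeds on all names of the argument.\<close>

lemma names_compprod: "names (compprod_problem U f g) = rcompprod U (names f) (names g)"
proof (intro ext set_eqI)
  fix p q
  show "q \<in> names (compprod_problem U f g) p \<longleftrightarrow> q \<in> rcompprod U (names f) (names g) p"
  proof
    assume "q \<in> names (compprod_problem U f g) p"
    then obtain x where x: "src g (right p) = Some x" "val g x \<noteq> {}"
      and all: "\<And>y. y \<in> val g x \<Longrightarrow> h (left p) y \<noteq> {}"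
      and val: "\<And>y z. y \<in> val g x \<Longrightarrow> z \<in> h (left p) y \<Longrightarrow> val f (snd z) \<noteq> {}"
      and ex: "\<exists>y\<in>val g x. \<exists>z\<in>h (left p) y. left q = fst z \<and>
        (\<exists>v. tgt f (right q) = Some v \<and> v \<in> val f (snd z))"
      unfolding names_comp_iff by blast
    have 1: "names g (right p) \<noteq> {}" using names_eq_empty_iff[OF g x(1)] x by simp
    have 2: "\<exists>s. run U (pair (left p) (pair r t)) = Some s \<and> names f (right s) \<noteq> {}"
      if "r \<in> names g (right p)" for r t
    proof -
      from that x obtain y where y: "y \<in> val g x" "tgt g r = Some y"
        by (auto simp: names_def)
      with all[OF y(1)] obtain s z where s: "run U (pair (left p) (pair r t)) = Some s" "e s = Some z"
        unfolding ex_in_conv[symmetric] in_h_iff by blast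
      with all[OF y(1)] y have "z \<in> h (left p) y"
        unfolding ex_in_conv[symmetric] in_h_iff by blast
      with val y have "val f (snd z) \<noteq> {}" by blast
      with s names_eq_empty_iff[OF f, of "right s" "snd z"] show ?thesis by auto
    qed
    from ex obtain y z v where y: "y \<in> val g x" "z \<in> h (left p) y" "left q = fst z"
      "tgt f (right q) = Some v" "v \<in> val f (snd z)" by blast
    then obtain r t s where "tgt g r = Some y" "run U (pair (left p) (pair r t)) = Some s"
      "e s = Some z" unfolding in_h_iff by blast
    with y x have "r \<in> names g (right p)" "left q = left s" "right q \<in> names f (right s)"
      by (auto simp: names_def baire_rep_def)
    with 1 2 \<open>run U _ = Some s\<close> show "q \<in> rcompprod U (names f) (names g) p"
      unfolding rcompprod_def by blast
  next
    assume "q \<in> rcompprod U (names f) (names g) p"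
    then obtain r0 t0 s0 where ne: "names g (right p) \<noteq> {}"
      and all: "\<And>y t. y \<in> names g (right p) \<Longrightarrow>
        \<exists>s. run U (pair (left p) (pair y t)) = Some s \<and> names f (right s) \<noteq> {}"
      and s0: "r0 \<in> names g (right p)" "run U (pair (left p) (pair r0 t0)) = Some s0"
        "left q = left s0" "right q \<in> names f (right s0)"
      unfolding rcompprod_def by blast
    from s0 obtain x y0 where x: "src g (right p) = Some x" "y0 \<in> val g x" "tgt g r0 = Some y0"
      by (auto simp: names_def)
    have 1: "\<exists>s z. run U (pair (left p) (pair r t)) = Some s \<and> e s = Some z \<and> val f (snd z) \<noteq> {}"
      if "y \<in> val g x" "tgt g r = Some y" for r y t
    proof -
      from that x have "r \<in> names g (right p)" by (auto simp: names_def)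
      from all[OF this] obtain s u v where s: "run U (pair (left p) (pair r t)) = Some s"
        "src f (right s) = Some u" "v \<in> val f u" by (fastforce simp: names_def)
      then show ?thesis by (intro exI[of _ s] exI[of _ "(left s, u)"]) (auto simp: baire_rep_def)
    qed
    have 2: "h (left p) y \<noteq> {}" if y: "y \<in> val g x" for y
    proof -
      from y g obtain r where r: "tgt g r = Some y" unfolding is_problem_iff by blast
      from 1[OF y r] obtain s z where "run U (pair (left p) (pair r t0)) = Some s" "e s = Some z"
        by blast
      then have "z \<in> h (left p) y" unfolding in_h_iff using r 1[OF y] by blast
      then show ?thesis by blast
    qed
    have 3: "val f (snd z) \<noteq> {}" if "y \<in> val g x" "z \<in> h (left p) y" for y z
    proof -
      from that(2) obtain r t s where "tgt g r = Some y" "run U (pair (left p) (pair r t)) = Some s"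
        "e s = Some z" unfolding in_h_iff by blast
      with 1[OF that(1), of r t] show ?thesis by auto
    qed
    from s0 obtain u v where u: "src f (right s0) = Some u" "tgt f (right q) = Some v" "v \<in> val f u"
      by (auto simp: names_def)
    then have "e s0 = Some (left s0, u)" by (auto simp: baire_rep_def)
    with s0 x 1[OF x(2)] have "(left s0, u) \<in> h (left p) y0"
      unfolding in_h_iff by blast
    with u s0 x 2 3 show "q \<in> names (compprod_problem U f g) p"
      unfolding names_comp_iff by fastforce
  qed
qed

lemma is_problem_compprod: "is_problem (compprod_problem U f g)"
proof (rule is_problemI)
  fix hx z assume z: "z \<in> val (compprod_problem U f g) hx"
  obtain h' x where hx: "hx = (h', x)" by force
  from z have h': "h' \<in> ran (fun_rep U (tgt g) e)" and "val g x \<noteq> {}"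
    and "\<exists>u. snd z \<in> val f u"
    unfolding hx compprod_problem_def comp_problem_def transp_problem_def prod_problem_def id_baire_def
    by (auto simp: mcomp_def mdom_def split: if_splits)
  with f g obtain p q where "src g p = Some x" "tgt f q = Some (snd z)"
    unfolding is_problem_iff by blast
  moreover from h' obtain p' where "fun_rep U (tgt g) e p' = Some h'" by (auto simp: ran_def)
  ultimately show "(\<exists>p. src (compprod_problem U f g) p = Some hx) \<and>
      (\<exists>q. tgt (compprod_problem U f g) q = Some z)"
    unfolding hx compprod_problem_def comp_problem_def transp_problem_def prod_problem_def id_baire_def
    by (intro conjI exI[of _ "pair p' p"] exI[of _ "pair (fst z) q"]) (simp_all add: baire_rep_def)
qed

end


section \<open>Reductions\<close>

lemma rc_two_adic [rc_intros]:
  assumes "rc f" shows "rc (\<lambda>p n. two_adic (f p n))"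
proof -
  have "rc (\<lambda>p n. two_adic n)" unfolding two_adic_def by (intro rc_intros)
  from rc_comp[OF this assms] show ?thesis .
qed

lemmas baire_defs = left_def right_def component_def tail_def elem_def

text \<open>
  Rules for name constructors; unfolding the constructors instead would duplicate their arguments.
\<close>

lemma rc_pair [rc_intros]:
  assumes "rc a" "rc (\<lambda>p z. A p (pfst z) (psnd z))" "rc (\<lambda>p z. B p (pfst z) (psnd z))"
  shows "rc (\<lambda>p n. pair (A p n) (B p n) (a p n))"
proof -
  have "rc (\<lambda>p n. prod_encode (n, a p n div 2))"
    using assms(1) by (intro rc_intros)
  from rc_comp[OF assms(2) this] rc_comp[OF assms(3) this] show ?thesis
    unfolding pair_def using assms(1) by (intro rc_intros) simp_all
qed

lemma rc_cons [rc_intros]: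
  assumes "rc a" "rc c" "rc (\<lambda>p z. A p (pfst z) (psnd z))"
  shows "rc (\<lambda>p n. cons (c p n) (A p n) (a p n))"
proof -
  have "rc (\<lambda>p n. prod_encode (n, a p n - 1))"
    using assms(1) by (intro rc_intros)
  from rc_comp[OF assms(3) this] show ?thesis
    unfolding cons_def using assms(1,2) by (intro rc_intros) simp_all
qed

lemma rc_mk_seq [rc_intros]:
  assumes "rc a" "rc (\<lambda>p z. E p (pfst z) (pfst (psnd z)) (psnd (psnd z)))"
  shows "rc (\<lambda>p n. mk_seq (\<lambda>i. E p n i) (a p n))"
proof -
  have "rc (\<lambda>p n. prod_encode (n, a p n))"
    using assms(1) by (intro rc_intros)
  from rc_comp[OF assms(2) this] show ?thesis unfolding mk_seq_def by simp
qed

lemma rc_mk_list [rc_intros]: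
  assumes "rc a" "rc l" "rc (\<lambda>p z. E p (pfst z) (pfst (psnd z)) (psnd (psnd z)))"
  shows "rc (\<lambda>p n. mk_list (l p n) (\<lambda>k. E p n k) (a p n))"
proof -
  have "rc (\<lambda>p n. prod_encode (n, prod_encode (two_adic (a p n - 1),
      (a p n - 1) div 2 ^ two_adic (a p n - 1) div 2)))"
    using assms(1) by (intro rc_intros)
  from rc_comp[OF assms(3) this] show ?thesis
    unfolding mk_list_def using assms(1,2) by (intro rc_intros) simp_all
qed

lemma rc_if_apply [rc_intros]:
  assumes "rcp P" "rc (\<lambda>p n. A p n (a p n))" "rc (\<lambda>p n. B p n (a p n))"
  shows "rc (\<lambda>p n. (if P p n then A p n else B p n) (a p n))"
  unfolding if_distribR using assms by (rule rc_if)

lemma red_refl: "red F F"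
proof (rule redI)
  show "computable (\<lambda>s. Some (right s))" "computable (\<lambda>p. Some p)"
    by (intro computable_intros; (unfold baire_defs)?; intro rc_intros)+
qed auto

lemma red_trans:
  assumes "red F G" "red G E"
  shows "red F E"
proof -
  obtain K1 H1 where KH1: "computable K1" "computable H1" and 1: "\<And>p. F p \<noteq> {} \<Longrightarrow>
      \<exists>h. H1 p = Some h \<and> G h \<noteq> {} \<and> (\<forall>r\<in>G h. \<exists>q\<in>F p. K1 (pair p r) = Some q)"
    using assms(1) by (rule redE) blast
  obtain K2 H2 where KH2: "computable K2" "computable H2" and 2: "\<And>p. G p \<noteq> {} \<Longrightarrow>
      \<exists>h. H2 p = Some h \<and> E h \<noteq> {} \<and> (\<forall>r\<in>E h. \<exists>q\<in>G p. K2 (pair p r) = Some q)"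
    using assms(2) by (rule redE) blast
  show ?thesis
  proof (rule redI)
    \<comment> \<open>The final step receives only the input and the last answer, so it computes the
      intermediate query once more.\<close>
    show "computable (\<lambda>s. Option.bind (H1 (left s)) (\<lambda>h. Option.bind (K2 (pair h (right s)))
        (\<lambda>r. K1 (pair (left s) r))))"
      by (intro computable_intros computable_comp_total[OF KH1(1)] computable_comp_total[OF KH1(2)]
          computable_comp_total[OF KH2(1)]; (unfold baire_defs)?; intro rc_intros)
    show "computable (\<lambda>p. Option.bind (H1 p) H2)"
      by (intro computable_intros computable_comp_total[OF KH2(2)] KH1)
        (unfold baire_defs, intro rc_intros)
    fix p assume "F p \<noteq> {}"
    with 1 obtain h where h: "H1 p = Some h" "G h \<noteq> {}"
      "\<forall>r\<in>G h. \<exists>q\<in>F p. K1 (pair p r) = Some q" by blast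
    with 2 obtain k where k: "H2 h = Some k" "E k \<noteq> {}"
      "\<forall>r\<in>E k. \<exists>q\<in>G h. K2 (pair h r) = Some q" by blast
    have "\<exists>q\<in>F p. Option.bind (K2 (pair h r)) (\<lambda>r'. K1 (pair p r')) = Some q" if r: "r \<in> E k" for r
    proof -
      from k(3) r obtain r' where "r' \<in> G h" "K2 (pair h r) = Some r'" by blast
      with h(3) show ?thesis by simp
    qed
    with h(1) k(1,2) show "\<exists>k. Option.bind (H1 p) H2 = Some k \<and> E k \<noteq> {} \<and>
       (\<forall>r\<in>E k. \<exists>q\<in>F p. Option.bind (H1 (left (pair p r)))
          (\<lambda>h. Option.bind (K2 (pair h (right (pair p r)))) (\<lambda>r'. K1 (pair (left (pair p r)) r'))) = Some q)"
      by simp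
  qed
qed

lemma computable_lift_seq:
  assumes "computable F"
  obtains L where "computable L"
    "\<And>p. (\<And>i. F (component p i) \<noteq> None) \<Longrightarrow> \<exists>s. L p = Some s \<and> (\<forall>i. F (component p i) = Some (component s i))"
proof -
  have "rcp (\<lambda>p i. True)" "rc (\<lambda>p z. component p (pfst z) (psnd z))"
    unfolding rcp_def baire_defs by (simp, intro rc_intros)+
  from computable_lift[OF assms this] obtain L where L: "computable L"
    "\<And>p. (\<And>i. True \<Longrightarrow> F (component p i) \<noteq> None) \<Longrightarrow>
       \<exists>s. L p = Some s \<and> (\<forall>i. True \<longrightarrow> F (component p i) = Some (component s i))" by blast
  show ?thesis by (rule that[of L]) (use L in auto)
qed

lemma computable_lift_list:
  assumes "computable F"
  obtains L where "computable L"
    "\<And>p. (\<And>k. k < p 0 \<Longrightarrow> F (elem p k) \<noteq> None) \<Longrightarrow>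
       \<exists>s. L p = Some s \<and> s 0 = p 0 \<and> (\<forall>k<p 0. F (elem p k) = Some (elem s k))"
proof -
  have "rcp (\<lambda>p i. i < p 0)" "rc (\<lambda>p z. elem p (pfst z) (psnd z))"
    unfolding baire_defs by (intro rc_intros)+
  from computable_lift[OF assms this] obtain L where L: "computable L"
    "\<And>p. (\<And>i. i < p 0 \<Longrightarrow> F (elem p i) \<noteq> None) \<Longrightarrow>
       \<exists>s. L p = Some s \<and> (\<forall>i. i < p 0 \<longrightarrow> F (elem p i) = Some (component s i))" by blast
  have c: "computable (\<lambda>p. Option.bind (L p) (\<lambda>s. Some (mk_list (p 0) (component s))))"
    by (intro computable_intros L(1); (unfold baire_defs)?; intro rc_intros)
  show ?thesis
  proof (rule that[OF c])
    fix p assume "\<And>k. k < p 0 \<Longrightarrow> F (elem p k) \<noteq> None"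
    from L(2)[OF this] show "\<exists>s. Option.bind (L p) (\<lambda>s. Some (mk_list (p 0) (component s))) = Some s \<and>
        s 0 = p 0 \<and> (\<forall>k<p 0. F (elem p k) = Some (elem s k))" by auto
  qed
qed

definition zip_seq :: "baire \<Rightarrow> baire \<Rightarrow> baire" where
  "zip_seq p r = mk_seq (\<lambda>i. pair (component p i) (component r i))"

definition zip_list :: "baire \<Rightarrow> baire \<Rightarrow> baire" where
  "zip_list p r = mk_list (p 0) (\<lambda>k. pair (elem p k) (elem r k))"

lemma component_zip_seq [simp]: "component (zip_seq p r) i = pair (component p i) (component r i)"
  by (simp add: zip_seq_def)

lemma zip_list_0 [simp]: "zip_list p r 0 = p 0"
  and elem_zip_list [simp]: "elem (zip_list p r) k = pair (elem p k) (elem r k)"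
  by (simp_all add: zip_list_def)

section \<open>Domains of the operations\<close>

lemma rhat_eq_empty_iff: "rhat F p = {} \<longleftrightarrow> (\<exists>i. F (component p i) = {})"
proof -
  have "\<exists>q. q \<in> rhat F p" if "\<And>i. F (component p i) \<noteq> {}"
  proof -
    from that have "\<forall>i. \<exists>q. q \<in> F (component p i)" by blast
    then obtain q where "\<And>i. q i \<in> F (component p i)" by metis
    then show ?thesis by (intro exI[of _ "mk_seq q"]) (simp add: rhat_def)
  qed
  then show ?thesis by (fastforce simp: rhat_def)
qed

lemma rstar_eq_empty_iff: "rstar F p = {} \<longleftrightarrow> (\<exists>k<p 0. F (elem p k) = {})"
proof -
  have "\<exists>q. q \<in> rstar F p" if "\<And>k. k < p 0 \<Longrightarrow> F (elem p k) \<noteq> {}"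
  proof -
    from that have "\<forall>k. \<exists>q. k < p 0 \<longrightarrow> q \<in> F (elem p k)" by blast
    then obtain q where "\<And>k. k < p 0 \<Longrightarrow> q k \<in> F (elem p k)" by metis
    then show ?thesis by (intro exI[of _ "mk_list (p 0) q"]) (simp add: rstar_def)
  qed
  then show ?thesis by (fastforce simp: rstar_def)
qed

lemma rprod_eq_empty_iff: "rprod F G p = {} \<longleftrightarrow> F (left p) = {} \<or> G (right p) = {}"
proof (cases "F (left p) = {} \<or> G (right p) = {}")
  case False
  then obtain a b where "a \<in> F (left p)" "b \<in> G (right p)" by blast
  then have "pair a b \<in> rprod F G p" by (simp add: rprod_def)
  with False show ?thesis by blast
qed (auto simp: rprod_def)

lemma rsup_eq_empty_iff:
  "rsup F G p = {} \<longleftrightarrow> \<not> (p 0 = 0 \<and> F (tail p) \<noteq> {} \<or> p 0 = 1 \<and> G (tail p) \<noteq> {})"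
proof (cases "p 0 = 0 \<and> F (tail p) \<noteq> {} \<or> p 0 = 1 \<and> G (tail p) \<noteq> {}")
  case True
  then obtain a where "p 0 = 0 \<and> a \<in> F (tail p) \<or> p 0 = 1 \<and> a \<in> G (tail p)" by blast
  then have "cons (p 0) a \<in> rsup F G p" by (simp add: rsup_def)
  with True show ?thesis by blast
qed (auto simp: rsup_def)

lemma rinf_eq_empty_iff: "rinf F G p = {} \<longleftrightarrow> F (left p) = {} \<or> G (right p) = {}"
proof (cases "F (left p) = {} \<or> G (right p) = {}")
  case False
  then obtain a where "a \<in> F (left p)" by blast
  with False have "cons 0 a \<in> rinf F G p" by (simp add: rinf_def)
  with False show ?thesis by blast
qed (auto simp: rinf_def)

lemma rcompprod_run:
  assumes "rcompprod U F G p \<noteq> {}" "y \<in> G (right p)"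
  shows "\<exists>s. run U (pair (left p) (pair y t)) = Some s \<and> F (right s) \<noteq> {}"
  using assms unfolding rcompprod_def by blast

text \<open>
  For universal \<open>U\<close>, this is reducibility to \<open>rcompprod U F G\<close>: the context that the final step
  needs, the input and the answer to \<open>G\<close>, passes through its identity component.
\<close>

definition seqred :: "brel \<Rightarrow> brel \<Rightarrow> brel \<Rightarrow> bool" where
  "seqred E F G \<longleftrightarrow> (\<exists>H M K. computable H \<and> computable M \<and> computable K \<and>
     (\<forall>p. E p \<noteq> {} \<longrightarrow> (\<exists>x. H p = Some x \<and> G x \<noteq> {} \<and>
        (\<forall>y\<in>G x. \<exists>u. M (pair p y) = Some u \<and> F u \<noteq> {} \<and>
           (\<forall>v\<in>F u. \<exists>q\<in>E p. K (pair (pair p y) v) = Some q)))))"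

lemma seqredI:
  assumes "computable H" "computable M" "computable K"
    and "\<And>p. E p \<noteq> {} \<Longrightarrow> \<exists>x. H p = Some x \<and> G x \<noteq> {} \<and>
        (\<forall>y\<in>G x. \<exists>u. M (pair p y) = Some u \<and> F u \<noteq> {} \<and>
           (\<forall>v\<in>F u. \<exists>q\<in>E p. K (pair (pair p y) v) = Some q))"
  shows "seqred E F G"
  using assms unfolding seqred_def by blast

lemma seqredE:
  assumes "seqred E F G"
  obtains H M K where "computable H" "computable M" "computable K"
    "\<And>p. E p \<noteq> {} \<Longrightarrow> \<exists>x. H p = Some x \<and> G x \<noteq> {} \<and>
        (\<forall>y\<in>G x. \<exists>u. M (pair p y) = Some u \<and> F u \<noteq> {} \<and>
           (\<forall>v\<in>F u. \<exists>q\<in>E p. K (pair (pair p y) v) = Some q))"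
  using assms unfolding seqred_def by blast

lemma seqred_rcompprod: "seqred (rcompprod U F G) F G"
proof (rule seqredI)
  \<comment> \<open>Any second half of the cylinder name is admissible. Fixing the zero sequence
    makes the last two steps see the same output of the machine, so the answer to \<open>F\<close>
    fits the identity component.\<close>
  let ?R = "\<lambda>z. run U (pair (left (left z)) (pair (right z) (\<lambda>_. 0)))"
  show "computable (\<lambda>p. Some (right p))"
    by (intro computable_intros; (unfold baire_defs)?; intro rc_intros)
  show "computable (\<lambda>z. Option.bind (?R z) (\<lambda>s. Some (right s)))"
    by (intro computable_intros computable_comp_total[OF computable_run]; (unfold baire_defs)?; intro rc_intros)
  show "computable (\<lambda>z. Option.bind (?R (left z)) (\<lambda>s. Some (pair (left s) (right z))))"
    by (intro computable_intros computable_comp_total[OF computable_run]; (unfold baire_defs)?; intro rc_intros)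
  fix p assume "rcompprod U F G p \<noteq> {}"
  then have G: "G (right p) \<noteq> {}" and *: "\<And>y t. y \<in> G (right p) \<Longrightarrow>
      \<exists>s. run U (pair (left p) (pair y t)) = Some s \<and> F (right s) \<noteq> {}"
    unfolding rcompprod_def by blast+
  have "\<exists>u. Option.bind (?R (pair p y)) (\<lambda>s. Some (right s)) = Some u \<and> F u \<noteq> {} \<and>
      (\<forall>v\<in>F u. \<exists>q\<in>rcompprod U F G p. Option.bind (?R (left (pair (pair p y) v)))
         (\<lambda>s. Some (pair (left s) (right (pair (pair p y) v)))) = Some q)"
    if y: "y \<in> G (right p)" for y
  proof -
    from *[OF y] obtain s where s: "run U (pair (left p) (pair y (\<lambda>_. 0))) = Some s" "F (right s) \<noteq> {}"
      by blast
    have "pair (left s) v \<in> rcompprod U F G p" if "v \<in> F (right s)" for v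
      unfolding rcompprod_def mem_Collect_eq left_pair right_pair using G * s(1) y that by blast
    with s show ?thesis by simp
  qed
  with G show "\<exists>x. Some (right p) = Some x \<and> G x \<noteq> {} \<and>
      (\<forall>y\<in>G x. \<exists>u. Option.bind (?R (pair p y)) (\<lambda>s. Some (right s)) = Some u \<and> F u \<noteq> {} \<and>
      (\<forall>v\<in>F u. \<exists>q\<in>rcompprod U F G p. Option.bind (?R (left (pair (pair p y) v)))
         (\<lambda>s. Some (pair (left s) (right (pair (pair p y) v)))) = Some q))"
    by simp
qed

lemma seqred_imp_red:
  assumes U: "universal U" and "seqred E F G"
  shows "red E (rcompprod U F G)"
proof -
  obtain H M K where c: "computable H" "computable M" "computable K" and
    *: "\<And>p. E p \<noteq> {} \<Longrightarrow> \<exists>x. H p = Some x \<and> G x \<noteq> {} \<and>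
        (\<forall>y\<in>G x. \<exists>u. M (pair p y) = Some u \<and> F u \<noteq> {} \<and>
           (\<forall>v\<in>F u. \<exists>q\<in>E p. K (pair (pair p y) v) = Some q))"
    using assms(2) by (rule seqredE) blast
  \<comment> \<open>\<open>N\<close> disregards the second half of the cylinder name and copies
    \<open>p\<close> and \<open>y\<close> into the identity component.\<close>
  let ?N = "\<lambda>z. Option.bind (M (pair (left z) (left (right z))))
      (\<lambda>u. Some (pair (pair (left z) (left (right z))) u))"
  have "computable ?N"
    by (intro computable_intros computable_comp_total[OF c(2)]; (unfold baire_defs)?; intro rc_intros)
  then obtain N where N: "\<And>z q. ?N z = Some q \<Longrightarrow> run N z = Some q"
    by (rule computableE) blast
  \<comment> \<open>By universality, \<open>S p\<close> is a computable name of the function that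
    \<open>N\<close> computes with parameter \<open>p\<close>, with the same domain.\<close>
  from U obtain S where S: "computable (\<lambda>p. Some (S p))" "\<And>p q. run U (pair (S p) q) = run N (pair p q)"
    unfolding universal_def by blast
  show ?thesis
  proof (rule redI)
    show "computable (\<lambda>z. K (right z))"
      by (intro computable_comp_total[OF c(3)]; (unfold baire_defs)?; intro rc_intros)
    show "computable (\<lambda>p. Option.bind (H p) (\<lambda>x. Option.bind (Some (S p)) (\<lambda>s. Some (pair s x))))"
      by (intro computable_bind c(1) computable_comp_total[OF S(1)] computable_total;
          (unfold baire_defs)?; intro rc_intros)
    fix p assume "E p \<noteq> {}"
    from *[OF this] obtain x where x: "H p = Some x" "G x \<noteq> {}" and y:
      "\<And>y. y \<in> G x \<Longrightarrow> \<exists>u. M (pair p y) = Some u \<and> F u \<noteq> {} \<and>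
           (\<forall>v\<in>F u. \<exists>q\<in>E p. K (pair (pair p y) v) = Some q)" by blast
    let ?P = "pair (S p) x"
    have run: "\<exists>u. run U (pair (S p) (pair y t)) = Some (pair (pair p y) u) \<and> F u \<noteq> {} \<and>
        (\<forall>v\<in>F u. \<exists>q\<in>E p. K (pair (pair p y) v) = Some q)" if "y \<in> G x" for y t
    proof -
      from y[OF that] obtain u where u: "M (pair p y) = Some u" "F u \<noteq> {}"
           "\<forall>v\<in>F u. \<exists>q\<in>E p. K (pair (pair p y) v) = Some q" by blast
      then have "run N (pair p (pair y t)) = Some (pair (pair p y) u)" by (intro N) simp
      with u S(2) show ?thesis by (intro exI[of _ u]) simp
    qed
    have all: "\<exists>s. run U (pair (S p) (pair y t)) = Some s \<and> F (right s) \<noteq> {}" if "y \<in> G x" for y t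
      using run[OF that, of t] by fastforce
    have "rcompprod U F G ?P \<noteq> {}"
    proof -
      from x obtain y where y: "y \<in> G x" by blast
      from run[OF y, of undefined] obtain u v where
        "run U (pair (S p) (pair y undefined)) = Some (pair (pair p y) u)" "v \<in> F u" by blast
      with y all have "pair (pair p y) v \<in> rcompprod U F G ?P"
        unfolding rcompprod_def mem_Collect_eq left_pair right_pair by fastforce
      then show ?thesis by blast
    qed
    moreover have "\<exists>q\<in>E p. K r = Some q" if "r \<in> rcompprod U F G ?P" for r
    proof -
      from that obtain y t s where r: "y \<in> G x" "run U (pair (S p) (pair y t)) = Some s"
        "left r = left s" "right r \<in> F (right s)"
        unfolding rcompprod_def mem_Collect_eq left_pair right_pair by blast
      from run[OF r(1), of t] obtain u where u: "run U (pair (S p) (pair y t)) = Some (pair (pair p y) u)"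
        "\<forall>v\<in>F u. \<exists>q\<in>E p. K (pair (pair p y) v) = Some q" by blast
      with r have s: "s = pair (pair p y) u" by simp
      with r u(2) obtain q where "q \<in> E p" "K (pair (left r) (right r)) = Some q"
        by auto
      then show ?thesis by auto
    qed
    ultimately show "\<exists>h. Option.bind (H p) (\<lambda>x. Option.bind (Some (S p)) (\<lambda>s. Some (pair s x))) = Some h \<and>
        rcompprod U F G h \<noteq> {} \<and> (\<forall>r\<in>rcompprod U F G h. \<exists>q\<in>E p. K (right (pair p r)) = Some q)"
      using x by simp
  qed
qed

lemma seqred_mono:
  assumes "seqred E F G" "red F F'" "red G G'"
  shows "seqred E F' G'"
proof -
  obtain H M K where c: "computable H" "computable M" "computable K" and
    0: "\<And>p. E p \<noteq> {} \<Longrightarrow> \<exists>x. H p = Some x \<and> G x \<noteq> {} \<and>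
        (\<forall>y\<in>G x. \<exists>u. M (pair p y) = Some u \<and> F u \<noteq> {} \<and>
           (\<forall>v\<in>F u. \<exists>q\<in>E p. K (pair (pair p y) v) = Some q))"
    using assms(1) by (rule seqredE) blast
  obtain K1 H1 where c1: "computable K1" "computable H1" and 1: "\<And>p. F p \<noteq> {} \<Longrightarrow>
      \<exists>h. H1 p = Some h \<and> F' h \<noteq> {} \<and> (\<forall>r\<in>F' h. \<exists>q\<in>F p. K1 (pair p r) = Some q)"
    using assms(2) by (rule redE) blast
  obtain K2 H2 where c2: "computable K2" "computable H2" and 2: "\<And>p. G p \<noteq> {} \<Longrightarrow>
      \<exists>h. H2 p = Some h \<and> G' h \<noteq> {} \<and> (\<forall>r\<in>G' h. \<exists>q\<in>G p. K2 (pair p r) = Some q)"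
    using assms(3) by (rule redE) blast
  note comps = c[THEN computable_comp_total] c1[THEN computable_comp_total] c2[THEN computable_comp_total]
  \<comment> \<open>\<open>Y\<close> and \<open>W\<close> recover the original answer to
    \<open>G\<close> and the original query to \<open>F\<close>. The last step needs both again, but
    is given only \<open>p\<close> and the answers to \<open>G'\<close> and
    \<open>F'\<close>.\<close>
  define Y where "Y z = Option.bind (H (left z)) (\<lambda>x. K2 (pair x (right z)))" for z
  define W where "W z = Option.bind (Y z) (\<lambda>y. M (pair (left z) y))" for z
  have Y: "computable Y" unfolding Y_def
    by (intro computable_intros comps; (unfold baire_defs)?; intro rc_intros)
  have W: "computable W" unfolding W_def
    by (intro computable_intros Y comps; (unfold baire_defs)?; intro rc_intros)
  show ?thesis
  proof (rule seqredI)
    show "computable (\<lambda>p. Option.bind (H p) H2)"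
      by (intro computable_intros c comps; (unfold baire_defs)?; intro rc_intros)
    show "computable (\<lambda>z. Option.bind (W z) H1)"
      by (intro computable_intros W comps; (unfold baire_defs)?; intro rc_intros)
    show "computable (\<lambda>z. Option.bind (Y (left z)) (\<lambda>y. Option.bind (W (left z)) (\<lambda>u.
        Option.bind (K1 (pair u (right z))) (\<lambda>v. K (pair (pair (left (left z)) y) v)))))"
      by (intro computable_intros W[THEN computable_comp_total] Y[THEN computable_comp_total] comps;
          (unfold baire_defs)?; intro rc_intros)
    fix p assume "E p \<noteq> {}"
    from 0[OF this] obtain x where x: "H p = Some x" "G x \<noteq> {}" and y:
      "\<And>y. y \<in> G x \<Longrightarrow> \<exists>u. M (pair p y) = Some u \<and> F u \<noteq> {} \<and>
           (\<forall>v\<in>F u. \<exists>q\<in>E p. K (pair (pair p y) v) = Some q)" by blast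
    from 2[OF x(2)] obtain x' where x': "H2 x = Some x'" "G' x' \<noteq> {}"
      "\<And>r. r \<in> G' x' \<Longrightarrow> \<exists>q\<in>G x. K2 (pair x r) = Some q" by blast
    have "\<exists>u'. Option.bind (W (pair p y')) H1 = Some u' \<and> F' u' \<noteq> {} \<and>
        (\<forall>v'\<in>F' u'. \<exists>q\<in>E p. Option.bind (Y (pair p y')) (\<lambda>y. Option.bind (W (pair p y')) (\<lambda>u.
        Option.bind (K1 (pair u v')) (\<lambda>v. K (pair (pair p y) v)))) = Some q)"
      if y': "y' \<in> G' x'" for y'
    proof -
      from x'(3)[OF y'] obtain y0 where y0: "y0 \<in> G x" "K2 (pair x y') = Some y0" by blast
      from y[OF y0(1)] obtain u where u: "M (pair p y0) = Some u" "F u \<noteq> {}"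
        "\<And>v. v \<in> F u \<Longrightarrow> \<exists>q\<in>E p. K (pair (pair p y0) v) = Some q" by blast
      from 1[OF u(2)] obtain u' where u': "H1 u = Some u'" "F' u' \<noteq> {}"
        "\<And>r. r \<in> F' u' \<Longrightarrow> \<exists>q\<in>F u. K1 (pair u r) = Some q" by blast
      have Y1: "Y (pair p y') = Some y0" by (simp add: Y_def x y0)
      have W1: "W (pair p y') = Some u" by (simp add: W_def Y1 u)
      have "\<exists>q\<in>E p. Option.bind (K1 (pair u v')) (\<lambda>v. K (pair (pair p y0) v)) = Some q"
        if v': "v' \<in> F' u'" for v'
        using u'(3)[OF v'] u(3) by fastforce
      with Y1 W1 u' show ?thesis by simp
    qed
    with x x' show "\<exists>x'. Option.bind (H p) H2 = Some x' \<and> G' x' \<noteq> {} \<and>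
        (\<forall>y'\<in>G' x'. \<exists>u'. Option.bind (W (pair p y')) H1 = Some u' \<and> F' u' \<noteq> {} \<and>
        (\<forall>v'\<in>F' u'. \<exists>q\<in>E p. Option.bind (Y (left (pair (pair p y') v'))) (\<lambda>y.
        Option.bind (W (left (pair (pair p y') v'))) (\<lambda>u.
        Option.bind (K1 (pair u (right (pair (pair p y') v')))) (\<lambda>v.
          K (pair (pair (left (left (pair (pair p y') v'))) y) v)))) = Some q))"
      by simp
  qed
qed

lemma rcompprod_mono:
  assumes "universal U" "red F F'" "red G G'"
  shows "red (rcompprod U F G) (rcompprod U F' G')"
  using assms seqred_imp_red seqred_mono seqred_rcompprod by blast

lemma seqred_hat:
  assumes "seqred E F G"
  shows "seqred (rhat E) (rhat F) (rhat G)"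
proof -
  obtain H M K where c: "computable H" "computable M" "computable K" and
    *: "\<And>p. E p \<noteq> {} \<Longrightarrow> \<exists>x. H p = Some x \<and> G x \<noteq> {} \<and>
        (\<forall>y\<in>G x. \<exists>u. M (pair p y) = Some u \<and> F u \<noteq> {} \<and>
           (\<forall>v\<in>F u. \<exists>q\<in>E p. K (pair (pair p y) v) = Some q))"
    using assms by (rule seqredE) blast
  obtain H' where H': "computable H'" "\<And>p. (\<And>i. H (component p i) \<noteq> None) \<Longrightarrow>
      \<exists>s. H' p = Some s \<and> (\<forall>i. H (component p i) = Some (component s i))"
    by (rule computable_lift_seq[OF c(1)]) blast
  obtain M' where M': "computable M'" "\<And>p. (\<And>i. M (component p i) \<noteq> None) \<Longrightarrow>
      \<exists>s. M' p = Some s \<and> (\<forall>i. M (component p i) = Some (component s i))"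
    by (rule computable_lift_seq[OF c(2)]) blast
  obtain K' where K': "computable K'" "\<And>p. (\<And>i. K (component p i) \<noteq> None) \<Longrightarrow>
      \<exists>s. K' p = Some s \<and> (\<forall>i. K (component p i) = Some (component s i))"
    by (rule computable_lift_seq[OF c(3)]) blast
  show ?thesis
  proof (rule seqredI[OF H'(1)])
    show "computable (\<lambda>z. M' (zip_seq (left z) (right z)))"
      by (intro computable_comp_total[OF M'(1)]; unfold zip_seq_def baire_defs; intro rc_intros)
    show "computable (\<lambda>z. K' (zip_seq (zip_seq (left (left z)) (right (left z))) (right z)))"
      by (intro computable_comp_total[OF K'(1)]; unfold zip_seq_def baire_defs; intro rc_intros)
    fix p assume "rhat E p \<noteq> {}"
    then have E: "E (component p i) \<noteq> {}" for i by (simp add: rhat_eq_empty_iff)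
    \<comment> \<open>A lifted program has an output only if it succeeds in all components; this is
      verified before each of the three lifted steps is run.\<close>
    have "H (component p i) \<noteq> None" for i using *[OF E[of i]] by force
    from H'(2)[OF this] obtain x where x: "H' p = Some x" "\<And>i. H (component p i) = Some (component x i)"
      by blast
    have G: "G (component x i) \<noteq> {}" for i using *[OF E[of i]] x(2)[of i] by force
    have y: "\<exists>u. M (pair (component p i) y) = Some u \<and> F u \<noteq> {} \<and>
           (\<forall>v\<in>F u. \<exists>q\<in>E (component p i). K (pair (pair (component p i) y) v) = Some q)"
      if "y \<in> G (component x i)" for i y
      using *[OF E[of i]] x(2)[of i] that by force
    have "\<exists>u. M' (zip_seq p y) = Some u \<and> rhat F u \<noteq> {} \<and>
        (\<forall>v\<in>rhat F u. \<exists>q\<in>rhat E p. K' (zip_seq (zip_seq p y) v) = Some q)"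
      if "y \<in> rhat G x" for y
    proof -
      from that have yi: "component y i \<in> G (component x i)" for i by (simp add: rhat_def)
      have "M (component (zip_seq p y) i) \<noteq> None" for i using y[OF yi] by force
      from M'(2)[OF this] obtain u where u: "M' (zip_seq p y) = Some u"
        "\<And>i. M (pair (component p i) (component y i)) = Some (component u i)" by auto
      have F: "F (component u i) \<noteq> {}" for i using y[OF yi, of i] u(2)[of i] by force
      have K: "\<exists>q\<in>E (component p i). K (pair (pair (component p i) (component y i)) v) = Some q"
        if "v \<in> F (component u i)" for i v using y[OF yi, of i] u(2)[of i] that by force
      have "\<exists>q\<in>rhat E p. K' (zip_seq (zip_seq p y) v) = Some q" if "v \<in> rhat F u" for v
      proof -
        from that have vi: "component v i \<in> F (component u i)" for i by (simp add: rhat_def)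
        have "K (component (zip_seq (zip_seq p y) v) i) \<noteq> None" for i using K[OF vi] by force
        from K'(2)[OF this] obtain q where q: "K' (zip_seq (zip_seq p y) v) = Some q"
          "\<And>i. K (pair (pair (component p i) (component y i)) (component v i)) = Some (component q i)"
          by auto
        have "component q i \<in> E (component p i)" for i using K[OF vi, of i] q(2)[of i] by force
        with q(1) show ?thesis by (auto simp: rhat_def)
      qed
      with u(1) F show ?thesis by (auto simp: rhat_eq_empty_iff)
    qed
    with x(1) G show "\<exists>x. H' p = Some x \<and> rhat G x \<noteq> {} \<and> (\<forall>y\<in>rhat G x.
        \<exists>u. M' (zip_seq (left (pair p y)) (right (pair p y))) = Some u \<and> rhat F u \<noteq> {} \<and>
        (\<forall>v\<in>rhat F u. \<exists>q\<in>rhat E p. K' (zip_seq (zip_seq (left (left (pair (pair p y) v)))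
           (right (left (pair (pair p y) v)))) (right (pair (pair p y) v))) = Some q))"
      by (simp add: rhat_eq_empty_iff)
  qed
qed

lemma seqred_star:
  assumes "seqred E F G"
  shows "seqred (rstar E) (rstar F) (rstar G)"
proof -
  obtain H M K where c: "computable H" "computable M" "computable K" and
    *: "\<And>p. E p \<noteq> {} \<Longrightarrow> \<exists>x. H p = Some x \<and> G x \<noteq> {} \<and>
        (\<forall>y\<in>G x. \<exists>u. M (pair p y) = Some u \<and> F u \<noteq> {} \<and>
           (\<forall>v\<in>F u. \<exists>q\<in>E p. K (pair (pair p y) v) = Some q))"
    using assms by (rule seqredE) blast
  obtain H' where H': "computable H'" "\<And>p. (\<And>k. k < p 0 \<Longrightarrow> H (elem p k) \<noteq> None) \<Longrightarrow>
      \<exists>s. H' p = Some s \<and> s 0 = p 0 \<and> (\<forall>k<p 0. H (elem p k) = Some (elem s k))"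
    by (rule computable_lift_list[OF c(1)]) blast
  obtain M' where M': "computable M'" "\<And>p. (\<And>k. k < p 0 \<Longrightarrow> M (elem p k) \<noteq> None) \<Longrightarrow>
      \<exists>s. M' p = Some s \<and> s 0 = p 0 \<and> (\<forall>k<p 0. M (elem p k) = Some (elem s k))"
    by (rule computable_lift_list[OF c(2)]) blast
  obtain K' where K': "computable K'" "\<And>p. (\<And>k. k < p 0 \<Longrightarrow> K (elem p k) \<noteq> None) \<Longrightarrow>
      \<exists>s. K' p = Some s \<and> s 0 = p 0 \<and> (\<forall>k<p 0. K (elem p k) = Some (elem s k))"
    by (rule computable_lift_list[OF c(3)]) blast
  show ?thesis
  proof (rule seqredI[OF H'(1)])
    show "computable (\<lambda>z. M' (zip_list (left z) (right z)))"
      by (intro computable_comp_total[OF M'(1)]; unfold zip_list_def baire_defs; intro rc_intros)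
    show "computable (\<lambda>z. K' (zip_list (zip_list (left (left z)) (right (left z))) (right z)))"
      by (intro computable_comp_total[OF K'(1)]; unfold zip_list_def baire_defs; intro rc_intros)
    fix p assume "rstar E p \<noteq> {}"
    then have E: "E (elem p k) \<noteq> {}" if "k < p 0" for k using that by (simp add: rstar_eq_empty_iff)
    have "H (elem p k) \<noteq> None" if "k < p 0" for k using *[OF E[OF that]] by force
    from H'(2)[OF this] obtain x where x: "H' p = Some x" "x 0 = p 0"
      "\<And>k. k < p 0 \<Longrightarrow> H (elem p k) = Some (elem x k)"
      by blast
    have G: "G (elem x k) \<noteq> {}" if "k < p 0" for k using *[OF E[OF that]] x(3)[OF that] by force
    have y: "\<exists>u. M (pair (elem p k) y) = Some u \<and> F u \<noteq> {} \<and>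
           (\<forall>v\<in>F u. \<exists>q\<in>E (elem p k). K (pair (pair (elem p k) y) v) = Some q)"
      if "y \<in> G (elem x k)" "k < p 0" for k y
      using *[OF E[OF that(2)]] x(3)[OF that(2)] that by force
    have "\<exists>u. M' (zip_list p y) = Some u \<and> rstar F u \<noteq> {} \<and>
        (\<forall>v\<in>rstar F u. \<exists>q\<in>rstar E p. K' (zip_list (zip_list p y) v) = Some q)"
      if "y \<in> rstar G x" for y
    proof -
      \<comment> \<open>An answer has the length of its query, so \<open>p 0\<close> bounds the
        indices throughout.\<close>
      from that have yi: "elem y k \<in> G (elem x k)" if "k < p 0" for k
        using that x(2) by (simp add: rstar_def)
      have "M (elem (zip_list p y) k) \<noteq> None" if "k < zip_list p y 0" for k
        using y[OF yi, of k] that by force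
      from M'(2)[OF this] obtain u where u: "M' (zip_list p y) = Some u" "u 0 = p 0"
        "\<And>k. k < p 0 \<Longrightarrow> M (pair (elem p k) (elem y k)) = Some (elem u k)" by auto
      have F: "F (elem u k) \<noteq> {}" if "k < p 0" for k using y[OF yi, of k] u(3)[of k] that by force
      have K: "\<exists>q\<in>E (elem p k). K (pair (pair (elem p k) (elem y k)) v) = Some q"
        if "v \<in> F (elem u k)" "k < p 0" for k v using y[OF yi, of k] u(3)[of k] that by force
      have "\<exists>q\<in>rstar E p. K' (zip_list (zip_list p y) v) = Some q" if "v \<in> rstar F u" for v
      proof -
        from that have vi: "elem v k \<in> F (elem u k)" if "k < p 0" for k
          using that u(2) by (simp add: rstar_def)
        have "K (elem (zip_list (zip_list p y) v) k) \<noteq> None" if "k < zip_list (zip_list p y) v 0" for k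
          using K[OF vi, of k] that by force
        from K'(2)[OF this] obtain q where q: "K' (zip_list (zip_list p y) v) = Some q" "q 0 = p 0"
          "\<And>k. k < p 0 \<Longrightarrow> K (pair (pair (elem p k) (elem y k)) (elem v k)) = Some (elem q k)"
          by auto
        have "elem q k \<in> E (elem p k)" if "k < p 0" for k using K[OF vi, of k] q(3)[of k] that by force
        with q show ?thesis by (auto simp: rstar_def)
      qed
      with u F show ?thesis by (auto simp: rstar_eq_empty_iff)
    qed
    with x G show "\<exists>x. H' p = Some x \<and> rstar G x \<noteq> {} \<and> (\<forall>y\<in>rstar G x.
        \<exists>u. M' (zip_list (left (pair p y)) (right (pair p y))) = Some u \<and> rstar F u \<noteq> {} \<and>
        (\<forall>v\<in>rstar F u. \<exists>q\<in>rstar E p. K' (zip_list (zip_list (left (left (pair (pair p y) v)))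
           (right (left (pair (pair p y) v)))) (right (pair (pair p y) v))) = Some q))"
      by (simp add: rstar_eq_empty_iff)
  qed
qed

lemma redI_total:
  assumes "rc K" "rc H"
    and "\<And>p. F p \<noteq> {} \<Longrightarrow> G (H p) \<noteq> {}"
    and "\<And>p r. F p \<noteq> {} \<Longrightarrow> r \<in> G (H p) \<Longrightarrow> K (pair p r) \<in> F p"
  shows "red F G"
  by (rule redI[of "\<lambda>p. Some (K p)" "\<lambda>p. Some (H p)"])
    (use assms in \<open>auto intro: computable_intros\<close>)

text \<open>An ordinary reduction is a two-step reduction whose second query goes to the identity.
  Thus the lifting of two-step reductions also yields monotonicity of both parallelizations.\<close>

lemma red_imp_seqred: "red E G \<Longrightarrow> seqred E (\<lambda>p. {p}) G"
proof (erule redE)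
  fix K H assume KH: "computable K" "computable H" and
    *: "\<And>p. E p \<noteq> {} \<Longrightarrow> \<exists>h. H p = Some h \<and> G h \<noteq> {} \<and> (\<forall>r\<in>G h. \<exists>q\<in>E p. K (pair p r) = Some q)"
  have "computable (\<lambda>z. Some (right z))"
    by (intro computable_intros; (unfold baire_defs)?; intro rc_intros)
  then show ?thesis
    by (rule seqredI[OF KH(2,1)]) (use * in fastforce)
qed

text \<open>If every query to \<open>F\<close> solves itself, it can be fed to the final step as its
  own answer. Lists and sequences over the identity have this property.\<close>

lemma seqred_imp_red_right:
  assumes "seqred E F G" and F: "\<And>u. F u \<noteq> {} \<Longrightarrow> u \<in> F u"
  shows "red E G"
proof -
  obtain H M K where c: "computable H" "computable M" "computable K" and
    *: "\<And>p. E p \<noteq> {} \<Longrightarrow> \<exists>x. H p = Some x \<and> G x \<noteq> {} \<and>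
        (\<forall>y\<in>G x. \<exists>u. M (pair p y) = Some u \<and> F u \<noteq> {} \<and>
           (\<forall>v\<in>F u. \<exists>q\<in>E p. K (pair (pair p y) v) = Some q))"
    using assms(1) by (rule seqredE) blast
  show ?thesis
  proof (rule redI[OF _ c(1)])
    show "computable (\<lambda>s. Option.bind (M s) (\<lambda>u. K (pair s u)))"
      by (intro computable_intros c computable_comp_total[OF c(3)]; (unfold baire_defs)?; intro rc_intros)
    fix p assume "E p \<noteq> {}"
    from *[OF this] obtain x where x: "H p = Some x" "G x \<noteq> {}" and y:
      "\<And>y. y \<in> G x \<Longrightarrow> \<exists>u. M (pair p y) = Some u \<and> F u \<noteq> {} \<and>
           (\<forall>v\<in>F u. \<exists>q\<in>E p. K (pair (pair p y) v) = Some q)" by blast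
    have "\<exists>q\<in>E p. Option.bind (M (pair p y)) (\<lambda>u. K (pair (pair p y) u)) = Some q" if "y \<in> G x" for y
      using y[OF that] F by fastforce
    with x show "\<exists>h. H p = Some h \<and> G h \<noteq> {} \<and> (\<forall>r\<in>G h. \<exists>q\<in>E p.
        Option.bind (M (pair p r)) (\<lambda>u. K (pair (pair p r) u)) = Some q)" by blast
  qed
qed

lemma rhat_mono: "red F G \<Longrightarrow> red (rhat F) (rhat G)"
  by (rule seqred_imp_red_right[OF seqred_hat[OF red_imp_seqred]]) (auto simp: rhat_def)

lemma rstar_mono: "red F G \<Longrightarrow> red (rstar F) (rstar G)"
  by (rule seqred_imp_red_right[OF seqred_star[OF red_imp_seqred]]) (auto simp: rstar_def)

section \<open>Monotonicity of product, join and meet\<close>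

context
  fixes F F' G G' :: brel
  assumes red: "red F F'" "red G G'"
begin

lemma rprod_mono: "red (rprod F G) (rprod F' G')"
proof -
  obtain K1 H1 where c1: "computable K1" "computable H1" and 1: "\<And>p. F p \<noteq> {} \<Longrightarrow>
      \<exists>h. H1 p = Some h \<and> F' h \<noteq> {} \<and> (\<forall>r\<in>F' h. \<exists>q\<in>F p. K1 (pair p r) = Some q)"
    using red(1) by (rule redE) blast
  obtain K2 H2 where c2: "computable K2" "computable H2" and 2: "\<And>p. G p \<noteq> {} \<Longrightarrow>
      \<exists>h. H2 p = Some h \<and> G' h \<noteq> {} \<and> (\<forall>r\<in>G' h. \<exists>q\<in>G p. K2 (pair p r) = Some q)"
    using red(2) by (rule redE) blast
  note comps = c1[THEN computable_comp_total] c2[THEN computable_comp_total]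
  show ?thesis
  proof (rule redI)
    show "computable (\<lambda>s. Option.bind (K1 (pair (left (left s)) (left (right s)))) (\<lambda>a.
        Option.bind (K2 (pair (right (left s)) (right (right s)))) (\<lambda>b. Some (pair a b))))"
      by (intro computable_intros comps; (unfold baire_defs)?; intro rc_intros)
    show "computable (\<lambda>p. Option.bind (H1 (left p)) (\<lambda>a. Option.bind (H2 (right p)) (\<lambda>b. Some (pair a b))))"
      by (intro computable_intros comps; (unfold baire_defs)?; intro rc_intros)
    fix p assume "rprod F G p \<noteq> {}"
    then have "F (left p) \<noteq> {}" "G (right p) \<noteq> {}" by (auto simp: rprod_eq_empty_iff)
    with 1 2 obtain h k where h: "H1 (left p) = Some h" "F' h \<noteq> {}"
      "\<forall>r\<in>F' h. \<exists>q\<in>F (left p). K1 (pair (left p) r) = Some q"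
      and k: "H2 (right p) = Some k" "G' k \<noteq> {}"
      "\<forall>r\<in>G' k. \<exists>q\<in>G (right p). K2 (pair (right p) r) = Some q" by meson
    have "\<exists>q\<in>rprod F G p. Option.bind (K1 (pair (left p) (left r))) (\<lambda>a.
        Option.bind (K2 (pair (right p) (right r))) (\<lambda>b. Some (pair a b))) = Some q"
      if "r \<in> rprod F' G' (pair h k)" for r
    proof -
      from that h(3) k(3) obtain a b where "a \<in> F (left p)" "K1 (pair (left p) (left r)) = Some a"
        "b \<in> G (right p)" "K2 (pair (right p) (right r)) = Some b"
        by (auto simp: rprod_def) blast
      then show ?thesis by (simp add: rprod_def)
    qed
    with h k show "\<exists>h. Option.bind (H1 (left p)) (\<lambda>a. Option.bind (H2 (right p)) (\<lambda>b. Some (pair a b))) = Some h \<and>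
        rprod F' G' h \<noteq> {} \<and> (\<forall>r\<in>rprod F' G' h. \<exists>q\<in>rprod F G p.
        Option.bind (K1 (pair (left (left (pair p r))) (left (right (pair p r))))) (\<lambda>a.
        Option.bind (K2 (pair (right (left (pair p r))) (right (right (pair p r))))) (\<lambda>b. Some (pair a b))) = Some q)"
      by (simp add: rprod_eq_empty_iff)
  qed
qed

lemma rsup_mono: "red (rsup F G) (rsup F' G')"
proof -
  obtain K1 H1 where c1: "computable K1" "computable H1" and 1: "\<And>p. F p \<noteq> {} \<Longrightarrow>
      \<exists>h. H1 p = Some h \<and> F' h \<noteq> {} \<and> (\<forall>r\<in>F' h. \<exists>q\<in>F p. K1 (pair p r) = Some q)"
    using red(1) by (rule redE) blast
  obtain K2 H2 where c2: "computable K2" "computable H2" and 2: "\<And>p. G p \<noteq> {} \<Longrightarrow>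
      \<exists>h. H2 p = Some h \<and> G' h \<noteq> {} \<and> (\<forall>r\<in>G' h. \<exists>q\<in>G p. K2 (pair p r) = Some q)"
    using red(2) by (rule redE) blast
  note comps = c1[THEN computable_comp_total] c2[THEN computable_comp_total]
  define K where "K s = (if s 0 = 0 then Option.bind (K1 (pair (tail (left s)) (tail (right s)))) (\<lambda>a. Some (cons 0 a))
      else Option.bind (K2 (pair (tail (left s)) (tail (right s)))) (\<lambda>a. Some (cons 1 a)))" for s
  define H where "H p = (if p 0 = 0 then Option.bind (H1 (tail p)) (\<lambda>a. Some (cons 0 a))
      else Option.bind (H2 (tail p)) (\<lambda>a. Some (cons 1 a)))" for p
  show ?thesis
  proof (rule redI)
    show "computable K" unfolding K_def
      by (intro computable_intros comps; (unfold baire_defs)?; intro rc_intros)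
    show "computable H" unfolding H_def
      by (intro computable_intros comps; (unfold baire_defs)?; intro rc_intros)
    fix p assume p: "rsup F G p \<noteq> {}"
    \<comment> \<open>The final step distinguishes its cases by the tag of the input, which stands
      at position 0 of the pair.\<close>
    have s: "pair p r 0 = p 0" for r by (simp add: pair_def)
    show "\<exists>h. H p = Some h \<and> rsup F' G' h \<noteq> {} \<and> (\<forall>r\<in>rsup F' G' h. \<exists>q\<in>rsup F G p. K (pair p r) = Some q)"
    proof (cases "p 0 = 0")
      case True
      with p have "F (tail p) \<noteq> {}" by (auto simp: rsup_eq_empty_iff)
      from 1[OF this] obtain h where h: "H1 (tail p) = Some h" "F' h \<noteq> {}"
        "\<forall>r\<in>F' h. \<exists>q\<in>F (tail p). K1 (pair (tail p) r) = Some q" by blast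
      have "\<exists>q\<in>rsup F G p. K (pair p r) = Some q" if r: "r \<in> rsup F' G' (cons 0 h)" for r
      proof -
        from r have "tail r \<in> F' h" by (simp add: rsup_def)
        with h(3) obtain a where "a \<in> F (tail p)" "K1 (pair (tail p) (tail r)) = Some a" by blast
        with True show ?thesis by (simp add: K_def s rsup_def)
      qed
      with h True show ?thesis by (simp add: H_def rsup_eq_empty_iff)
    next
      case False
      with p have p: "p 0 = 1" "G (tail p) \<noteq> {}" by (auto simp: rsup_eq_empty_iff)
      from 2[OF p(2)] obtain h where h: "H2 (tail p) = Some h" "G' h \<noteq> {}"
        "\<forall>r\<in>G' h. \<exists>q\<in>G (tail p). K2 (pair (tail p) r) = Some q" by blast
      have "\<exists>q\<in>rsup F G p. K (pair p r) = Some q" if r: "r \<in> rsup F' G' (cons 1 h)" for r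
      proof -
        from r have "tail r \<in> G' h" by (simp add: rsup_def)
        with h(3) obtain a where "a \<in> G (tail p)" "K2 (pair (tail p) (tail r)) = Some a" by blast
        with p show ?thesis by (simp add: K_def s rsup_def)
      qed
      with h p show ?thesis by (simp add: H_def rsup_eq_empty_iff)
    qed
  qed
qed

lemma rinf_mono: "red (rinf F G) (rinf F' G')"
proof -
  obtain K1 H1 where c1: "computable K1" "computable H1" and 1: "\<And>p. F p \<noteq> {} \<Longrightarrow>
      \<exists>h. H1 p = Some h \<and> F' h \<noteq> {} \<and> (\<forall>r\<in>F' h. \<exists>q\<in>F p. K1 (pair p r) = Some q)"
    using red(1) by (rule redE) blast
  obtain K2 H2 where c2: "computable K2" "computable H2" and 2: "\<And>p. G p \<noteq> {} \<Longrightarrow>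
      \<exists>h. H2 p = Some h \<and> G' h \<noteq> {} \<and> (\<forall>r\<in>G' h. \<exists>q\<in>G p. K2 (pair p r) = Some q)"
    using red(2) by (rule redE) blast
  note comps = c1[THEN computable_comp_total] c2[THEN computable_comp_total]
  define K where "K s = (if right s 0 = 0
      then Option.bind (K1 (pair (left (left s)) (tail (right s)))) (\<lambda>a. Some (cons 0 a))
      else Option.bind (K2 (pair (right (left s)) (tail (right s)))) (\<lambda>a. Some (cons 1 a)))" for s
  show ?thesis
  proof (rule redI)
    show "computable K" unfolding K_def
      by (intro computable_intros comps; (unfold baire_defs)?; intro rc_intros)
    show "computable (\<lambda>p. Option.bind (H1 (left p)) (\<lambda>a. Option.bind (H2 (right p)) (\<lambda>b. Some (pair a b))))"
      by (intro computable_intros comps; (unfold baire_defs)?; intro rc_intros)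
    fix p assume "rinf F G p \<noteq> {}"
    then have FG: "F (left p) \<noteq> {}" "G (right p) \<noteq> {}" by (auto simp: rinf_eq_empty_iff)
    with 1 2 obtain h k where h: "H1 (left p) = Some h" "F' h \<noteq> {}"
      "\<forall>r\<in>F' h. \<exists>q\<in>F (left p). K1 (pair (left p) r) = Some q"
      and k: "H2 (right p) = Some k" "G' k \<noteq> {}"
      "\<forall>r\<in>G' k. \<exists>q\<in>G (right p). K2 (pair (right p) r) = Some q" by meson
    have "\<exists>q\<in>rinf F G p. K (pair p r) = Some q" if r: "r \<in> rinf F' G' (pair h k)" for r
    proof (cases "r 0 = 0")
      case True
      with r h(3) obtain a where "a \<in> F (left p)" "K1 (pair (left p) (tail r)) = Some a"
        by (auto simp: rinf_def)
      with True FG show ?thesis by (simp add: K_def rinf_def)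
    next
      case False
      with r k(3) obtain a where "a \<in> G (right p)" "K2 (pair (right p) (tail r)) = Some a"
        by (auto simp: rinf_def)
      with False FG show ?thesis by (simp add: K_def rinf_def)
    qed
    with h k show "\<exists>h. Option.bind (H1 (left p)) (\<lambda>a. Option.bind (H2 (right p)) (\<lambda>b. Some (pair a b))) = Some h \<and>
        rinf F' G' h \<noteq> {} \<and> (\<forall>r\<in>rinf F' G' h. \<exists>q\<in>rinf F G p. K (pair p r) = Some q)"
      by (simp add: rinf_eq_empty_iff)
  qed
qed

end

text \<open>
  Collects the entries with tag \<open>t\<close> without changing the length of the list: the places of the
  other entries are filled with copies of the first entry with tag \<open>t\<close>.
\<close>

definition select :: "nat \<Rightarrow> baire \<Rightarrow> baire" where
  "select t p = mk_list (if \<exists>i<p 0. elem p i 0 = t then p 0 else 0)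
     (\<lambda>i. tail (elem p (if elem p i 0 = t then i else first_below (p 0) (\<lambda>j. elem p j 0 = t))))"

lemma rstar_select_nonempty:
  assumes "\<And>i. i < p 0 \<Longrightarrow> elem p i 0 = t \<Longrightarrow> F (tail (elem p i)) \<noteq> {}"
  shows "rstar F (select t p) \<noteq> {}"
proof -
  have "F (elem (select t p) i) \<noteq> {}" if i: "i < select t p 0" for i
  proof -
    from i have ex: "\<exists>i<p 0. elem p i 0 = t" and i': "i < p 0"
      by (auto simp: select_def split: if_splits)
    let ?j = "first_below (p 0) (\<lambda>j. elem p j 0 = t)"
    from ex have j: "?j < p 0" by (simp add: first_below_Ex)
    then have "elem p ?j 0 = t" by (rule first_below_holds)
    with j i' assms show ?thesis by (simp add: select_def)
  qed
  then show ?thesis by (auto simp: rstar_eq_empty_iff)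
qed

lemma rstar_select_solution:
  assumes "r \<in> rstar F (select t p)" "i < p 0" "elem p i 0 = t"
  shows "elem r i \<in> F (tail (elem p i))"
proof -
  from assms(2,3) have "select t p 0 = p 0" by (auto simp: select_def)
  with assms(1,2) have "elem r i \<in> F (elem (select t p) i)" by (simp add: rstar_def)
  with assms(3) show ?thesis by (simp add: select_def)
qed

section \<open>Inequalities for finite parallelization\<close>

lemma star_sup_le_prod_star: "red (rstar (rsup F G)) (rprod (rstar F) (rstar G))"
proof (rule redI_total)
  let ?K = "\<lambda>s. mk_list (left s 0) (\<lambda>i. if elem (left s) i 0 = 0
      then cons 0 (elem (left (right s)) i) else cons 1 (elem (right (right s)) i))"
  show "rc ?K" by (unfold baire_defs, intro rc_intros)
  show "rc (\<lambda>p. pair (select 0 p) (select 1 p))"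
    by (unfold select_def baire_defs, intro rc_intros)
  fix p assume "rstar (rsup F G) p \<noteq> {}"
  then have p: "elem p i 0 = 0 \<and> F (tail (elem p i)) \<noteq> {} \<or> elem p i 0 = 1 \<and> G (tail (elem p i)) \<noteq> {}"
    if "i < p 0" for i using that by (auto simp: rstar_eq_empty_iff rsup_eq_empty_iff)
  then show "rprod (rstar F) (rstar G) (pair (select 0 p) (select 1 p)) \<noteq> {}"
    unfolding rprod_eq_empty_iff left_pair right_pair
    using rstar_select_nonempty[of p 0 F] rstar_select_nonempty[of p 1 G] by fastforce
  fix r assume r: "r \<in> rprod (rstar F) (rstar G) (pair (select 0 p) (select 1 p))"
  \<comment> \<open>\<open>select\<close> preserves indices, so the answer to entry \<open>i\<close>
    stands at index \<open>i\<close> of the list selected for its tag.\<close>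
  have "elem (?K (pair p r)) i \<in> rsup F G (elem p i)" if i: "i < p 0" for i
    using p[OF i] r rstar_select_solution[of "left r" F 0 p i] rstar_select_solution[of "right r" G 1 p i] i
    by (auto simp: rprod_def rsup_def)
  then show "?K (pair p r) \<in> rstar (rsup F G) p" by (simp add: rstar_def)
qed

text \<open>The tagged lists are concatenated. The length of the first one, known from the input,
  separates the answers again.\<close>

lemma prod_star_le_star_sup: "red (rprod (rstar F) (rstar G)) (rstar (rsup F G))"
proof (rule redI_total)
  let ?H = "\<lambda>p. mk_list (left p 0 + right p 0) (\<lambda>i. if i < left p 0
      then cons 0 (elem (left p) i) else cons 1 (elem (right p) (i - left p 0)))"
  let ?K = "\<lambda>s. pair (mk_list (left (left s) 0) (\<lambda>i. tail (elem (right s) i)))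
      (mk_list (right (left s) 0) (\<lambda>i. tail (elem (right s) (left (left s) 0 + i))))"
  show "rc ?K" by (unfold baire_defs, intro rc_intros)
  show "rc ?H" by (unfold baire_defs, intro rc_intros)
  fix p assume "rprod (rstar F) (rstar G) p \<noteq> {}"
  then show "rstar (rsup F G) (?H p) \<noteq> {}"
    by (auto simp: rstar_eq_empty_iff rprod_eq_empty_iff rsup_eq_empty_iff)
  fix r assume "r \<in> rstar (rsup F G) (?H p)"
  then have r: "elem r i \<in> rsup F G (elem (?H p) i)" if "i < left p 0 + right p 0" for i
    using that by (simp add: rstar_def)
  have "tail (elem r i) \<in> F (elem (left p) i)" if "i < left p 0" for i
    using r[of i] that by (simp add: rsup_def)
  moreover have "tail (elem r (left p 0 + i)) \<in> G (elem (right p) i)" if "i < right p 0" for i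
    using r[of "left p 0 + i"] that by (simp add: rsup_def)
  ultimately show "?K (pair p r) \<in> rprod (rstar F) (rstar G) p"
    by (simp add: rprod_def rstar_def)
qed

lemma star_prod_le_prod_star: "red (rstar (rprod F G)) (rprod (rstar F) (rstar G))"
proof (rule redI_total)
  let ?H = "\<lambda>p. pair (mk_list (p 0) (\<lambda>i. left (elem p i))) (mk_list (p 0) (\<lambda>i. right (elem p i)))"
  let ?K = "\<lambda>s. mk_list (left s 0) (\<lambda>i. pair (elem (left (right s)) i) (elem (right (right s)) i))"
  show "rc ?K" by (unfold baire_defs, intro rc_intros)
  show "rc ?H" by (unfold baire_defs, intro rc_intros)
  fix p assume "rstar (rprod F G) p \<noteq> {}"
  then show "rprod (rstar F) (rstar G) (?H p) \<noteq> {}"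
    by (auto simp: rstar_eq_empty_iff rprod_eq_empty_iff)
  fix r assume "r \<in> rprod (rstar F) (rstar G) (?H p)"
  then show "?K (pair p r) \<in> rstar (rprod F G) p"
    by (simp add: rprod_def rstar_def)
qed

lemma star_inf_le_inf_star: "red (rstar (rinf F G)) (rinf (rstar F) (rstar G))"
proof (rule redI_total)
  let ?H = "\<lambda>p. pair (mk_list (p 0) (\<lambda>i. left (elem p i))) (mk_list (p 0) (\<lambda>i. right (elem p i)))"
  let ?K = "\<lambda>s. mk_list (left s 0) (\<lambda>i. cons (right s 0) (elem (tail (right s)) i))"
  show "rc ?K" by (unfold baire_defs, intro rc_intros)
  show "rc ?H" by (unfold baire_defs, intro rc_intros)
  fix p assume p: "rstar (rinf F G) p \<noteq> {}"
  then show "rinf (rstar F) (rstar G) (?H p) \<noteq> {}"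
    by (auto simp: rstar_eq_empty_iff rinf_eq_empty_iff)
  fix r assume "r \<in> rinf (rstar F) (rstar G) (?H p)"
  with p show "?K (pair p r) \<in> rstar (rinf F G) p"
    by (auto simp: rinf_def[of "rstar F"] rstar_def[of F] rstar_def[of G] rstar_def[of "rinf F G"]
        rstar_eq_empty_iff rinf_eq_empty_iff) (auto simp: rinf_def)
qed

text \<open>All pairs of entries are asked, arranged as a matrix. Either some row is answered
  entirely on the side of \<open>G\<close>, which solves the second list, or every row contains an
  answer for \<open>F\<close>, which solves the first. Finiteness is essential here: the alternative
  is decided by inspecting all tags.\<close>

lemma inf_star_le_star_inf: "red (rinf (rstar F) (rstar G)) (rstar (rinf F G))"
proof (rule redI_total)
  let ?H = "\<lambda>p. mk_list (left p 0 * right p 0)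
     (\<lambda>t. pair (elem (left p) (t div right p 0)) (elem (right p) (t mod right p 0)))"
  define P where "P n m r i \<longleftrightarrow> (\<forall>j<m. elem r (i * m + j) 0 = 1)" for n m :: nat and r i
  \<comment> \<open>Empty matrices are covered. For \<open>n = 0\<close> there is no row and the
    first list is empty; for \<open>m = 0 < n\<close> row 0 satisfies \<open>P\<close> vacuously and
    the second list is empty.\<close>
  let ?K' = "\<lambda>n m r. if \<exists>i<n. P n m r i
     then cons 1 (mk_list m (\<lambda>j. tail (elem r (first_below n (P n m r) * m + j))))
     else cons 0 (mk_list n (\<lambda>i. tail (elem r (i * m + first_below m (\<lambda>j. elem r (i * m + j) 0 \<noteq> 1)))))"
  let ?K = "\<lambda>s. ?K' (left (left s) 0) (right (left s) 0) (right s)"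
  show "rc ?K" unfolding P_def by (unfold baire_defs, intro rc_intros)
  show "rc ?H" by (unfold baire_defs, intro rc_intros)
  fix p assume p: "rinf (rstar F) (rstar G) p \<noteq> {}"
  let ?n = "left p 0" and ?m = "right p 0"
  from p have FG: "\<And>i. i < ?n \<Longrightarrow> F (elem (left p) i) \<noteq> {}" "\<And>j. j < ?m \<Longrightarrow> G (elem (right p) j) \<noteq> {}"
    by (auto simp: rstar_eq_empty_iff rinf_eq_empty_iff)
  have "t div ?m < ?n" "t mod ?m < ?m" if "t < ?n * ?m" for t
    using that by (auto simp: less_mult_imp_div_less intro!: mod_less_divisor intro: gr0I)
  with FG show "rstar (rinf F G) (?H p) \<noteq> {}"
    by (auto simp: rstar_eq_empty_iff rinf_eq_empty_iff)
  fix r assume "r \<in> rstar (rinf F G) (?H p)"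
  then have r: "elem r t \<in> rinf F G (pair (elem (left p) (t div ?m)) (elem (right p) (t mod ?m)))"
    if "t < ?n * ?m" for t using that by (simp add: rstar_def)
  have r': "elem r (i * ?m + j) \<in> rinf F G (pair (elem (left p) i) (elem (right p) j))"
    if "i < ?n" "j < ?m" for i j
  proof -
    have "i * ?m + j < Suc i * ?m" using that(2) by simp
    also have "\<dots> \<le> ?n * ?m" using that(1) by (intro mult_right_mono) auto
    finally show ?thesis using r[of "i * ?m + j"] that(2) by simp
  qed
  show "?K (pair p r) \<in> rinf (rstar F) (rstar G) p"
  proof (cases "\<exists>i<?n. P ?n ?m r i")
    case True
    then have i: "first_below ?n (P ?n ?m r) < ?n" by (simp add: first_below_Ex)
    then have "P ?n ?m r (first_below ?n (P ?n ?m r))" by (rule first_below_holds)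
    then have "tail (elem r (first_below ?n (P ?n ?m r) * ?m + j)) \<in> G (elem (right p) j)"
      if "j < ?m" for j
      using r'[OF i that] that by (auto simp: P_def rinf_def)
    with True p show ?thesis by (auto simp: rinf_def rstar_def)
  next
    case False
    have "tail (elem r (i * ?m + first_below ?m (\<lambda>j. elem r (i * ?m + j) 0 \<noteq> 1))) \<in> F (elem (left p) i)"
      if i: "i < ?n" for i
    proof -
      let ?j = "first_below ?m (\<lambda>j. elem r (i * ?m + j) 0 \<noteq> 1)"
      from False i have j: "?j < ?m" by (auto simp: first_below_Ex P_def)
      then have "elem r (i * ?m + ?j) 0 \<noteq> 1" by (rule first_below_holds)
      with r'[OF i j] show ?thesis by (auto simp: rinf_def)
    qed
    with False p show ?thesis by (auto simp: rinf_def rstar_def)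
  qed
qed

section \<open>Inequalities for parallelization\<close>

lemma prod_hat_le_hat_sup: "red (rprod (rhat F) (rhat G)) (rhat (rsup F G))"
proof (rule redI_total)
  let ?H = "\<lambda>p. mk_seq (\<lambda>i. if even i then cons 0 (component (left p) (i div 2))
      else cons 1 (component (right p) (i div 2)))"
  let ?K = "\<lambda>s. pair (mk_seq (\<lambda>i. tail (component (right s) (2 * i))))
      (mk_seq (\<lambda>i. tail (component (right s) (Suc (2 * i)))))"
  show "rc ?K" by (unfold baire_defs, intro rc_intros)
  show "rc ?H" by (unfold baire_defs, intro rc_intros)
  fix p assume "rprod (rhat F) (rhat G) p \<noteq> {}"
  then show "rhat (rsup F G) (?H p) \<noteq> {}"
    by (auto simp: rhat_eq_empty_iff rprod_eq_empty_iff rsup_eq_empty_iff)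
  fix r assume "r \<in> rhat (rsup F G) (?H p)"
  then have r: "component r i \<in> rsup F G (component (?H p) i)" for i
    by (simp add: rhat_def)
  have "tail (component r (2 * i)) \<in> F (component (left p) i)"
    "tail (component r (Suc (2 * i))) \<in> G (component (right p) i)" for i
    using r[of "2 * i"] r[of "Suc (2 * i)"] by (simp_all add: rsup_def)
  then show "?K (pair p r) \<in> rprod (rhat F) (rhat G) p"
    by (simp add: rprod_def rhat_def)
qed

lemma sup_hat_le_hat_sup: "red (rsup (rhat F) (rhat G)) (rhat (rsup F G))"
proof (rule redI_total)
  let ?H = "\<lambda>p. mk_seq (\<lambda>i. cons (p 0) (component (tail p) i))"
  let ?K = "\<lambda>s. cons (left s 0) (mk_seq (\<lambda>i. tail (component (right s) i)))"
  show "rc ?K" by (unfold baire_defs, intro rc_intros)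
  show "rc ?H" by (unfold baire_defs, intro rc_intros)
  fix p assume p: "rsup (rhat F) (rhat G) p \<noteq> {}"
  then show "rhat (rsup F G) (?H p) \<noteq> {}"
    by (auto simp: rhat_eq_empty_iff rsup_eq_empty_iff)
  fix r assume "r \<in> rhat (rsup F G) (?H p)"
  with p show "?K (pair p r) \<in> rsup (rhat F) (rhat G) p"
    by (auto simp: rsup_def rhat_def)
qed

lemma hat_prod_le_prod_hat: "red (rhat (rprod F G)) (rprod (rhat F) (rhat G))"
proof (rule redI_total)
  let ?H = "\<lambda>p. pair (mk_seq (\<lambda>i. left (component p i))) (mk_seq (\<lambda>i. right (component p i)))"
  let ?K = "\<lambda>s. mk_seq (\<lambda>i. pair (component (left (right s)) i) (component (right (right s)) i))"
  show "rc ?K" by (unfold baire_defs, intro rc_intros)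
  show "rc ?H" by (unfold baire_defs, intro rc_intros)
  fix p assume "rhat (rprod F G) p \<noteq> {}"
  then show "rprod (rhat F) (rhat G) (?H p) \<noteq> {}"
    by (auto simp: rhat_eq_empty_iff rprod_eq_empty_iff)
  fix r assume "r \<in> rprod (rhat F) (rhat G) (?H p)"
  then show "?K (pair p r) \<in> rhat (rprod F G) p"
    by (simp add: rprod_def rhat_def)
qed

lemma prod_hat_le_hat_prod: "red (rprod (rhat F) (rhat G)) (rhat (rprod F G))"
proof (rule redI_total)
  let ?H = "\<lambda>p. mk_seq (\<lambda>i. pair (component (left p) i) (component (right p) i))"
  let ?K = "\<lambda>s. pair (mk_seq (\<lambda>i. left (component (right s) i))) (mk_seq (\<lambda>i. right (component (right s) i)))"
  show "rc ?K" by (unfold baire_defs, intro rc_intros)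
  show "rc ?H" by (unfold baire_defs, intro rc_intros)
  fix p assume "rprod (rhat F) (rhat G) p \<noteq> {}"
  then show "rhat (rprod F G) (?H p) \<noteq> {}"
    by (auto simp: rhat_eq_empty_iff rprod_eq_empty_iff)
  fix r assume "r \<in> rhat (rprod F G) (?H p)"
  then show "?K (pair p r) \<in> rprod (rhat F) (rhat G) p"
    by (simp add: rprod_def rhat_def)
qed

text \<open>An answer on the right solves a whole sequence on one side, so all entries receive the
  same tag. On the left, tags may vary from entry to entry, which leaves room for a
  separation.\<close>

lemma hat_inf_le_inf_hat: "red (rhat (rinf F G)) (rinf (rhat F) (rhat G))"
proof (rule redI_total)
  let ?H = "\<lambda>p. pair (mk_seq (\<lambda>i. left (component p i))) (mk_seq (\<lambda>i. right (component p i)))"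
  let ?K = "\<lambda>s. mk_seq (\<lambda>i. cons (right s 0) (component (tail (right s)) i))"
  show "rc ?K" by (unfold baire_defs, intro rc_intros)
  show "rc ?H" by (unfold baire_defs, intro rc_intros)
  fix p assume p: "rhat (rinf F G) p \<noteq> {}"
  then show "rinf (rhat F) (rhat G) (?H p) \<noteq> {}"
    by (auto simp: rhat_eq_empty_iff rinf_eq_empty_iff)
  fix r assume "r \<in> rinf (rhat F) (rhat G) (?H p)"
  with p show "?K (pair p r) \<in> rhat (rinf F G) p"
    by (auto simp: rinf_def[of "rhat F"] rhat_def[of F] rhat_def[of G] rhat_def[of "rinf F G"]
        rhat_eq_empty_iff rinf_eq_empty_iff) (auto simp: rinf_def)
qed


section \<open>Operations on degrees\<close>

text \<open>Every point of Baire space serves as its own name. With this problem, each degree except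
  the top has the form \<open>rdeg F\<close>, and statements about degrees become statements about
  relations.\<close>

definition problem_of :: "brel \<Rightarrow> (baire, baire) problem" where
  "problem_of F = \<lparr>src = Some, tgt = Some, val = F\<rparr>"

lemma names_problem_of [simp]: "names (problem_of F) = F"
  by (intro ext) (simp add: names_def problem_of_def)

lemma is_problem_problem_of [simp]: "is_problem (problem_of F)"
  by (auto simp: is_problem_iff problem_of_def)

definition rdeg :: "brel \<Rightarrow> wdegree" where
  "rdeg F = degree_of (problem_of F)"

lemma degree_of_red:
  "is_problem f \<Longrightarrow> degree_of f = Degree {g. is_problem g \<and> red (names f) (names g) \<and> red (names g) (names f)}"
  by (auto simp: degree_of_def equivalent_def reducible_iff_red)

lemma degree_of_eq_rdeg: "is_problem f \<Longrightarrow> degree_of f = rdeg (names f)"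
  by (simp add: degree_of_red rdeg_def)

lemma rdeg_eq_Degree: "rdeg F = Degree {g. is_problem g \<and> red F (names g) \<and> red (names g) F}"
  by (simp add: rdeg_def degree_of_red)

lemma rdegE:
  obtains A where "rdeg F = Degree A" "is_problem (representative A)"
    "red F (names (representative A))" "red (names (representative A)) F"
proof -
  let ?A = "{g :: (baire, baire) problem. is_problem g \<and> red F (names g) \<and> red (names g) F}"
  have "problem_of F \<in> ?A" by (simp add: red_refl)
  then have "representative ?A \<in> ?A" unfolding representative_def by (rule someI)
  then show ?thesis using that[of ?A] by (simp add: rdeg_eq_Degree)
qed

lemma rdeg_eqI:
  assumes "red F G" "red G F"
  shows "rdeg F = rdeg G"
proof -
  have "red F H \<longleftrightarrow> red G H" "red H F \<longleftrightarrow> red H G" for H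
    using red_trans[OF assms(1), of H] red_trans[OF assms(2), of H]
      red_trans[OF _ assms(1), of H] red_trans[OF _ assms(2), of H] by blast+
  then show ?thesis by (simp add: rdeg_eq_Degree)
qed

lemma rdeg_eqD: "rdeg F = rdeg G \<Longrightarrow> red F G"
proof -
  assume "rdeg F = rdeg G"
  moreover have "problem_of G \<in> {g. is_problem g \<and> red G (names g) \<and> red (names g) G}"
    by (simp add: red_refl)
  ultimately have "problem_of G \<in> {g. is_problem g \<and> red F (names g) \<and> red (names g) F}"
    unfolding rdeg_eq_Degree by simp
  then show "red F G" by simp
qed

lemma weihrauch_degreesE:
  assumes "a \<in> \<W>"
  obtains "a = Top_degree" | F where "a = rdeg F"
proof -
  from assms consider "a = Top_degree" | f :: "(baire, baire) problem"
    where "a = degree_of f" "is_problem f"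
    unfolding weihrauch_degrees_def by blast
  then show ?thesis
  proof cases
    case 2
    show ?thesis by (rule that(2)) (use 2 degree_of_eq_rdeg in auto)
  qed (rule that(1))
qed

lemma rdeg_in_degrees: "rdeg F \<in> \<W>"
  unfolding weihrauch_degrees_def rdeg_def by simp

lemma rdeg_le_iff: "rdeg F \<le>\<^sub>W rdeg G \<longleftrightarrow> red F G"
proof -
  obtain A where A: "rdeg F = Degree A" "is_problem (representative A)"
    "red F (names (representative A))" "red (names (representative A)) F" by (rule rdegE)
  obtain B where B: "rdeg G = Degree B" "is_problem (representative B)"
    "red G (names (representative B))" "red (names (representative B)) G" by (rule rdegE)
  have "rdeg F \<le>\<^sub>W rdeg G \<longleftrightarrow> red (names (representative A)) (names (representative B))"
    using A B by (simp add: reducible_iff_red)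
  also have "\<dots> \<longleftrightarrow> red F G"
    using red_trans[OF A(3) red_trans[OF _ B(4)]] red_trans[OF A(4) red_trans[OF _ B(3)]] by blast
  finally show ?thesis .
qed

text \<open>The operations act on representatives picked by choice, of which only equivalence with
  \<open>F\<close> and \<open>G\<close> is known. Monotonicity in both directions makes the
  resulting degree independent of the pick.\<close>

lemma rdeg_ops:
  shows prod_rdeg: "rdeg F \<times>\<^sub>W rdeg G = rdeg (rprod F G)"
    and sup_rdeg: "rdeg F \<squnion>\<^sub>W rdeg G = rdeg (rsup F G)"
    and inf_rdeg: "rdeg F \<sqinter>\<^sub>W rdeg G = rdeg (rinf F G)"
    and star_rdeg: "(rdeg F)\<^sup>\<star> = rdeg (rstar F)"
    and par_rdeg: "wpar (rdeg F) = rdeg (rhat F)"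
    and compprod_rdeg: "universal U \<Longrightarrow> wcompprod U (rdeg F) (rdeg G) = rdeg (rcompprod U F G)"
proof -
  obtain A where A: "rdeg F = Degree A" "is_problem (representative A)"
    "red F (names (representative A))" "red (names (representative A)) F" by (rule rdegE)
  obtain B where B: "rdeg G = Degree B" "is_problem (representative B)"
    "red G (names (representative B))" "red (names (representative B)) G" by (rule rdegE)
  show "rdeg F \<times>\<^sub>W rdeg G = rdeg (rprod F G)"
  proof -
    have "rdeg F \<times>\<^sub>W rdeg G = degree_of (prod_problem (representative A) (representative B))"
      by (simp add: A(1) B(1))
    also have "\<dots> = rdeg (rprod (names (representative A)) (names (representative B)))"
      by (simp only: degree_of_eq_rdeg is_problem_prod[OF A(2) B(2)] names_prod)
    also have "\<dots> = rdeg (rprod F G)"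
      by (intro rdeg_eqI rprod_mono A B)
    finally show ?thesis .
  qed
  show "rdeg F \<squnion>\<^sub>W rdeg G = rdeg (rsup F G)"
  proof -
    have "rdeg F \<squnion>\<^sub>W rdeg G = degree_of (sup_problem (representative A) (representative B))"
      by (simp add: A(1) B(1))
    also have "\<dots> = rdeg (rsup (names (representative A)) (names (representative B)))"
      by (simp only: degree_of_eq_rdeg is_problem_sup[OF A(2) B(2)] names_sup)
    also have "\<dots> = rdeg (rsup F G)"
      by (intro rdeg_eqI rsup_mono A B)
    finally show ?thesis .
  qed
  show "rdeg F \<sqinter>\<^sub>W rdeg G = rdeg (rinf F G)"
  proof -
    have "rdeg F \<sqinter>\<^sub>W rdeg G = degree_of (inf_problem (representative A) (representative B))"
      by (simp add: A(1) B(1))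
    also have "\<dots> = rdeg (rinf (names (representative A)) (names (representative B)))"
      by (simp only: degree_of_eq_rdeg is_problem_inf[OF A(2) B(2)] names_inf[OF A(2) B(2)])
    also have "\<dots> = rdeg (rinf F G)"
      by (intro rdeg_eqI rinf_mono A B)
    finally show ?thesis .
  qed
  show "(rdeg F)\<^sup>\<star> = rdeg (rstar F)"
  proof -
    have "(rdeg F)\<^sup>\<star> = degree_of (star_problem (representative A))"
      by (simp add: A(1))
    also have "\<dots> = rdeg (rstar (names (representative A)))"
      by (simp only: degree_of_eq_rdeg is_problem_star[OF A(2)] names_star)
    also have "\<dots> = rdeg (rstar F)"
      by (intro rdeg_eqI rstar_mono A)
    finally show ?thesis .
  qed
  show "wpar (rdeg F) = rdeg (rhat F)"
  proof -
    have "wpar (rdeg F) = degree_of (hat_problem (representative A))"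
      by (simp add: A(1))
    also have "\<dots> = rdeg (rhat (names (representative A)))"
      by (simp only: degree_of_eq_rdeg is_problem_hat[OF A(2)] names_hat)
    also have "\<dots> = rdeg (rhat F)"
      by (intro rdeg_eqI rhat_mono A)
    finally show ?thesis .
  qed
  show "wcompprod U (rdeg F) (rdeg G) = rdeg (rcompprod U F G)" if U: "universal U"
  proof -
    have "wcompprod U (rdeg F) (rdeg G) = degree_of (compprod_problem U (representative A) (representative B))"
      by (simp add: A(1) B(1))
    also have "\<dots> = rdeg (rcompprod U (names (representative A)) (names (representative B)))"
      by (simp only: degree_of_eq_rdeg is_problem_compprod[OF A(2) B(2)] names_compprod[OF A(2) B(2)])
    also have "\<dots> = rdeg (rcompprod U F G)"
      by (intro rdeg_eqI rcompprod_mono A B U)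
    finally show ?thesis .
  qed
qed

lemma star_compprod_le:
  "universal U \<Longrightarrow> red (rstar (rcompprod U F G)) (rcompprod U (rstar F) (rstar G))"
  by (intro seqred_imp_red seqred_star seqred_rcompprod)

lemma hat_compprod_le:
  "universal U \<Longrightarrow> red (rhat (rcompprod U F G)) (rcompprod U (rhat F) (rhat G))"
  by (intro seqred_imp_red seqred_hat seqred_rcompprod)

lemma Top_ops [simp]:
  "Top_degree \<times>\<^sub>W a = Top_degree" "a \<times>\<^sub>W Top_degree = Top_degree"
  "Top_degree \<squnion>\<^sub>W a = Top_degree" "a \<squnion>\<^sub>W Top_degree = Top_degree"
  "Top_degree \<sqinter>\<^sub>W a = a"
  "wcompprod U Top_degree a = Top_degree" "wcompprod U a Top_degree = Top_degree"
  by (cases a; simp)+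


section \<open>Separations\<close>

definition computable_point :: "baire \<Rightarrow> bool" where
  "computable_point q \<longleftrightarrow> (\<exists>M. run M (\<lambda>_. 0) = Some q)"

lemma computable_point_apply:
  assumes "computable F" "computable_point p" "F p = Some q"
  shows "computable_point q"
proof -
  from assms(2) obtain M where M: "run M (\<lambda>_. 0) = Some p" by (auto simp: computable_point_def)
  have "computable (\<lambda>z. Option.bind (run M z) F)"
    by (intro computable_intros computable_run computable_comp_total[OF assms(1)];
        (unfold baire_defs)?; intro rc_intros)
  then obtain N where "\<And>p q. Option.bind (run M p) F = Some q \<Longrightarrow> run N p = Some q"
    by (rule computableE) blast
  from this[of "\<lambda>_. 0"] M assms(3) have "run N (\<lambda>_. 0) = Some q" by simp
  then show ?thesis unfolding computable_point_def by blast
qed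

lemma computable_point_total:
  assumes "rc T" "computable_point p"
  shows "computable_point (T p)"
  by (rule computable_point_apply[where F = "\<lambda>p. Some (T p)", OF computable_total[OF assms(1)] assms(2) refl])

lemma computable_point_zero: "computable_point (\<lambda>_. 0)"
proof -
  have "run (Proj 0) (\<lambda>_. 0) = Some (\<lambda>n. n)" by (simp add: run_def)
  then have "computable_point (\<lambda>n. n)" unfolding computable_point_def by blast
  from computable_point_total[OF rc_const this] show ?thesis .
qed

lemma computable_point_pair:
  assumes "computable_point p" "computable_point q"
  shows "computable_point (pair p q)"
proof -
  from assms obtain M N where M: "run M (\<lambda>_. 0) = Some p" and N: "run N (\<lambda>_. 0) = Some q"
    by (auto simp: computable_point_def)
  have "computable (\<lambda>z. Option.bind (run M z) (\<lambda>a. Option.bind (run N z) (\<lambda>b. Some (pair a b))))"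
    by (intro computable_intros computable_run computable_comp_total[OF computable_run];
        (unfold baire_defs)?; intro rc_intros)
  from computable_point_apply[OF this computable_point_zero] show ?thesis
    by (simp add: M N)
qed

lemma ex_not_computable_point: "\<exists>q. \<not> computable_point q"
proof -
  \<comment> \<open>The sequence differs from the output of program \<open>n\<close> at place
    \<open>n\<close>. Where that program has no output, the arbitrary value of \<open>the\<close>
    does no harm, since only actual outputs have to be excluded.\<close>
  define q where "q n = Suc (the (run (from_nat n) (\<lambda>_. 0)) n)" for n
  have "run M (\<lambda>_. 0) \<noteq> Some q" for M
  proof
    assume "run M (\<lambda>_. 0) = Some q"
    then show False using q_def[of "to_nat M"] by simp
  qed
  then show ?thesis unfolding computable_point_def by blast
qed

text \<open>Both steps of a reduction preserve computable points. A reduction is thus refuted if a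
  computable instance lacks computable solutions while all instances it could be sent to have one,
  or if it could be sent only to noncomputable instances.\<close>

lemma red_computable_point:
  assumes "red F G" "computable_point p" "F p \<noteq> {}"
  obtains h where "computable_point h" "G h \<noteq> {}"
    "\<And>r. r \<in> G h \<Longrightarrow> computable_point r \<Longrightarrow> \<exists>q\<in>F p. computable_point q"
proof -
  obtain K H where KH: "computable K" "computable H" and
    *: "\<And>p. F p \<noteq> {} \<Longrightarrow> \<exists>h. H p = Some h \<and> G h \<noteq> {} \<and> (\<forall>r\<in>G h. \<exists>q\<in>F p. K (pair p r) = Some q)"
    using assms(1) by (rule redE) blast
  from *[OF assms(3)] obtain h where h: "H p = Some h" "G h \<noteq> {}"
    and r: "\<And>r. r \<in> G h \<Longrightarrow> \<exists>q\<in>F p. K (pair p r) = Some q" by blast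
  show ?thesis
  proof (rule that[of h])
    show "computable_point h" by (rule computable_point_apply[where F = H, OF KH(2) assms(2) h(1)])
    fix s assume s: "s \<in> G h" "computable_point s"
    from r[OF s(1)] obtain q where q: "q \<in> F p" "K (pair p s) = Some q" by blast
    have "computable_point q"
      by (rule computable_point_apply[where F = K, OF KH(1) computable_point_pair[OF assms(2) s(2)] q(2)])
    with q show "\<exists>q\<in>F p. computable_point q" by blast
  qed (use h in simp)
qed

section \<open>Separations by problems with few instances\<close>

lemma star_const_not_le_star_empty:
  assumes "\<not> computable_point q"
  shows "\<not> red (rstar (\<lambda>_. {q})) (rstar (\<lambda>_. {}))"
proof
  assume le: "red (rstar (\<lambda>_. {q})) (rstar (\<lambda>_. {}))"
  \<comment> \<open>\<open>\<lambda>_. 1\<close> names a list of length one, so its solutions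
    compute \<open>q\<close>.\<close>
  have one: "computable_point (\<lambda>_. 1)"
    by (rule computable_point_total[OF rc_const computable_point_zero])
  show False
  proof (rule red_computable_point[OF le one])
    show "rstar (\<lambda>_. {q}) (\<lambda>_. 1) \<noteq> {}" by (simp add: rstar_eq_empty_iff)
    fix h assume h: "rstar (\<lambda>_. {}) h \<noteq> {}" and
      r: "\<And>r. r \<in> rstar (\<lambda>_. {}) h \<Longrightarrow> computable_point r \<Longrightarrow> \<exists>x\<in>rstar (\<lambda>_. {q}) (\<lambda>_. 1). computable_point x"
    \<comment> \<open>A problem without instances admits only the empty list, and the zero sequence
      names the empty list of answers.\<close>
    from h have "h 0 = 0" by (auto simp: rstar_eq_empty_iff)
    then have "(\<lambda>_. 0) \<in> rstar (\<lambda>_. {}) h" by (simp add: rstar_def)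
    from r[OF this computable_point_zero] obtain x where x: "computable_point x" "elem x 0 = q"
      by (auto simp: rstar_def)
    have "rc (\<lambda>x. elem x 0)" by (unfold baire_defs, intro rc_intros)
    from computable_point_total[OF this x(1)] x(2) assms show False by simp
  qed
qed

text \<open>The zero sequence names the empty list, which is an instance even over a problem without
  instances. So the second factor can always be satisfied.\<close>

lemma red_prod_star_empty: "red (rstar F) (rprod (rstar F) (rstar (\<lambda>_. {})))"
proof (rule redI_total)
  show "rc (\<lambda>s. left (right s))" by (unfold baire_defs, intro rc_intros)
  show "rc (\<lambda>p. pair p (\<lambda>_. 0))" by (intro rc_intros)
  show "rprod (rstar F) (rstar (\<lambda>_. {})) (pair p (\<lambda>_. 0)) \<noteq> {}" if "rstar F p \<noteq> {}" for p
    using that by (simp add: rprod_eq_empty_iff rstar_eq_empty_iff)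
qed (simp add: rprod_def)

lemma seqred_star_empty: "seqred (rstar F) (rstar F) (rstar (\<lambda>_. {}))"
proof (rule seqredI)
  show "computable (\<lambda>p. Some (\<lambda>_. 0))" by (intro computable_intros rc_intros)
  show "computable (\<lambda>z. Some (left z))"
    by (intro computable_intros; (unfold baire_defs)?; intro rc_intros)
  show "computable (\<lambda>z. Some (right z))"
    by (intro computable_intros; (unfold baire_defs)?; intro rc_intros)
qed (auto simp: rstar_eq_empty_iff)

lemma rcompprod_empty: "rcompprod U F (\<lambda>_. {}) = (\<lambda>_. {})"
  by (auto simp: rcompprod_def)

lemma rprod_empty: "rprod F (\<lambda>_. {}) = (\<lambda>_. {})"
  by (auto simp: rprod_def)

lemma prod_star_not_le_star_prod:
  "\<exists>F G. \<not> red (rprod (rstar F) (rstar G)) (rstar (rprod F G))"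
proof -
  obtain q where "\<not> computable_point q" using ex_not_computable_point by blast
  from star_const_not_le_star_empty[OF this]
  have "\<not> red (rprod (rstar (\<lambda>_. {q})) (rstar (\<lambda>_. {}))) (rstar (rprod (\<lambda>_. {q}) (\<lambda>_. {})))"
    unfolding rprod_empty by (rule contrapos_nn) (rule red_trans[OF red_prod_star_empty])
  then show ?thesis by (intro exI)
qed

lemma compprod_star_not_le_star_compprod:
  assumes "universal U"
  shows "\<exists>F G. \<not> red (rcompprod U (rstar F) (rstar G)) (rstar (rcompprod U F G))"
proof -
  obtain q where "\<not> computable_point q" using ex_not_computable_point by blast
  from star_const_not_le_star_empty[OF this]
  have "\<not> red (rcompprod U (rstar (\<lambda>_. {q})) (rstar (\<lambda>_. {}))) (rstar (rcompprod U (\<lambda>_. {q}) (\<lambda>_. {})))"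
    unfolding rcompprod_empty by (rule contrapos_nn) (rule red_trans[OF seqred_imp_red[OF assms seqred_star_empty]])
  then show ?thesis by (intro exI)
qed

lemma hat_sup_not_le_prod_hat: "\<exists>F G. \<not> red (rhat (rsup F G)) (rprod (rhat F) (rhat G))"
proof -
  have "\<not> red (rhat (rsup (\<lambda>p. {p}) (\<lambda>_. {}))) (rprod (rhat (\<lambda>p. {p})) (rhat (\<lambda>_. {})))"
  proof
    assume "red (rhat (rsup (\<lambda>p. {p}) (\<lambda>_. {}))) (rprod (rhat (\<lambda>p. {p})) (rhat (\<lambda>_. {})))"
    \<comment> \<open>All components of the zero sequence carry the tag 0, so only the identity is
      asked.\<close>
    moreover have "rhat (rsup (\<lambda>p. {p}) (\<lambda>_. {})) (\<lambda>_. 0) \<noteq> {}"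
      by (simp add: rhat_eq_empty_iff rsup_eq_empty_iff component_def)
    ultimately obtain h where "rprod (rhat (\<lambda>p. {p})) (rhat (\<lambda>_. {})) h \<noteq> {}"
      unfolding red_def by blast
    then show False by (simp add: rprod_eq_empty_iff rhat_eq_empty_iff)
  qed
  then show ?thesis by (intro exI)
qed

text \<open>
  A single answer of \<open>\<lambda>p. {\<lambda>_. q (p 0)}\<close> is computable, whereas its parallelization yields \<open>q\<close>, the
  only instance of the outer problem.
\<close>

lemma compprod_hat_not_le_hat_compprod:
  assumes "universal U"
  shows "\<exists>F G. \<not> red (rcompprod U (rhat F) (rhat G)) (rhat (rcompprod U F G))"
proof -
  obtain q where q: "\<not> computable_point q" using ex_not_computable_point by blast
  let ?F = "\<lambda>p :: baire. if p = q then {\<lambda>_ :: nat. 0 :: nat} else {}"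
  let ?G = "\<lambda>p :: baire. {\<lambda>_ :: nat. q (p 0)}"
  \<comment> \<open>The trivial problem already separates: reducing it to a problem requires a
    computable instance of that problem. On the left such an instance exists.\<close>
  have "seqred (\<lambda>_. {\<lambda>_. 0}) (rhat ?F) (rhat ?G)"
  proof (rule seqredI)
    \<comment> \<open>Component \<open>i\<close> asks for the value \<open>q i\<close>. The
      collected answers then make every component of the second query equal to
      \<open>q\<close>.\<close>
    show "computable (\<lambda>p. Some (mk_seq (\<lambda>i _. i)))"
      by (intro computable_intros rc_intros)
    show "computable (\<lambda>z. Some (mk_seq (\<lambda>_ i. component (right z) i 0)))"
      by (intro computable_intros; (unfold baire_defs)?; intro rc_intros)
    show "computable (\<lambda>z. Some (\<lambda>_. 0))"
      by (intro computable_intros rc_intros)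
    fix p :: baire
    have "rhat ?F (mk_seq (\<lambda>_ i. component y i 0)) \<noteq> {}" if "y \<in> rhat ?G (mk_seq (\<lambda>i _. i))" for y
    proof -
      from that have "component y i = (\<lambda>_. q i)" for i by (simp add: rhat_def)
      then show ?thesis by (simp add: rhat_eq_empty_iff)
    qed
    moreover have "rhat ?G (mk_seq (\<lambda>i _. i)) \<noteq> {}" by (simp add: rhat_eq_empty_iff)
    ultimately show "\<exists>x. Some (mk_seq (\<lambda>i _. i)) = Some x \<and> rhat ?G x \<noteq> {} \<and> (\<forall>y\<in>rhat ?G x.
        \<exists>u. Some (mk_seq (\<lambda>_ i. component (right (pair p y)) i 0)) = Some u \<and> rhat ?F u \<noteq> {} \<and>
        (\<forall>v\<in>rhat ?F u. \<exists>q\<in>{\<lambda>_. 0}. Some (\<lambda>_. 0) = Some q))"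
      by simp
  qed
  then have 1: "red (\<lambda>_. {\<lambda>_. 0}) (rcompprod U (rhat ?F) (rhat ?G))"
    by (rule seqred_imp_red[OF assms])
  have "\<not> red (\<lambda>_. {\<lambda>_. 0}) (rhat (rcompprod U ?F ?G))"
  proof
    assume r: "red (\<lambda>_. {\<lambda>_. 0}) (rhat (rcompprod U ?F ?G))"
    show False
    proof (rule red_computable_point[OF r computable_point_zero])
      show "{\<lambda>_ :: nat. 0 :: nat} \<noteq> {}" by simp
      fix h assume h: "computable_point h" "rhat (rcompprod U ?F ?G) h \<noteq> {}"
      let ?P = "component h 0"
      from h(2) have "rcompprod U ?F ?G ?P \<noteq> {}" by (simp add: rhat_eq_empty_iff)
      \<comment> \<open>Only one value of \<open>q\<close> enters the input of the machine, which is
        therefore computable. Yet the domain condition forces the right half of its output to be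
        \<open>q\<close>.\<close>
      then have "\<exists>s. run U (pair (left ?P) (pair (\<lambda>_. q (right ?P 0)) (\<lambda>_. 0))) = Some s \<and> ?F (right s) \<noteq> {}"
        by (rule rcompprod_run) simp
      then obtain s where s: "run U (pair (left ?P) (pair (\<lambda>_. q (right ?P 0)) (\<lambda>_. 0))) = Some s"
        "right s = q" by (metis (full_types))
      have "rc (\<lambda>h. left (component h 0))" by (unfold baire_defs, intro rc_intros)
      from computable_point_total[OF this h(1)] have 2: "computable_point (left ?P)" .
      have 3: "computable_point (\<lambda>_. c)" for c
        by (rule computable_point_total[OF rc_const computable_point_zero])
      have "computable_point s"
        by (rule computable_point_apply[where F = "run U", OF computable_run
              computable_point_pair[OF 2 computable_point_pair[OF 3 3]] s(1)])
      moreover have "rc right" unfolding right_def[abs_def] by (intro rc_intros)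
      ultimately show False using q s(2) computable_point_total[of right s] by simp
    qed
  qed
  then have "\<not> red (rcompprod U (rhat ?F) (rhat ?G)) (rhat (rcompprod U ?F ?G))"
    by (rule contrapos_nn) (rule red_trans[OF 1])
  then show ?thesis by (intro exI)
qed

section \<open>Separations by diagonalization\<close>

lemma rhat_component: "q \<in> rhat F p \<Longrightarrow> component q i \<in> F (component p i)"
  by (simp add: rhat_def)

definition lpo_sol :: "baire \<Rightarrow> baire" where
  "lpo_sol p = (\<lambda>_. if \<forall>n. p n = 0 then 0 else 1)"

definition lpo :: brel where
  "lpo p = {lpo_sol p}"

definition avoid :: "(nat \<Rightarrow> nat) \<Rightarrow> brel" where
  "avoid v p = {y. y 0 \<noteq> v (p 0)}"

lemma lpo_nonempty [simp]: "lpo p \<noteq> {}" by (simp add: lpo_def)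

lemma avoid_nonempty [simp]: "avoid v p \<noteq> {}"
proof -
  have "(\<lambda>_. Suc (v (p 0))) \<in> avoid v p" by (simp add: avoid_def)
  then show ?thesis by blast
qed

definition spike :: "nat \<Rightarrow> baire" where
  "spike k = (\<lambda>n. if n = k then 1 else 0)"

lemma lpo_sol_zero: "lpo_sol (\<lambda>_. 0) 0 = 0" and lpo_sol_spike: "lpo_sol (spike k) 0 = 1"
  by (auto simp: lpo_sol_def spike_def)

text \<open>Passing from functions to programs makes the candidates for a reduction countable, so
  that a diagonal argument can number them.\<close>

lemma red_run:
  assumes "red F G"
  obtains M N where "\<And>p. F p \<noteq> {} \<Longrightarrow>
    \<exists>h. run N p = Some h \<and> G h \<noteq> {} \<and> (\<forall>r\<in>G h. \<exists>q\<in>F p. run M (pair p r) = Some q)"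
proof -
  obtain K H where KH: "computable K" "computable H" and
    *: "\<And>p. F p \<noteq> {} \<Longrightarrow> \<exists>h. H p = Some h \<and> G h \<noteq> {} \<and> (\<forall>r\<in>G h. \<exists>q\<in>F p. K (pair p r) = Some q)"
    using assms(1) by (rule redE) blast
  obtain M where M: "\<And>p q. K p = Some q \<Longrightarrow> run M p = Some q" using computableE[OF KH(1)] by blast
  obtain N where N: "\<And>p q. H p = Some q \<Longrightarrow> run N p = Some q" using computableE[OF KH(2)] by blast
  show ?thesis by (rule that[of N M]) (use * M N in metis)
qed

lemma run_continuous:
  assumes "run M p = Some q"
  shows "\<exists>L. \<forall>p' q'. agree L p p' \<longrightarrow> run M p' = Some q' \<longrightarrow> agree B q q'"
proof -
  from assms have e: "eval p M [n] = Some (q n)" for n by (simp add: run_eq_Some)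
  have "\<forall>n\<in>set [0..<B]. \<exists>L. \<forall>L'\<ge>L. \<forall>p'. agree L' p p' \<longrightarrow> eval p' M [n] = Some (q n)"
  proof
    fix n
    from eval_continuous[OF e[of n]] obtain L where "\<forall>p'. agree L p p' \<longrightarrow> eval p' M [n] = Some (q n)"
      by blast
    then show "\<exists>L. \<forall>L'\<ge>L. \<forall>p'. agree L' p p' \<longrightarrow> eval p' M [n] = Some (q n)"
      using agree_mono by blast
  qed
  from uniform_threshold[OF this] obtain L where
    "\<forall>p'. agree L p p' \<longrightarrow> (\<forall>n\<in>set [0..<B]. eval p' M [n] = Some (q n))" by blast
  then show ?thesis by (intro exI[of _ L]) (auto simp: agree_def run_eq_Some)
qed

lemma agree_pair: "agree L p p' \<Longrightarrow> agree L r r' \<Longrightarrow> agree L (pair p r) (pair p' r')"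
  by (auto simp: agree_def pair_def)

text \<open>A query to a join of parallelizations commits itself to one side by its first symbol. On
  the side of LPO the answer is determined by the query, hence \<open>diag\<close> can anticipate
  what is made of it. On the other side the commitment persists near the zero sequence, and an
  answer can be continued to nearby queries; LPO at zero would then be decided from a
  prefix.\<close>

lemma hat_sup_not_le_sup_hat: "\<exists>F G. \<not> red (rhat (rsup F G)) (rsup (rhat F) (rhat G))"
proof -
  \<comment> \<open>Component 0 is the instance of LPO, and component \<open>Suc n\<close> asks to
    avoid \<open>diag n\<close>. The number of every candidate thus occurs in one instance.\<close>
  define I where "I z = mk_seq (\<lambda>i. if i = 0 then cons 0 z else cons 1 (\<lambda>_. i - 1))" for z
  let ?z = "\<lambda>_ :: nat. 0 :: nat"
  \<comment> \<open>If \<open>(M, N)\<close> has code \<open>e\<close> and queries \<open>lpo\<close> on \<open>I 0\<close>, then \<open>diag e\<close> is its answer to instance \<open>e\<close>.\<close>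
  define diag where "diag e = (case from_nat e of (M, N) \<Rightarrow>
     let h = the (run N (I ?z)); r = cons 0 (mk_seq (\<lambda>i. lpo_sol (component (tail h) i)))
     in component (the (run M (pair (I ?z) r))) (Suc e) 1)" for e
  let ?F = "rhat (rsup lpo (avoid diag))" and ?G = "rsup (rhat lpo) (rhat (avoid diag))"
  have ne: "?F (I z) \<noteq> {}" for z
    by (auto simp: rhat_eq_empty_iff rsup_eq_empty_iff I_def)
  have "\<not> red ?F ?G"
  proof
    assume "red ?F ?G"
    then obtain M N where MN: "\<And>p. ?F p \<noteq> {} \<Longrightarrow>
        \<exists>h. run N p = Some h \<and> ?G h \<noteq> {} \<and> (\<forall>r\<in>?G h. \<exists>q\<in>?F p. run M (pair p r) = Some q)"
      by (rule red_run) blast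
    from MN[OF ne[of ?z]] obtain h where h: "run N (I ?z) = Some h" "?G h \<noteq> {}"
      and M: "\<And>r. r \<in> ?G h \<Longrightarrow> \<exists>q\<in>?F (I ?z). run M (pair (I ?z) r) = Some q" by blast
    from h(2) consider "h 0 = 0" | "h 0 = 1" by (auto simp: rsup_def)
    then show False
    proof cases
      case 1
      let ?r = "cons 0 (mk_seq (\<lambda>i. lpo_sol (component (tail h) i)))"
      have "?r \<in> ?G h" using 1 by (simp add: rsup_def rhat_def lpo_def)
      from M[OF this] obtain q where q: "q \<in> ?F (I ?z)" "run M (pair (I ?z) ?r) = Some q" by blast
      let ?e = "to_nat (M, N)"
      have "diag ?e = component q (Suc ?e) 1"
        by (simp add: diag_def h q(2))
      moreover have "component q (Suc ?e) \<in> rsup lpo (avoid diag) (cons 1 (\<lambda>_. ?e))"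
        using rhat_component[OF q(1), of "Suc ?e"] by (simp add: I_def)
      ultimately show False by (simp add: rsup_def avoid_def tail_def cons_def)
    next
      case 2
      from h(2) obtain r where r: "r \<in> ?G h" by blast
      from M[OF r] obtain q where q: "q \<in> ?F (I ?z)" "run M (pair (I ?z) r) = Some q" by blast
      \<comment> \<open>Position 1 comes right after the tag of component 0 and carries the answer
        of LPO.\<close>
      have pos: "component q 0 1 = q (prod_encode (0, 1))" for q by (simp add: component_def)
      have F0: "component q 0 1 = lpo_sol z 0" if "q \<in> ?F (I z)" for q z
      proof -
        from rhat_component[OF that, of 0] have "tail (component q 0) \<in> lpo z" by (simp add: I_def rsup_def)
        then have "tail (component q 0) 0 = lpo_sol z 0" by (simp add: lpo_def)
        then show ?thesis by (simp add: tail_def)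
      qed
      obtain L1 where L1: "\<And>p' q'. agree L1 (pair (I ?z) r) p' \<Longrightarrow> run M p' = Some q' \<Longrightarrow>
          agree (Suc (prod_encode (0, 1))) q q'" using run_continuous[OF q(2)] by blast
      \<comment> \<open>The successor makes \<open>L\<close> positive, so that the nearby query
        \<open>h'\<close> has the same tag as \<open>h\<close>.\<close>
      define L where "L = Suc L1"
      obtain L2 where L2: "\<And>p' q'. agree L2 (I ?z) p' \<Longrightarrow> run N p' = Some q' \<Longrightarrow> agree L h q'"
        using run_continuous[OF h(1)] by blast
      let ?k = "max L L2"
      have I: "agree ?k (I ?z) (I (spike ?k))"
      proof -
        have "spike ?k (psnd n - 1) = 0" if "n < ?k" for n
          using that psnd_le[of n] by (auto simp: spike_def)
        then show ?thesis by (auto simp: agree_def I_def mk_seq_def cons_def)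
      qed
      from MN[OF ne[of "spike ?k"]] obtain h' where h': "run N (I (spike ?k)) = Some h'"
        and M': "\<And>r. r \<in> ?G h' \<Longrightarrow> \<exists>q\<in>?F (I (spike ?k)). run M (pair (I (spike ?k)) r) = Some q" by blast
      have hh': "agree L h h'" by (rule L2[OF agree_mono[OF I] h']) simp
      \<comment> \<open>The value at a position answers the query value at the same position. Below
        \<open>L\<close> both queries agree and \<open>r\<close> remains correct; from
        \<open>L\<close> on, a successor avoids the forbidden value.\<close>
      define r' where "r' n = (if n < L then r n else Suc (diag (h' n)))" for n
      have h0: "h' 0 = 1" "r' 0 = 1" using hh' 2 r by (auto simp: agree_def L_def r'_def rsup_def)
      have "component (tail r') i 0 \<noteq> diag (component (tail h') i 0)" for i
      proof -
        have "component (tail r) i 0 \<noteq> diag (component (tail h) i 0)"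
          using r 2 by (simp add: rsup_def rhat_def avoid_def)
        then show ?thesis
          using hh' by (auto simp: component_def tail_def r'_def agree_def)
      qed
      then have "r' \<in> ?G h'" using h0 by (simp add: rsup_def rhat_def avoid_def)
      from M'[OF this] obtain q' where q': "q' \<in> ?F (I (spike ?k))"
        "run M (pair (I (spike ?k)) r') = Some q'" by blast
      have "agree L1 r r'" by (auto simp: agree_def r'_def L_def)
      then have "agree L1 (pair (I ?z) r) (pair (I (spike ?k)) r')"
        using agree_mono[OF I, of L1] by (intro agree_pair) (auto simp: L_def)
      from L1[OF this q'(2)] have "component q' 0 1 = component q 0 1"
        unfolding pos by (simp add: agree_def)
      with F0[OF q(1)] F0[OF q'(1)] show False
        by (simp add: lpo_sol_zero lpo_sol_spike)
    qed
  qed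
  then show ?thesis by (intro exI)
qed

text \<open>Now the answer of the reduction commits itself to a side, after reading a prefix. All
  queries are first answered on the side of \<open>avoid\<close>. A commitment to LPO would decide
  it from finitely many values; after a commitment to \<open>avoid\<close>, the unread answers are
  replaced by those of LPO, which do not depend on \<open>diag\<close>.\<close>

lemma inf_hat_not_le_hat_inf: "\<exists>F G. \<not> red (rinf (rhat F) (rhat G)) (rhat (rinf F G))"
proof -
  \<comment> \<open>Again one instance contains all numbers: component \<open>n\<close> on the right
    asks to avoid \<open>diag n\<close>, while on the left only component 0 varies with
    \<open>z\<close>.\<close>
  define J where "J z = pair (mk_seq (\<lambda>i. if i = 0 then z else (\<lambda>_. 0))) (mk_seq (\<lambda>i _. i))" for z
  let ?z = "\<lambda>_ :: nat. 0 :: nat"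
  define mix where "mix ys h = mk_seq (\<lambda>i. if i < length ys then cons 1 (\<lambda>_. ys ! i)
      else cons 0 (lpo_sol (left (component h i))))" for ys h
  \<comment> \<open>Once \<open>M\<close> has committed itself to the second problem, it has seen a finite part of the answers,
    recorded in \<open>ys\<close>; all other queries can then be answered on the side of \<open>lpo\<close>.\<close>
  define diag where "diag e = (case from_nat e of (M, N, ys) \<Rightarrow>
     component (tail (the (run M (pair (J ?z) (mix ys (the (run N (J ?z)))))))) e 0)" for e
  define ans where "ans h = mk_seq (\<lambda>i. cons 1 (\<lambda>_. Suc (diag (right (component h i) 0))))" for h
  let ?F = "rinf (rhat lpo) (rhat (avoid diag))" and ?G = "rhat (rinf lpo (avoid diag))"
  have ne: "?F (J z) \<noteq> {}" for z
    by (auto simp: rhat_eq_empty_iff rinf_eq_empty_iff J_def)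
  have ans: "ans h \<in> ?G h" for h
    by (auto simp: rhat_def rinf_def ans_def) (simp add: avoid_def)
  have "\<not> red ?F ?G"
  proof
    assume "red ?F ?G"
    then obtain M N where MN: "\<And>p. ?F p \<noteq> {} \<Longrightarrow>
        \<exists>h. run N p = Some h \<and> ?G h \<noteq> {} \<and> (\<forall>r\<in>?G h. \<exists>q\<in>?F p. run M (pair p r) = Some q)"
      by (rule red_run) blast
    from MN[OF ne[of ?z]] obtain h where h: "run N (J ?z) = Some h"
      and M: "\<And>r. r \<in> ?G h \<Longrightarrow> \<exists>q\<in>?F (J ?z). run M (pair (J ?z) r) = Some q" by blast
    from M[OF ans] obtain q where q: "q \<in> ?F (J ?z)" "run M (pair (J ?z) (ans h)) = Some q" by blast
    \<comment> \<open>The bound covers the tag at position 0 and the position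
      \<open>Suc (prod_encode (0, 0))\<close>, where the first answer of LPO would stand.\<close>
    obtain L1 where L1: "\<And>p' q'. agree L1 (pair (J ?z) (ans h)) p' \<Longrightarrow> run M p' = Some q' \<Longrightarrow>
        agree (Suc (Suc (prod_encode (0, 0)))) q q'" using run_continuous[OF q(2)] by blast
    from q(1) consider "q 0 = 0" | "q 0 = 1" by (auto simp: rinf_def)
    then show False
    proof cases
      case 1
      have F0: "q (Suc (prod_encode (0, 0))) = lpo_sol z 0" if "q \<in> ?F (J z)" "q 0 = 0" for q z
      proof -
        from that have "component (tail q) 0 \<in> lpo (component (left (J z)) 0)"
          by (simp add: rinf_def rhat_def)
        then have "component (tail q) 0 0 = lpo_sol z 0" by (simp add: lpo_def J_def)
        then show ?thesis by (simp add: component_def tail_def)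
      qed
      \<comment> \<open>\<open>right (component h i) 0\<close> is the value of \<open>h\<close> at
        \<open>prod_encode (i, 1)\<close>. The prefix of length \<open>L1\<close> of
        \<open>ans h\<close> depends only on these values for \<open>i < L1\<close>.\<close>
      obtain B where B: "\<And>i. i < L1 \<Longrightarrow> prod_encode (i, 1) < B"
        using finite_nat_set_iff_bounded[of "(\<lambda>i. prod_encode (i, 1)) ` {..<L1}"] by auto
      obtain L2 where L2: "\<And>p' q'. agree L2 (J ?z) p' \<Longrightarrow> run N p' = Some q' \<Longrightarrow> agree B h q'"
        using run_continuous[OF h] by blast
      let ?k = "max L1 L2"
      have J: "agree ?k (J ?z) (J (spike ?k))"
      proof -
        have "spike ?k (psnd (n div 2)) = 0" if "n < ?k" for n
          using that psnd_le[of "n div 2"] by (auto simp: spike_def)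
        then show ?thesis by (auto simp: agree_def J_def mk_seq_def pair_def)
      qed
      from MN[OF ne[of "spike ?k"]] obtain h' where h': "run N (J (spike ?k)) = Some h'"
        and M': "\<And>r. r \<in> ?G h' \<Longrightarrow> \<exists>q\<in>?F (J (spike ?k)). run M (pair (J (spike ?k)) r) = Some q" by blast
      have hh': "agree B h h'" by (rule L2[OF agree_mono[OF J] h']) simp
      have "right (component h' i) 0 = right (component h i) 0" if "i < L1" for i
        using hh' B[OF that] by (simp add: agree_def right_def component_def)
      then have "agree L1 (ans h) (ans h')"
        using le_less_trans[OF pfst_le, of _ L1] by (simp add: agree_def ans_def mk_seq_def)
      then have a: "agree L1 (pair (J ?z) (ans h)) (pair (J (spike ?k)) (ans h'))"
        using agree_mono[OF J, of L1] by (intro agree_pair) auto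
      from M'[OF ans] obtain q' where q': "q' \<in> ?F (J (spike ?k))"
        "run M (pair (J (spike ?k)) (ans h')) = Some q'" by blast
      from L1[OF a q'(2)] 1 have "q' 0 = 0" "q' (Suc (prod_encode (0, 0))) = q (Suc (prod_encode (0, 0)))"
        by (auto simp: agree_def)
      with F0[OF q(1) 1] F0[OF q'(1)] show False
        by (simp add: lpo_sol_zero lpo_sol_spike)
    next
      case 2
      \<comment> \<open>The list is computed from \<open>diag\<close>, but there is no circularity:
        \<open>diag\<close> is defined for codes with arbitrary lists, and this one is merely a
        possible value.\<close>
      define ys where "ys = map (\<lambda>i. Suc (diag (right (component h i) 0))) [0..<L1]"
      have "agree L1 (ans h) (mix ys h)"
        unfolding agree_def ans_def mix_def mk_seq_def
        using le_less_trans[OF pfst_le, of _ L1] by (auto simp: ys_def)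
      then have a: "agree L1 (pair (J ?z) (ans h)) (pair (J ?z) (mix ys h))"
        by (intro agree_pair) (auto simp: agree_def)
      have "mix ys h \<in> ?G h"
        by (auto simp: rhat_def rinf_def mix_def ys_def lpo_def) (simp add: avoid_def)
      from M[OF this] obtain x where x: "x \<in> ?F (J ?z)" "run M (pair (J ?z) (mix ys h)) = Some x" by blast
      from L1[OF a x(2)] 2 have "x 0 = 1" by (simp add: agree_def)
      with x(1) have *: "component (tail x) e \<in> avoid diag (component (right (J ?z)) e)" for e
        by (simp add: rinf_def rhat_def)
      let ?e = "to_nat (M, N, ys)"
      have "diag ?e = component (tail x) ?e 0"
        by (simp add: diag_def h x(2))
      with *[of ?e] show False by (simp add: avoid_def J_def)
    qed
  qed
  then show ?thesis by (intro exI)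
qed

theorem proposition4p11:
  fixes U :: program
  assumes "universal U"
  shows
    "(\<forall>a\<in>\<W>. \<forall>b\<in>\<W>.
        (a \<squnion>\<^sub>W b)\<^sup>\<star> = a\<^sup>\<star> \<times>\<^sub>W b\<^sup>\<star> \<and>
        (a \<times>\<^sub>W b)\<^sup>\<star> \<le>\<^sub>W a\<^sup>\<star> \<times>\<^sub>W b\<^sup>\<star> \<and>
        (a \<sqinter>\<^sub>W b)\<^sup>\<star> = a\<^sup>\<star> \<sqinter>\<^sub>W b\<^sup>\<star> \<and>
        (wcompprod U a b)\<^sup>\<star> \<le>\<^sub>W wcompprod U (a\<^sup>\<star>) (b\<^sup>\<star>) \<and>
        wpar a \<times>\<^sub>W wpar b \<le>\<^sub>W wpar (a \<squnion>\<^sub>W b) \<and>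
        wpar a \<squnion>\<^sub>W wpar b \<le>\<^sub>W wpar (a \<squnion>\<^sub>W b) \<and>
        wpar (a \<times>\<^sub>W b) = wpar a \<times>\<^sub>W wpar b \<and>
        wpar (a \<sqinter>\<^sub>W b) \<le>\<^sub>W wpar a \<sqinter>\<^sub>W wpar b \<and>
        wpar (wcompprod U a b) \<le>\<^sub>W wcompprod U (wpar a) (wpar b)) \<and>
     (\<exists>a\<in>\<W>. \<exists>b\<in>\<W>. (a \<times>\<^sub>W b)\<^sup>\<star> \<noteq> a\<^sup>\<star> \<times>\<^sub>W b\<^sup>\<star>) \<and>
     (\<exists>a\<in>\<W>. \<exists>b\<in>\<W>. (wcompprod U a b)\<^sup>\<star> \<noteq> wcompprod U (a\<^sup>\<star>) (b\<^sup>\<star>)) \<and>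
     (\<exists>a\<in>\<W>. \<exists>b\<in>\<W>. wpar a \<times>\<^sub>W wpar b \<noteq> wpar (a \<squnion>\<^sub>W b)) \<and>
     (\<exists>a\<in>\<W>. \<exists>b\<in>\<W>. wpar a \<squnion>\<^sub>W wpar b \<noteq> wpar (a \<squnion>\<^sub>W b)) \<and>
     (\<exists>a\<in>\<W>. \<exists>b\<in>\<W>. wpar (a \<sqinter>\<^sub>W b) \<noteq> wpar a \<sqinter>\<^sub>W wpar b) \<and>
     (\<exists>a\<in>\<W>. \<exists>b\<in>\<W>. wpar (wcompprod U a b) \<noteq> wcompprod U (wpar a) (wpar b))"
proof (intro conjI ballI)
  note ops = rdeg_ops compprod_rdeg[OF assms]
  fix a b assume ab: "a \<in> \<W>" "b \<in> \<W>"
  show "(a \<squnion>\<^sub>W b)\<^sup>\<star> = a\<^sup>\<star> \<times>\<^sub>W b\<^sup>\<star>"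
    using ab by (elim weihrauch_degreesE)
      (simp_all add: rdeg_ops rdeg_eqI star_sup_le_prod_star prod_star_le_star_sup)
  show "(a \<times>\<^sub>W b)\<^sup>\<star> \<le>\<^sub>W a\<^sup>\<star> \<times>\<^sub>W b\<^sup>\<star>"
    using ab by (elim weihrauch_degreesE)
      (simp_all add: rdeg_ops rdeg_le_iff star_prod_le_prod_star)
  show "(a \<sqinter>\<^sub>W b)\<^sup>\<star> = a\<^sup>\<star> \<sqinter>\<^sub>W b\<^sup>\<star>"
    using ab by (elim weihrauch_degreesE)
      (simp_all add: rdeg_ops rdeg_eqI star_inf_le_inf_star inf_star_le_star_inf)
  show "(wcompprod U a b)\<^sup>\<star> \<le>\<^sub>W wcompprod U (a\<^sup>\<star>) (b\<^sup>\<star>)"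
    using ab by (elim weihrauch_degreesE)
      (simp_all add: ops rdeg_le_iff star_compprod_le assms)
  show "wpar a \<times>\<^sub>W wpar b \<le>\<^sub>W wpar (a \<squnion>\<^sub>W b)"
    using ab by (elim weihrauch_degreesE)
      (simp_all add: rdeg_ops rdeg_le_iff prod_hat_le_hat_sup)
  show "wpar a \<squnion>\<^sub>W wpar b \<le>\<^sub>W wpar (a \<squnion>\<^sub>W b)"
    using ab by (elim weihrauch_degreesE)
      (simp_all add: rdeg_ops rdeg_le_iff sup_hat_le_hat_sup)
  show "wpar (a \<times>\<^sub>W b) = wpar a \<times>\<^sub>W wpar b"
    using ab by (elim weihrauch_degreesE)
      (simp_all add: rdeg_ops rdeg_eqI hat_prod_le_prod_hat prod_hat_le_hat_prod)
  show "wpar (a \<sqinter>\<^sub>W b) \<le>\<^sub>W wpar a \<sqinter>\<^sub>W wpar b"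
    \<comment> \<open>If exactly one degree is the top, both sides are the parallelization of the
      other, whence \<open>red_refl\<close>.\<close>
    using ab by (elim weihrauch_degreesE)
      (simp_all add: rdeg_ops rdeg_le_iff hat_inf_le_inf_hat red_refl)
  show "wpar (wcompprod U a b) \<le>\<^sub>W wcompprod U (wpar a) (wpar b)"
    using ab by (elim weihrauch_degreesE)
      (simp_all add: ops rdeg_le_iff hat_compprod_le assms)
next
  note ops = rdeg_ops compprod_rdeg[OF assms]
  \<comment> \<open>\<open>P\<close> stands for an inequality of degrees. As a disjunction, the
    second premise follows from the equations for \<open>rdeg\<close>; equality of degrees would
    yield the excluded reduction.\<close>
  have diff: "\<exists>a\<in>\<W>. \<exists>b\<in>\<W>. P a b"
    if "\<exists>F G. \<not> red (R F G) (S F G)" "\<And>F G. rdeg (R F G) = rdeg (S F G) \<or> P (rdeg F) (rdeg G)"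
    for P and R S :: "brel \<Rightarrow> brel \<Rightarrow> brel"
    using that rdeg_eqD rdeg_in_degrees by metis
  show "\<exists>a\<in>\<W>. \<exists>b\<in>\<W>. (a \<times>\<^sub>W b)\<^sup>\<star> \<noteq> a\<^sup>\<star> \<times>\<^sub>W b\<^sup>\<star>"
    by (rule diff[OF prod_star_not_le_star_prod]) (auto simp: rdeg_ops)
  show "\<exists>a\<in>\<W>. \<exists>b\<in>\<W>. (wcompprod U a b)\<^sup>\<star> \<noteq> wcompprod U (a\<^sup>\<star>) (b\<^sup>\<star>)"
    by (rule diff[OF compprod_star_not_le_star_compprod[OF assms]]) (auto simp: ops)
  show "\<exists>a\<in>\<W>. \<exists>b\<in>\<W>. wpar a \<times>\<^sub>W wpar b \<noteq> wpar (a \<squnion>\<^sub>W b)"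
    by (rule diff[OF hat_sup_not_le_prod_hat]) (auto simp: rdeg_ops)
  show "\<exists>a\<in>\<W>. \<exists>b\<in>\<W>. wpar a \<squnion>\<^sub>W wpar b \<noteq> wpar (a \<squnion>\<^sub>W b)"
    by (rule diff[OF hat_sup_not_le_sup_hat]) (auto simp: rdeg_ops)
  show "\<exists>a\<in>\<W>. \<exists>b\<in>\<W>. wpar (a \<sqinter>\<^sub>W b) \<noteq> wpar a \<sqinter>\<^sub>W wpar b"
    by (rule diff[OF inf_hat_not_le_hat_inf]) (auto simp: rdeg_ops)
  show "\<exists>a\<in>\<W>. \<exists>b\<in>\<W>. wpar (wcompprod U a b) \<noteq> wcompprod U (wpar a) (wpar b)"
    by (rule diff[OF compprod_hat_not_le_hat_compprod[OF assms]]) (auto simp: ops)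
qed

end
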